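(* Let $S$ be a one-dimensional random walk with i.i.d. increments $X_1,X_2,\ldots$ satisfying $\mathbb{E}|X_1|\in(0,\infty)$ and $\mathbb{E}X_1=0$, and assume that the distribution of $X_1$ is either arithmetic or spread out. Then $$\lim_{n\to\infty}\bigl\|\mathbb{P}_x(O_n\in\cdot)-\pi_+(\cdot)\bigr\|_{\mathrm{TV}}=0\qquad\text{for all } x\in\mathcal{Z}_d.$$
   Context: $S_n=S_0+X_1+\cdots+X_n$, with $S_0$ independent of the i.i.d. real increments $X_1,X_2,\ldots$; $\mathbb{P}_x$ is the law under which $S_0=x$. Let $\mathcal{Z}_0=\mathbb{R}$ and $\mathcal{Z}_h=h\mathbb{Z}$ for $h>0$. The span of the distribution of $X_1$ is $d:=\sup\{h\in[0,\infty):\mathbb{P}(X_1\in\mathcal{Z}_h)=1\}\in[0,\infty)$; the distribution is arithmetic if $d>0$. It is spread out if for some $k\ge1$ the law $\mathbb{P}_0(S_k\in\cdot)$ is non-singular with respect to Lebesgue measure. The walk takes values in $\mathcal{Z}_d$. Let $\lambda_0$ be Lebesgue measure on $\mathbb{R}$ and $\lambda_d(B)=d\cdot\#B$ for $B\subset\mathcal{Z}_d$ if $d>0$. Up-crossing times of zero: $T_0=0$, $T_n=\inf\{k>T_{n-1}:S_{k-1}<0,\ S_k\ge0\}$ for $n\ge1$ (a.s. finite here); overshoots: $O_n=S_{T_n}$ for $n\ge1$, $O_0=S_0$. The probability measure $\pi_+$ on $\mathcal{Z}_d$ is $$\pi_+(dx)=\frac{2}{\mathbb{E}|X_1|}\,\mathbf{1}_{[0,\infty)}(x)\,\mathbb{P}(X_1>x)\,\lambda_d(dx).$$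 $\|\cdot\|_{\mathrm{TV}}$ is the total variation distance, $\|\mu-\nu\|_{\mathrm{TV}}=\sup_B|\mu(B)-\nu(B)|$ over Borel sets $B$. *)

theory Defs
  imports "HOL-Probability.Probability" "HOL-Library.Extended_Nat"
begin

definition lattice_set :: "real \<Rightarrow> real set" where
  "lattice_set h = (if h = 0 then UNIV else range (\<lambda>k::int. h * of_int k))"

text \<open>The set below always contains \<open>0\<close>. It is bounded above unless \<open>\<mu>\<close> is the point mass at
  \<open>0\<close>, so for every other probability measure the real-valued supremum is the genuine one.\<close>

definition span_of :: "real measure \<Rightarrow> real" where
  "span_of \<mu> = Sup {h. 0 \<le> h \<and> measure \<mu> (lattice_set h) = 1}"

definition arithmetic :: "real measure \<Rightarrow> bool" where
  "arithmetic \<mu> \<longleftrightarrow> span_of \<mu> > 0"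

definition mutually_singular :: "'a measure \<Rightarrow> 'a measure \<Rightarrow> bool" where
  "mutually_singular \<mu> \<nu> \<longleftrightarrow>
     (\<exists>A \<in> sets \<mu> \<inter> sets \<nu>. emeasure \<mu> A = 0 \<and> emeasure \<nu> (space \<nu> - A) = 0)"

text \<open>Increments are indexed from \<open>1\<close>; the value \<open>X 0\<close> is never used.\<close>

definition walk :: "real \<Rightarrow> (nat \<Rightarrow> 'a \<Rightarrow> real) \<Rightarrow> nat \<Rightarrow> 'a \<Rightarrow> real" where
  "walk x X n \<omega> = x + (\<Sum>i = 1..n. X i \<omega>)"

definition spread_out :: "'a measure \<Rightarrow> (nat \<Rightarrow> 'a \<Rightarrow> real) \<Rightarrow> bool" where
  "spread_out M X \<longleftrightarrow> (\<exists>k\<ge>1. \<not> mutually_singular (distr M borel (walk 0 X k)) lborel)"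

text \<open>Crossing times of a fixed path \<open>s\<close>. They take values in \<^typ>\<open>enat\<close>, where the infimum of
  the empty set is \<open>\<infinity>\<close>. Since \<open>k\<close> exceeds a crossing time, \<open>k \<ge> 1\<close> and \<open>k - 1\<close> does not truncate.\<close>

primrec upcrossing_time :: "(nat \<Rightarrow> real) \<Rightarrow> nat \<Rightarrow> enat" where
  "upcrossing_time s 0 = 0"
| "upcrossing_time s (Suc n) =
     Inf {enat k | k. upcrossing_time s n < enat k \<and> s (k - 1) < 0 \<and> 0 \<le> s k}"

text \<open>The value \<open>0\<close> at an infinite crossing time is a dummy: for a centred nondegenerate
  integrable walk all crossing times are almost surely finite.\<close>

definition overshoot :: "(nat \<Rightarrow> real) \<Rightarrow> nat \<Rightarrow> real" where
  "overshoot s n = (case upcrossing_time s n of enat k \<Rightarrow> s k | \<infinity> \<Rightarrow> 0)"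

text \<open>The reference measure on the lattice of span \<open>d\<close>, regarded as a Borel measure on the line.\<close>

definition lattice_measure :: "real \<Rightarrow> real measure" where
  "lattice_measure d =
     (if d = 0 then lborel
      else distr (scale_measure (ennreal d) (count_space (lattice_set d))) borel (\<lambda>x. x))"

definition pi_plus :: "real measure \<Rightarrow> real measure" where
  "pi_plus \<mu> = density (lattice_measure (span_of \<mu>))
     (\<lambda>x. ennreal (2 / (\<integral>y. \<bar>y\<bar> \<partial>\<mu>) * indicator {0..} x * measure \<mu> {x<..}))"

definition tv_dist :: "real measure \<Rightarrow> real measure \<Rightarrow> real" where
  "tv_dist \<mu> \<nu> = (SUP B \<in> sets borel. \<bar>measure \<mu> B - measure \<nu> B\<bar>)"

lemma emeasure_lattice_measure:
  assumes "d > 0" "B \<in> sets borel"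
  shows "emeasure (lattice_measure d) B =
           ennreal d * emeasure (count_space UNIV) (B \<inter> lattice_set d)"
proof -
  have "emeasure (count_space (lattice_set d)) (B \<inter> lattice_set d) =
          emeasure (count_space UNIV) (B \<inter> lattice_set d)"
    by (cases "finite (B \<inter> lattice_set d)")
       (auto simp: emeasure_count_space_finite emeasure_count_space_infinite)
  then show ?thesis
    using assms by (simp add: lattice_measure_def emeasure_distr space_scale_measure)
qed

end

theory Submission
  imports Defs
begin

text \<open>Let \<open>Q\<close> be the transition kernel of the overshoots. Weighting a starting point \<open>b \<ge> 0\<close> by
  \<open>P(X\<^sub>1 > b)\<close> amounts to letting the walk cross zero from the invariant measure \<open>\<lambda>\<^sub>d\<close> on the
  negative half-line; this gives \<open>\<pi>\<^sub>+ Q \<le> \<pi>\<^sub>+\<close>, with equality because the walk oscillates and \<open>Q\<close>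
  has mass one. Oscillation is a Liouville theorem for nondecreasing harmonic functions on a half-line.

  Listing the nonnegative increments of a path before the negative ones removes all upcrossings, so
  that \<open>Q(x, \<cdot>)\<close> dominates, up to a factor \<open>2 ^ n\<close>, the law obtained by first making \<open>n\<close> free steps
  of the walk and then one step of \<open>Q\<close>. Together with irreducibility (arithmetic case) or Steinhaus'
  theorem (spread-out case) this yields \<open>\<alpha>(x) \<nu> \<le> Q(x, \<cdot>)\<close> with \<open>\<alpha> > 0\<close> almost everywhere under \<open>\<pi>\<^sub>+\<close>.

  Two chains that are coupled through this minorization fail to merge with a limiting probability
  \<open>g(x, y)\<close>, which vanishes almost everywhere under \<open>\<pi>\<^sub>+ \<otimes> \<pi>\<^sub>+\<close>. Its average over \<open>y\<close> bounds the limiting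
  total variation distance from \<open>x\<close>, is invariant under \<open>Q\<close> and therefore harmonic for the walk itself;
  being zero almost everywhere under \<open>\<pi>\<^sub>+\<close>, it is then zero at every point of the lattice.\<close>

section \<open>Coupling of a minorized kernel with itself\<close>

text \<open>The function \<alpha> is positive only almost everywhere and has no positive lower
  bound, so neither a contraction rate nor control of return times is at hand. Merging is therefore
  not estimated in time. No coupled process is built either: the limit \<open>g\<close> of the
  failure probabilities is a fixed point of the operator
  \<open>f \<mapsto> P f - a * \<eta> f\<close>, and a quadratic inequality, integrated against the
  invariant law, forces \<open>a * g^2 = 0\<close>. With a first moment only, quadratic martingales
  cannot show oscillation. Instead, the probability of staying nonnegative is monotone in the
  starting point, so its primitive is convex, and convexity replaces the second moment. A path that
  reaches a good region may have crossed zero on the way, so properties of the free walk do not pass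
  directly to \<open>Q\<close>. This is the obstacle that the reordering removes, and it does so for
  starting points in the nonnegative half-line. A \<open>Q\<close>-invariant \<open>G\<close> is
  harmonic for the walk because the first-step equation \<open>Q G = cross G + stay (Q G)\<close>
  turns into \<open>G = cross G + stay G = step G\<close>.\<close>

lemma prob_algebraD:
  assumes "L \<in> space (prob_algebra N)"
  shows "prob_space L" "sets L = sets N" "space L = space N"
  using assms by (auto simp: space_prob_algebra dest: sets_eq_imp_space_eq)

lemma integrable_bounded_prob:
  fixes f :: "'a \<Rightarrow> real"
  assumes "L \<in> space (prob_algebra N)" "f \<in> borel_measurable N" "\<And>z. z \<in> space N \<Longrightarrow> \<bar>f z\<bar> \<le> c"
  shows "integrable L f"
proof -
  note L = prob_algebraD[OF assms(1)]
  interpret prob_space L by (rule L(1))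
  show ?thesis
    by (rule integrable_const_bound[of _ c]) (use assms L in \<open>auto intro!: AE_I2 cong: measurable_cong_sets\<close>)
qed

lemma nn_integral_eq_integral_prob:
  fixes f :: "'a \<Rightarrow> real"
  assumes "L \<in> space (prob_algebra N)" "f \<in> borel_measurable N"
    "\<And>z. z \<in> space N \<Longrightarrow> 0 \<le> f z" "\<And>z. z \<in> space N \<Longrightarrow> f z \<le> c"
  shows "(\<integral>\<^sup>+z. ennreal (f z) \<partial>L) = ennreal (\<integral>z. f z \<partial>L)"
proof -
  note sp = prob_algebraD(3)[OF assms(1)]
  have "integrable L f"
  proof (rule integrable_bounded_prob[OF assms(1,2), of c])
    show "\<bar>f z\<bar> \<le> c" if "z \<in> space N" for z using assms(3,4)[OF that] by simp
  qed
  then show ?thesis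
    by (rule nn_integral_eq_integral) (use assms(3) sp in \<open>auto intro!: AE_I2\<close>)
qed

lemma integral_prob_bounds:
  fixes f :: "'a \<Rightarrow> real"
  assumes "L \<in> space (prob_algebra N)" "f \<in> borel_measurable N"
    "\<And>z. z \<in> space N \<Longrightarrow> 0 \<le> f z" "\<And>z. z \<in> space N \<Longrightarrow> f z \<le> 1"
  shows "0 \<le> (\<integral>z. f z \<partial>L)" "(\<integral>z. f z \<partial>L) \<le> 1"
proof -
  note L = prob_algebraD[OF assms(1)]
  interpret prob_space L by (rule L(1))
  have i: "integrable L f"
    by (rule integrable_bounded_prob[of L N f 1]) (use assms in \<open>auto simp: abs_le_iff intro: order_trans[of _ 0]\<close>)
  show "0 \<le> (\<integral>z. f z \<partial>L)" by (rule integral_nonneg_AE) (use assms L in \<open>auto intro!: AE_I2\<close>)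
  show "(\<integral>z. f z \<partial>L) \<le> 1"
    by (rule integral_le_const[OF i]) (use assms L in \<open>auto intro!: AE_I2\<close>)
qed

text \<open>Stated for one kernel, but meant for two independent copies of the chain: \<eta> becomes
  the product of \<nu> with itself and \<open>a\<close> becomes
  \<open>\<alpha> x * \<alpha> y\<close>.\<close>

locale minorized_kernel =
  fixes N :: "'a measure" and P :: "'a \<Rightarrow> 'a measure" and \<kappa> \<eta> :: "'a measure" and a :: "'a \<Rightarrow> real"
  assumes P[measurable]: "P \<in> N \<rightarrow>\<^sub>M prob_algebra N"
    and \<kappa>: "\<kappa> \<in> space (prob_algebra N)"
    and \<eta>: "\<eta> \<in> space (prob_algebra N)"
    and a[measurable]: "a \<in> borel_measurable N"
    and a_nonneg: "\<And>z. 0 \<le> a z"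
    and invariant: "\<And>f. f \<in> borel_measurable N \<Longrightarrow> (\<integral>\<^sup>+z. (\<integral>\<^sup>+w. f w \<partial>P z) \<partial>\<kappa>) = (\<integral>\<^sup>+z. f z \<partial>\<kappa>)"
    and minorized: "\<And>f z. f \<in> borel_measurable N \<Longrightarrow> z \<in> space N \<Longrightarrow>
      ennreal (a z) * (\<integral>\<^sup>+w. f w \<partial>\<eta>) \<le> (\<integral>\<^sup>+w. f w \<partial>P z)"
begin

text \<open>The sub-Markov kernel \<open>P z - a z * \<eta>\<close> acting on functions, that is, a
  transition without its regenerating part. Bochner integrals are used because it is later applied
  to signed differences.\<close>

definition residual :: "('a \<Rightarrow> real) \<Rightarrow> 'a \<Rightarrow> real" where
  "residual f z = (\<integral>w. f w \<partial>P z) - a z * (\<integral>w. f w \<partial>\<eta>)"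

lemma P_in: "z \<in> space N \<Longrightarrow> P z \<in> space (prob_algebra N)"
  using measurable_space[OF P] .

lemma integral_P_measurable:
  fixes f :: "'a \<Rightarrow> real"
  assumes [measurable]: "f \<in> borel_measurable N"
  shows "(\<lambda>z. \<integral>w. f w \<partial>P z) \<in> borel_measurable N"
  using measurable_compose[OF measurable_prob_algebraD[OF P] integral_measurable_subprob_algebra[OF assms]]
  by simp

lemma residual_measurable[measurable]:
  "f \<in> borel_measurable N \<Longrightarrow> residual f \<in> borel_measurable N"
  unfolding residual_def
  by (intro borel_measurable_diff borel_measurable_times integral_P_measurable a) auto

lemma residual_nonneg:
  fixes f :: "'a \<Rightarrow> real"
  assumes f: "f \<in> borel_measurable N" "\<And>z. z \<in> space N \<Longrightarrow> 0 \<le> f z" "\<And>z. z \<in> space N \<Longrightarrow> f z \<le> c"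
    and z: "z \<in> space N"
  shows "0 \<le> residual f z"
proof -
  have "ennreal (a z * (\<integral>w. f w \<partial>\<eta>)) = ennreal (a z) * (\<integral>\<^sup>+w. ennreal (f w) \<partial>\<eta>)"
    using nn_integral_eq_integral_prob[OF \<eta> f] a_nonneg
    by (simp add: ennreal_mult')
  also have "\<dots> \<le> (\<integral>\<^sup>+w. ennreal (f w) \<partial>P z)" by (rule minorized) (use f z in auto)
  also have "\<dots> = ennreal (\<integral>w. f w \<partial>P z)"
    by (rule nn_integral_eq_integral_prob[OF P_in[OF z] f])
  finally have "a z * (\<integral>w. f w \<partial>\<eta>) \<le> (\<integral>w. f w \<partial>P z)"
    by (subst (asm) ennreal_le_iff)
       (use f z P_in[OF z] in \<open>auto intro!: integral_nonneg_AE AE_I2 simp: space_prob_algebra dest: sets_eq_imp_space_eq\<close>)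
  then show ?thesis by (simp add: residual_def)
qed

lemma residual_mono:
  assumes f: "f \<in> borel_measurable N" "\<And>z. z \<in> space N \<Longrightarrow> \<bar>f z\<bar> \<le> c"
    and g: "g \<in> borel_measurable N" "\<And>z. z \<in> space N \<Longrightarrow> \<bar>g z\<bar> \<le> c"
    and le: "\<And>z. z \<in> space N \<Longrightarrow> f z \<le> g z" and z: "z \<in> space N"
  shows "residual f z \<le> residual g z"
proof -
  have i: "integrable L f" "integrable L g" if "L \<in> space (prob_algebra N)" for L
    using integrable_bounded_prob[OF that] f g by blast+
  have "0 \<le> residual (\<lambda>w. g w - f w) z"
  proof (rule residual_nonneg[where c="2*c"])
    show "g w - f w \<le> 2 * c" if "w \<in> space N" for w
      using f(2)[OF that] g(2)[OF that] by linarith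
  qed (use f g le z in auto)
  also have "\<dots> = residual g z - residual f z"
    unfolding residual_def using i[OF P_in[OF z]] i[OF \<eta>] by (simp add: algebra_simps)
  finally show ?thesis by simp
qed

lemma residual_1: "z \<in> space N \<Longrightarrow> residual (\<lambda>_. 1) z = 1 - a z"
  using P_in[of z] \<eta> by (simp add: residual_def space_prob_algebra prob_space.prob_space)

text \<open>The probability that none of the first \<open>n\<close> transitions from
  \<open>z\<close> used the regenerating part \<open>a * \<eta>\<close>.\<close>

primrec uncoupled :: "nat \<Rightarrow> 'a \<Rightarrow> real" where
  "uncoupled 0 = (\<lambda>_. 1)"
| "uncoupled (Suc n) = residual (uncoupled n)"

lemma uncoupled_measurable[measurable]: "uncoupled n \<in> borel_measurable N"
  by (induction n) auto

lemma uncoupled_bounds: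
  assumes "z \<in> space N"
  shows "0 \<le> uncoupled n z" "uncoupled n z \<le> 1"
proof -
  have "0 \<le> uncoupled n z \<and> uncoupled n z \<le> 1" using assms
  proof (induction n arbitrary: z)
    case (Suc n)
    have "0 \<le> residual (uncoupled n) z" by (rule residual_nonneg[where c=1]) (use Suc in auto)
    moreover have "residual (uncoupled n) z \<le> residual (\<lambda>_. 1) z"
      by (rule residual_mono[where c=1]) (use Suc in \<open>auto simp: abs_le_iff intro: order_trans[of _ 0]\<close>)
    ultimately show ?case using residual_1[OF Suc.prems] a_nonneg[of z] by simp
  qed auto
  then show "0 \<le> uncoupled n z" "uncoupled n z \<le> 1" by auto
qed

lemma abs_uncoupled_le: "z \<in> space N \<Longrightarrow> \<bar>uncoupled n z\<bar> \<le> 1"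
  using uncoupled_bounds[of z n] by (auto simp: abs_le_iff)

lemma uncoupled_Suc_le: "z \<in> space N \<Longrightarrow> uncoupled (Suc n) z \<le> uncoupled n z"
proof (induction n arbitrary: z)
  case 0
  then show ?case using uncoupled_bounds[of z "Suc 0"] by simp
next
  case (Suc n)
  show ?case
    unfolding uncoupled.simps(2)[of "Suc n"] uncoupled.simps(2)[of n]
    using Suc abs_uncoupled_le[of _ "Suc n"] abs_uncoupled_le[of _ n]
    by (intro residual_mono[where c=1]) auto
qed

definition never_coupled :: "'a \<Rightarrow> real" where
  "never_coupled z = lim (\<lambda>n. uncoupled n z)"

lemma uncoupled_tendsto:
  assumes "z \<in> space N" shows "(\<lambda>n. uncoupled n z) \<longlonglongrightarrow> never_coupled z"
proof -
  have "convergent (\<lambda>n. uncoupled n z)"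
    by (rule Bseq_monoseq_convergent)
       (use assms abs_uncoupled_le uncoupled_Suc_le in \<open>auto intro!: BseqI'[of _ 1] simp: monoseq_Suc\<close>)
  then show ?thesis by (simp add: never_coupled_def convergent_LIMSEQ_iff)
qed

lemma never_coupled_measurable[measurable]: "never_coupled \<in> borel_measurable N"
  by (rule borel_measurable_LIMSEQ_real[OF uncoupled_tendsto]) auto

lemma never_coupled_bounds:
  assumes "z \<in> space N"
  shows "0 \<le> never_coupled z" "never_coupled z \<le> 1"
  using uncoupled_tendsto[OF assms] uncoupled_bounds[OF assms]
  by (auto intro: LIMSEQ_le_const LIMSEQ_le_const2)

lemma abs_never_coupled_le: "z \<in> space N \<Longrightarrow> \<bar>never_coupled z\<bar> \<le> 1"
  using never_coupled_bounds[of z] by (auto simp: abs_le_iff)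

lemma integral_uncoupled_tendsto:
  assumes L: "L \<in> space (prob_algebra N)"
  shows "(\<lambda>n. \<integral>w. uncoupled n w \<partial>L) \<longlonglongrightarrow> (\<integral>w. never_coupled w \<partial>L)"
proof (rule integral_dominated_convergence[where w="\<lambda>_. 1"])
  have L': "sets L = sets N" "prob_space L" using L by (auto simp: space_prob_algebra)
  have sp: "space L = space N" using L'(1) by (rule sets_eq_imp_space_eq)
  show "never_coupled \<in> borel_measurable L" "\<And>n. uncoupled n \<in> borel_measurable L"
    using L'(1) by (simp_all cong: measurable_cong_sets)
  show "integrable L (\<lambda>_. 1::real)" using integrable_bounded_prob[OF L, of "\<lambda>_. 1" 1] by simp
qed (use L abs_uncoupled_le uncoupled_tendsto in
      \<open>auto intro!: AE_I2 simp: space_prob_algebra dest!: sets_eq_imp_space_eq\<close>)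

lemma never_coupled_fixpoint:
  assumes z: "z \<in> space N"
  shows "residual never_coupled z = never_coupled z"
proof (rule LIMSEQ_unique)
  show "(\<lambda>n. uncoupled (Suc n) z) \<longlonglongrightarrow> never_coupled z"
    using uncoupled_tendsto[OF z] by (rule LIMSEQ_Suc)
  show "(\<lambda>n. uncoupled (Suc n) z) \<longlonglongrightarrow> residual never_coupled z"
    unfolding uncoupled.simps residual_def
    by (intro tendsto_intros integral_uncoupled_tendsto P_in z \<eta>)
qed

lemma integral_invariant:
  fixes f :: "'a \<Rightarrow> real"
  assumes f: "f \<in> borel_measurable N" "\<And>z. z \<in> space N \<Longrightarrow> 0 \<le> f z" "\<And>z. z \<in> space N \<Longrightarrow> f z \<le> 1"
  shows "(\<integral>z. (\<integral>w. f w \<partial>P z) \<partial>\<kappa>) = (\<integral>z. f z \<partial>\<kappa>)"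
proof -
  note sp = prob_algebraD(3)[OF \<kappa>]
  have "ennreal (\<integral>z. (\<integral>w. f w \<partial>P z) \<partial>\<kappa>) = (\<integral>\<^sup>+z. ennreal (\<integral>w. f w \<partial>P z) \<partial>\<kappa>)"
    by (rule nn_integral_eq_integral_prob[OF \<kappa>, where c=1, symmetric])
       (use f integral_prob_bounds[OF P_in f] in \<open>auto intro: integral_P_measurable\<close>)
  also have "\<dots> = (\<integral>\<^sup>+z. (\<integral>\<^sup>+w. ennreal (f w) \<partial>P z) \<partial>\<kappa>)"
    by (rule nn_integral_cong)
       (use sp nn_integral_eq_integral_prob[OF P_in f] in auto)
  also have "\<dots> = (\<integral>\<^sup>+z. ennreal (f z) \<partial>\<kappa>)" by (rule invariant) (use f in auto)
  also have "\<dots> = ennreal (\<integral>z. f z \<partial>\<kappa>)" by (rule nn_integral_eq_integral_prob[OF \<kappa> f])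
  finally show ?thesis
    using integral_prob_bounds(1)[OF \<kappa> f]
      integral_prob_bounds(1)[OF \<kappa> integral_P_measurable[OF f(1)]]
      integral_prob_bounds[OF P_in f]
    by simp
qed

text \<open>The Cauchy--Schwarz type bound \<open>(1 + a) g\<^sup>2 \<le> P (g\<^sup>2)\<close> for the fixed point \<open>g\<close> of the
  residual operator, integrated against the invariant law, leaves no room for \<open>a g\<^sup>2\<close>.\<close>

lemma never_coupled_AE_zero:
  assumes a_pos: "AE z in \<kappa>. 0 < a z"
  shows "AE z in \<kappa>. never_coupled z = 0"
proof -
  let ?g = never_coupled
  have sp: "space \<kappa> = space N" and sets: "sets \<kappa> = sets N" and "prob_space \<kappa>"
    using prob_algebraD[OF \<kappa>] by auto
  have g2: "(?g z)^2 \<le> 1" "0 \<le> (?g z)^2" if "z \<in> space N" for z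
    using never_coupled_bounds[OF that] by (auto intro: power_le_one)
  have key: "(1 + a z) * (?g z)^2 \<le> (\<integral>w. (?g w)^2 \<partial>P z)" if z: "z \<in> space N" for z
  proof -
    define c where "c = ?g z"
    have c: "0 \<le> c" "c \<le> 1" using never_coupled_bounds[OF z] by (auto simp: c_def)
    have i: "integrable L ?g" "integrable L (\<lambda>w. (?g w)^2)" if L: "L \<in> space (prob_algebra N)" for L
      by (rule integrable_bounded_prob[OF L, of _ 1]; use abs_never_coupled_le g2 in simp)+
    have 1: "prob_space (P z)" "prob_space \<eta>" using P_in[OF z] \<eta> by (auto simp: space_prob_algebra)
    interpret Pz: prob_space "P z" by fact
    interpret Eta: prob_space \<eta> by fact
    \<comment> \<open>This is positivity of the residual operator on \<open>(c - g)^2\<close>.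
      Taking \<open>c\<close> as the value of \<open>g\<close> at \<open>z\<close> lets the fixed
      point equation turn the left side into \<open>2 * c^2\<close>.\<close>
    have "residual (\<lambda>w. (2 * c) * ?g w) z \<le> residual (\<lambda>w. c^2 + (?g w)^2) z"
    proof (rule residual_mono[where c=2])
      fix w assume w: "w \<in> space N"
      have "0 \<le> c * ?g w" "c * ?g w \<le> 1"
        using c never_coupled_bounds[OF w] by (auto intro: mult_le_one)
      then show "\<bar>(2 * c) * ?g w\<bar> \<le> 2" by simp
      have "c^2 \<le> 1" using c by (auto intro: power_le_one)
      then show "\<bar>c^2 + (?g w)^2\<bar> \<le> 2" using g2[OF w] by simp
      have "0 \<le> (c - ?g w)^2" by simp
      then show "(2 * c) * ?g w \<le> c^2 + (?g w)^2" by (simp add: power2_eq_square algebra_simps)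
    qed (use z in auto)
    also have "residual (\<lambda>w. (2 * c) * ?g w) z = 2 * c * residual ?g z"
      by (simp add: residual_def algebra_simps)
    also have "\<dots> = 2 * c^2" using never_coupled_fixpoint[OF z] by (simp add: c_def power2_eq_square)
    also have "residual (\<lambda>w. c^2 + (?g w)^2) z =
        c^2 * (1 - a z) + (\<integral>w. (?g w)^2 \<partial>P z) - a z * (\<integral>w. (?g w)^2 \<partial>\<eta>)"
      using i[OF P_in[OF z]] i[OF \<eta>]
      by (simp add: residual_def algebra_simps Pz.prob_space Eta.prob_space)
    finally have "(1 + a z) * c^2 \<le> (\<integral>w. (?g w)^2 \<partial>P z) - a z * (\<integral>w. (?g w)^2 \<partial>\<eta>)"
      by (simp add: algebra_simps)
    moreover have "0 \<le> a z * (\<integral>w. (?g w)^2 \<partial>\<eta>)"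
      using a_nonneg[of z] by simp
    ultimately show ?thesis by (simp add: c_def)
  qed
  define d where "d z = (\<integral>w. (?g w)^2 \<partial>P z) - (?g z)^2" for z
  have dm: "(\<lambda>z. \<integral>w. (?g w)^2 \<partial>P z) \<in> borel_measurable N"
    by (rule integral_P_measurable) measurable
  have iP: "integrable \<kappa> (\<lambda>z. \<integral>w. (?g w)^2 \<partial>P z)"
    by (rule integrable_bounded_prob[OF \<kappa> dm, of 1])
       (use integral_prob_bounds[OF P_in, of _ "\<lambda>w. (?g w)^2"] g2 in auto)
  have ig: "integrable \<kappa> (\<lambda>z. (?g z)^2)"
    by (rule integrable_bounded_prob[OF \<kappa>, of _ 1]) (use g2 in auto)
  have "(\<integral>z. d z \<partial>\<kappa>) = 0"
    unfolding d_def using iP ig integral_invariant[of "\<lambda>w. (?g w)^2"] g2 by simp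
  moreover have d_ge: "a z * (?g z)^2 \<le> d z" if "z \<in> space N" for z
    using key[OF that] by (simp add: d_def algebra_simps)
  moreover have "integrable \<kappa> d" unfolding d_def by (intro Bochner_Integration.integrable_diff iP ig)
  moreover have "AE z in \<kappa>. 0 \<le> d z"
  proof (rule AE_I2)
    fix z assume "z \<in> space \<kappa>"
    then have "a z * (?g z)^2 \<le> d z" using d_ge sp by simp
    moreover have "0 \<le> a z * (?g z)^2" by (intro mult_nonneg_nonneg a_nonneg) simp
    ultimately show "0 \<le> d z" by linarith
  qed
  ultimately have "AE z in \<kappa>. d z = 0"
    using integral_nonneg_eq_0_iff_AE[of \<kappa> d] by simp
  with a_pos AE_space show ?thesis
  proof eventually_elim
    case (elim z)
    then have "a z * (?g z)^2 \<le> 0" using d_ge[of z] sp by simp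
    then show ?case using elim by (simp add: mult_le_0_iff)
  qed
qed

text \<open>The subtracted term vanishes: \<open>P g\<close> has integral zero under \<kappa>, so at
  some point \<open>a > 0\<close> and \<open>P g = 0\<close>, and nonnegativity of the residual
  there gives \<open>\<eta> g = 0\<close>. The fixed point equation then reads
  \<open>P g = g\<close> at every point, not only almost everywhere.\<close>

lemma never_coupled_harmonic:
  assumes a_pos: "AE z in \<kappa>. 0 < a z" and z: "z \<in> space N"
  shows "(\<integral>w. never_coupled w \<partial>P z) = never_coupled z"
proof -
  let ?g = never_coupled
  have sp: "space \<kappa> = space N" and sets: "sets \<kappa> = sets N" and "prob_space \<kappa>"
    using prob_algebraD[OF \<kappa>] by auto
  interpret Pi: prob_space \<kappa> by fact
  have "(\<integral>z. (\<integral>w. ?g w \<partial>P z) \<partial>\<kappa>) = (\<integral>z. ?g z \<partial>\<kappa>)"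
    by (rule integral_invariant) (use never_coupled_bounds in auto)
  also have "\<dots> = 0"
    by (rule integral_eq_zero_AE) (rule never_coupled_AE_zero[OF a_pos])
  finally have "(\<integral>z. (\<integral>w. ?g w \<partial>P z) \<partial>\<kappa>) = 0" .
  moreover have i: "integrable \<kappa> (\<lambda>z. \<integral>w. ?g w \<partial>P z)"
    by (rule integrable_bounded_prob[OF \<kappa> integral_P_measurable, of _ 1])
       (use integral_prob_bounds[OF P_in, of _ "?g"] never_coupled_bounds in auto)
  moreover have "AE z in \<kappa>. 0 \<le> (\<integral>w. ?g w \<partial>P z)"
    by (rule AE_I2, rule integral_prob_bounds(1)[OF P_in])
       (use never_coupled_bounds sp in auto)
  ultimately have "AE z in \<kappa>. (\<integral>w. ?g w \<partial>P z) = 0"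
    using integral_nonneg_eq_0_iff_AE[OF i] by simp
  then have "AE z in \<kappa>. 0 < a z \<and> (\<integral>w. ?g w \<partial>P z) = 0 \<and> z \<in> space \<kappa>"
    using a_pos AE_space by eventually_elim simp
  then have "\<exists>z. 0 < a z \<and> (\<integral>w. ?g w \<partial>P z) = 0 \<and> z \<in> space \<kappa>"
    by (rule eventually_happens'[OF Pi.ae_filter_bot])
  then obtain z0 where z0: "0 < a z0" "(\<integral>w. ?g w \<partial>P z0) = 0" "z0 \<in> space N"
    using sp by auto
  have "0 \<le> residual ?g z0"
    by (rule residual_nonneg[where c=1]) (use z0 never_coupled_bounds in auto)
  then have "a z0 * (\<integral>w. ?g w \<partial>\<eta>) \<le> 0" by (simp add: residual_def z0)
  moreover have "0 \<le> (\<integral>w. ?g w \<partial>\<eta>)"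
    using integral_prob_bounds(1)[OF \<eta>, of ?g] never_coupled_bounds by auto
  ultimately have "(\<integral>w. ?g w \<partial>\<eta>) = 0" using z0(1) by (simp add: mult_le_0_iff)
  then show ?thesis using never_coupled_fixpoint[OF z] by (simp add: residual_def)
qed

end

section \<open>Two independent copies of a chain, and the average over a stationary second
  copy\<close>

lemma nn_integral_pair_prob:
  assumes L: "L1 \<in> space (prob_algebra N1)" "L2 \<in> space (prob_algebra N2)"
    and f: "f \<in> borel_measurable (N1 \<Otimes>\<^sub>M N2)"
  shows "(\<integral>\<^sup>+z. f z \<partial>(L1 \<Otimes>\<^sub>M L2)) = (\<integral>\<^sup>+x. (\<integral>\<^sup>+y. f (x, y) \<partial>L2) \<partial>L1)"
    "(\<integral>\<^sup>+z. f z \<partial>(L1 \<Otimes>\<^sub>M L2)) = (\<integral>\<^sup>+y. (\<integral>\<^sup>+x. f (x, y) \<partial>L1) \<partial>L2)"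
proof -
  note D1 = prob_algebraD[OF L(1)] and D2 = prob_algebraD[OF L(2)]
  interpret L1: prob_space L1 by (rule D1(1))
  interpret L2: prob_space L2 by (rule D2(1))
  interpret pair_sigma_finite L1 L2 ..
  have f': "f \<in> borel_measurable (L1 \<Otimes>\<^sub>M L2)"
    using f D1(2) D2(2) by (simp cong: measurable_cong_sets sets_pair_measure_cong)
  show "(\<integral>\<^sup>+z. f z \<partial>(L1 \<Otimes>\<^sub>M L2)) = (\<integral>\<^sup>+x. (\<integral>\<^sup>+y. f (x, y) \<partial>L2) \<partial>L1)"
    using L2.nn_integral_fst[OF f'] by simp
  show "(\<integral>\<^sup>+z. f z \<partial>(L1 \<Otimes>\<^sub>M L2)) = (\<integral>\<^sup>+y. (\<integral>\<^sup>+x. f (x, y) \<partial>L1) \<partial>L2)"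
    using nn_integral_snd[OF f'] by simp
qed

lemma integral_pair_prob_diff:
  fixes p :: "'a \<Rightarrow> real"
  assumes L: "L1 \<in> space (prob_algebra N)" "L2 \<in> space (prob_algebra N)"
    and p[measurable]: "p \<in> borel_measurable N" and bound: "\<And>x. x \<in> space N \<Longrightarrow> \<bar>p x\<bar> \<le> 1"
  shows "(\<integral>z. p (fst z) - p (snd z) \<partial>(L1 \<Otimes>\<^sub>M L2)) = (\<integral>x. p x \<partial>L1) - (\<integral>x. p x \<partial>L2)"
proof -
  note D1 = prob_algebraD[OF L(1)] and D2 = prob_algebraD[OF L(2)]
  interpret L1: prob_space L1 by (rule D1(1))
  interpret L2: prob_space L2 by (rule D2(1))
  interpret pair_prob_space L1 L2 ..
  note [measurable_cong] = D1(2) D2(2)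
  have i: "integrable L1 p" "integrable L2 p"
    using integrable_bounded_prob[OF L(1) p bound] integrable_bounded_prob[OF L(2) p bound] by auto
  have "integrable (L1 \<Otimes>\<^sub>M L2) (\<lambda>z. p (fst z) - p (snd z))"
  proof (rule P.integrable_const_bound[of _ 2], rule AE_I2)
    fix z assume "z \<in> space (L1 \<Otimes>\<^sub>M L2)"
    then show "norm (p (fst z) - p (snd z)) \<le> 2"
      using bound[of "fst z"] bound[of "snd z"] D1 D2 by (auto simp: space_pair_measure)
  qed measurable
  from integral_fst'[OF this, symmetric]
  have "(\<integral>z. p (fst z) - p (snd z) \<partial>(L1 \<Otimes>\<^sub>M L2)) = (\<integral>x. (\<integral>y. p x - p y \<partial>L2) \<partial>L1)" by simp
  also have "\<dots> = (\<integral>x. p x - (\<integral>y. p y \<partial>L2) \<partial>L1)"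
    using i by (simp add: L2.prob_space)
  also have "\<dots> = (\<integral>x. p x \<partial>L1) - (\<integral>y. p y \<partial>L2)"
    using i by (simp add: L1.prob_space)
  finally show ?thesis .
qed

locale minorized_chain =
  fixes N :: "'a measure" and Q :: "'a \<Rightarrow> 'a measure" and \<pi> \<nu> :: "'a measure" and \<alpha> :: "'a \<Rightarrow> real"
  assumes Q[measurable]: "Q \<in> N \<rightarrow>\<^sub>M prob_algebra N"
    and \<pi>: "\<pi> \<in> space (prob_algebra N)"
    and \<nu>: "\<nu> \<in> space (prob_algebra N)"
    and \<alpha>[measurable]: "\<alpha> \<in> borel_measurable N"
    and \<alpha>_nonneg: "\<And>x. 0 \<le> \<alpha> x"
    and \<alpha>_pos: "AE x in \<pi>. 0 < \<alpha> x"
    and Q_invariant: "\<And>f. f \<in> borel_measurable N \<Longrightarrow> (\<integral>\<^sup>+x. (\<integral>\<^sup>+y. f y \<partial>Q x) \<partial>\<pi>) = (\<integral>\<^sup>+x. f x \<partial>\<pi>)"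
    and Q_minorized: "\<And>f x. f \<in> borel_measurable N \<Longrightarrow> x \<in> space N \<Longrightarrow>
      ennreal (\<alpha> x) * (\<integral>\<^sup>+y. f y \<partial>\<nu>) \<le> (\<integral>\<^sup>+y. f y \<partial>Q x)"
begin

lemma Q_in: "x \<in> space N \<Longrightarrow> Q x \<in> space (prob_algebra N)"
  using measurable_space[OF Q] .

lemma nn_integral_Q_measurable:
  assumes "(\<lambda>(x, y). f x y) \<in> borel_measurable (M \<Otimes>\<^sub>M N)" "h \<in> M \<rightarrow>\<^sub>M N"
  shows "(\<lambda>x. \<integral>\<^sup>+y. f x y \<partial>Q (h x)) \<in> borel_measurable M"
  by (rule nn_integral_measurable_subprob_algebra2[where N=N])
     (use assms in \<open>auto intro!: measurable_prob_algebraD measurable_compose[OF _ Q]\<close>)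

lemma pair_in: "L1 \<in> space (prob_algebra N) \<Longrightarrow> L2 \<in> space (prob_algebra N) \<Longrightarrow>
    L1 \<Otimes>\<^sub>M L2 \<in> space (prob_algebra (N \<Otimes>\<^sub>M N))"
  by (auto simp: space_prob_algebra intro!: prob_space_pair sets_pair_measure_cong)

lemma product_invariant:
  assumes f[measurable]: "f \<in> borel_measurable (N \<Otimes>\<^sub>M N)"
  shows "(\<integral>\<^sup>+z. (\<integral>\<^sup>+w. f w \<partial>(Q (fst z) \<Otimes>\<^sub>M Q (snd z))) \<partial>(\<pi> \<Otimes>\<^sub>M \<pi>)) = (\<integral>\<^sup>+z. f z \<partial>(\<pi> \<Otimes>\<^sub>M \<pi>))"
proof -
  note sp = prob_algebraD(3)[OF \<pi>] and sets = prob_algebraD(2)[OF \<pi>]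
  have QQ: "(\<lambda>z. Q (fst z) \<Otimes>\<^sub>M Q (snd z)) \<in> (N \<Otimes>\<^sub>M N) \<rightarrow>\<^sub>M prob_algebra (N \<Otimes>\<^sub>M N)" by measurable
  have "(\<integral>\<^sup>+z. (\<integral>\<^sup>+w. f w \<partial>(Q (fst z) \<Otimes>\<^sub>M Q (snd z))) \<partial>(\<pi> \<Otimes>\<^sub>M \<pi>)) =
      (\<integral>\<^sup>+x. (\<integral>\<^sup>+y. (\<integral>\<^sup>+w. f w \<partial>(Q x \<Otimes>\<^sub>M Q y)) \<partial>\<pi>) \<partial>\<pi>)"
    using nn_integral_pair_prob(1)[OF \<pi> \<pi>
        measurable_compose[OF measurable_prob_algebraD[OF QQ] nn_integral_measurable_subprob_algebra[OF f]]] by simp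
  also have "\<dots> = (\<integral>\<^sup>+x. (\<integral>\<^sup>+u. (\<integral>\<^sup>+v. f (u, v) \<partial>\<pi>) \<partial>Q x) \<partial>\<pi>)"
  proof (rule nn_integral_cong)
    fix x assume "x \<in> space \<pi>"
    then have x: "x \<in> space N" using sp by simp
    have m: "(\<lambda>z. \<integral>\<^sup>+v. f (snd z, v) \<partial>Q (fst z)) \<in> borel_measurable (N \<Otimes>\<^sub>M N)"
      by (rule nn_integral_Q_measurable) measurable
    have "(\<integral>\<^sup>+y. (\<integral>\<^sup>+w. f w \<partial>(Q x \<Otimes>\<^sub>M Q y)) \<partial>\<pi>) = (\<integral>\<^sup>+y. (\<integral>\<^sup>+u. (\<integral>\<^sup>+v. f (u, v) \<partial>Q y) \<partial>Q x) \<partial>\<pi>)"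
      using sp by (intro nn_integral_cong nn_integral_pair_prob(1)[OF Q_in[OF x] Q_in f]) simp
    also have "\<dots> = (\<integral>\<^sup>+u. (\<integral>\<^sup>+y. (\<integral>\<^sup>+v. f (u, v) \<partial>Q y) \<partial>\<pi>) \<partial>Q x)"
      using nn_integral_pair_prob[OF \<pi> Q_in[OF x] m] by simp
    also have "\<dots> = (\<integral>\<^sup>+u. (\<integral>\<^sup>+v. f (u, v) \<partial>\<pi>) \<partial>Q x)"
      using prob_algebraD(3)[OF Q_in[OF x]] by (intro nn_integral_cong Q_invariant) simp
    finally show "(\<integral>\<^sup>+y. (\<integral>\<^sup>+w. f w \<partial>(Q x \<Otimes>\<^sub>M Q y)) \<partial>\<pi>) = (\<integral>\<^sup>+u. (\<integral>\<^sup>+v. f (u, v) \<partial>\<pi>) \<partial>Q x)" .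
  qed
  also have "\<dots> = (\<integral>\<^sup>+u. (\<integral>\<^sup>+v. f (u, v) \<partial>\<pi>) \<partial>\<pi>)"
  proof (rule Q_invariant)
    interpret prob_space \<pi> by (rule prob_algebraD(1)[OF \<pi>])
    note [measurable_cong] = sets
    show "(\<lambda>u. \<integral>\<^sup>+v. f (u, v) \<partial>\<pi>) \<in> borel_measurable N" by measurable
  qed
  also have "\<dots> = (\<integral>\<^sup>+z. f z \<partial>(\<pi> \<Otimes>\<^sub>M \<pi>))"
    by (rule nn_integral_pair_prob(1)[OF \<pi> \<pi> f, symmetric])
  finally show ?thesis .
qed

lemma product_minorized:
  assumes f[measurable]: "f \<in> borel_measurable (N \<Otimes>\<^sub>M N)" and z: "x \<in> space N" "y \<in> space N"
  shows "ennreal (\<alpha> x * \<alpha> y) * (\<integral>\<^sup>+w. f w \<partial>(\<nu> \<Otimes>\<^sub>M \<nu>)) \<le> (\<integral>\<^sup>+w. f w \<partial>(Q x \<Otimes>\<^sub>M Q y))"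
proof -
  interpret \<nu>: prob_space \<nu> by (rule prob_algebraD(1)[OF \<nu>])
  note [measurable_cong] = prob_algebraD(2)[OF \<nu>]
  note spQ = prob_algebraD(3)[OF Q_in]
  have "ennreal (\<alpha> x * \<alpha> y) * (\<integral>\<^sup>+w. f w \<partial>(\<nu> \<Otimes>\<^sub>M \<nu>)) =
      ennreal (\<alpha> y) * (ennreal (\<alpha> x) * (\<integral>\<^sup>+u. (\<integral>\<^sup>+v. f (u, v) \<partial>\<nu>) \<partial>\<nu>))"
    using \<alpha>_nonneg by (simp add: nn_integral_pair_prob(1)[OF \<nu> \<nu> f] ennreal_mult' mult_ac)
  also have "\<dots> \<le> ennreal (\<alpha> y) * (\<integral>\<^sup>+u. (\<integral>\<^sup>+v. f (u, v) \<partial>\<nu>) \<partial>Q x)"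
    by (intro mult_left_mono Q_minorized z) auto
  also have "\<dots> = (\<integral>\<^sup>+u. ennreal (\<alpha> y) * (\<integral>\<^sup>+v. f (u, v) \<partial>\<nu>) \<partial>Q x)"
    using prob_algebraD(2)[OF Q_in[OF z(1)]]
    by (subst nn_integral_cmult) (auto cong: measurable_cong_sets)
  also have "\<dots> \<le> (\<integral>\<^sup>+u. (\<integral>\<^sup>+v. f (u, v) \<partial>Q y) \<partial>Q x)"
    using spQ[OF z(1)] by (intro nn_integral_mono Q_minorized z) auto
  also have "\<dots> = (\<integral>\<^sup>+w. f w \<partial>(Q x \<Otimes>\<^sub>M Q y))"
    by (rule nn_integral_pair_prob(1)[OF Q_in[OF z(1)] Q_in[OF z(2)] f, symmetric])
  finally show ?thesis .
qed

sublocale C: minorized_kernel "N \<Otimes>\<^sub>M N" "\<lambda>z. Q (fst z) \<Otimes>\<^sub>M Q (snd z)" "\<pi> \<Otimes>\<^sub>M \<pi>" "\<nu> \<Otimes>\<^sub>M \<nu>"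
  "\<lambda>z. \<alpha> (fst z) * \<alpha> (snd z)"
proof
  show "(\<lambda>z. Q (fst z) \<Otimes>\<^sub>M Q (snd z)) \<in> N \<Otimes>\<^sub>M N \<rightarrow>\<^sub>M prob_algebra (N \<Otimes>\<^sub>M N)" by measurable
qed (auto intro!: pair_in \<pi> \<nu> \<alpha>_nonneg mult_nonneg_nonneg product_invariant product_minorized simp: space_pair_measure)

lemma product_pos: "AE z in \<pi> \<Otimes>\<^sub>M \<pi>. 0 < \<alpha> (fst z) * \<alpha> (snd z)"
proof -
  interpret \<pi>: prob_space \<pi> by (rule prob_algebraD(1)[OF \<pi>])
  interpret P: pair_sigma_finite \<pi> \<pi> ..
  have [measurable]: "\<alpha> \<in> borel_measurable \<pi>"
    using prob_algebraD(2)[OF \<pi>] by (simp cong: measurable_cong_sets)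
  have "AE x in \<pi>. AE y in \<pi>. 0 < \<alpha> x * \<alpha> y"
    using \<alpha>_pos by eventually_elim (use \<alpha>_pos in \<open>auto elim: eventually_mono\<close>)
  moreover have "{z \<in> space (\<pi> \<Otimes>\<^sub>M \<pi>). 0 < \<alpha> (fst z) * \<alpha> (snd z)} \<in> sets (\<pi> \<Otimes>\<^sub>M \<pi>)"
    by measurable
  ultimately show ?thesis
    by (intro P.AE_pair_measure) simp_all
qed

text \<open>A difference \<open>p(x) - p(y)\<close> integrates to zero against the product of \<nu>
  with itself, so the residual operator maps differences of \<open>p n\<close> exactly to
  differences of \<open>p (Suc n)\<close>; positivity propagates the initial bound 1. Regenerated
  copies need not sit at the same point: having the same law is enough.\<close>

lemma difference_le_uncoupled:
  fixes p :: "nat \<Rightarrow> 'a \<Rightarrow> real"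
  assumes p: "\<And>n. p n \<in> borel_measurable N" "\<And>n x. x \<in> space N \<Longrightarrow> \<bar>p n x\<bar> \<le> 1"
    and 0: "\<And>x y. x \<in> space N \<Longrightarrow> y \<in> space N \<Longrightarrow> \<bar>p 0 x - p 0 y\<bar> \<le> 1"
    and Suc: "\<And>n x. x \<in> space N \<Longrightarrow> p (Suc n) x = (\<integral>y. p n y \<partial>Q x)"
    and xy: "x \<in> space N" "y \<in> space N"
  shows "\<bar>p n x - p n y\<bar> \<le> C.uncoupled n (x, y)"
  using xy
proof (induction n arbitrary: x y)
  case (Suc n)
  let ?F = "\<lambda>z. p n (fst z) - p n (snd z)"
  have res: "C.residual ?F (x, y) = p (Suc n) x - p (Suc n) y"
    using Suc.prems integral_pair_prob_diff[OF Q_in Q_in p] integral_pair_prob_diff[OF \<nu> \<nu> p]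
    by (simp add: C.residual_def assms(4))
  have F: "?F \<in> borel_measurable (N \<Otimes>\<^sub>M N)" using p(1)[measurable] by measurable
  have b: "\<bar>?F z\<bar> \<le> 2" "\<bar>?F z\<bar> \<le> C.uncoupled n z" if "z \<in> space (N \<Otimes>\<^sub>M N)" for z
  proof -
    have z: "fst z \<in> space N" "snd z \<in> space N" using that by (auto simp: space_pair_measure)
    show "\<bar>?F z\<bar> \<le> 2" using p(2)[OF z(1), of n] p(2)[OF z(2), of n] by linarith
    show "\<bar>?F z\<bar> \<le> C.uncoupled n z" using Suc.IH[OF z] by simp
  qed
  have u: "\<bar>C.uncoupled n z\<bar> \<le> 2" if "z \<in> space (N \<Otimes>\<^sub>M N)" for z
    using C.abs_uncoupled_le[OF that, of n] by simp
  have xy: "(x, y) \<in> space (N \<Otimes>\<^sub>M N)" using Suc.prems by (simp add: space_pair_measure)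
  have "C.residual ?F (x, y) \<le> C.residual (C.uncoupled n) (x, y)"
    by (rule C.residual_mono[OF F b(1) C.uncoupled_measurable u _ xy]) (use b(2) in \<open>auto simp: abs_le_iff\<close>)
  moreover have "C.residual (\<lambda>z. - ?F z) (x, y) \<le> C.residual (C.uncoupled n) (x, y)"
    by (rule C.residual_mono[OF _ _ C.uncoupled_measurable u _ xy])
       (use b borel_measurable_uminus[OF F] in \<open>auto simp: abs_le_iff\<close>)
  moreover have "C.residual (\<lambda>z. - ?F z) (x, y) = - C.residual ?F (x, y)"
    unfolding C.residual_def by (simp only: Bochner_Integration.integral_minus)
  ultimately show ?case using res by simp
qed (use 0 in simp)

definition gap :: "nat \<Rightarrow> 'a \<Rightarrow> real" where
  "gap n x = (\<integral>y. C.uncoupled n (x, y) \<partial>\<pi>)"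

definition gap_limit :: "'a \<Rightarrow> real" where
  "gap_limit x = (\<integral>y. C.never_coupled (x, y) \<partial>\<pi>)"

lemma section_measurable:
  assumes "f \<in> borel_measurable (N \<Otimes>\<^sub>M N)" "x \<in> space N"
  shows "(\<lambda>y. f (x, y)) \<in> borel_measurable N"
  using assms by measurable

text \<open>The pairwise bound is averaged over \<open>y\<close> with law \<pi>, under which the
  mean of \<open>p n\<close> does not depend on \<open>n\<close>. With \<open>p n x\<close> the
  probability that the chain from \<open>x\<close> is in \<open>B\<close> at time \<open>n\<close>,
  the bound is uniform in \<open>B\<close> and hence one on total variation.\<close>

lemma difference_le_gap:
  fixes p :: "nat \<Rightarrow> 'a \<Rightarrow> real"
  assumes p: "\<And>n. p n \<in> borel_measurable N" "\<And>n x. x \<in> space N \<Longrightarrow> 0 \<le> p n x"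
      "\<And>n x. x \<in> space N \<Longrightarrow> p n x \<le> 1"
    and Suc: "\<And>n x. x \<in> space N \<Longrightarrow> p (Suc n) x = (\<integral>y. p n y \<partial>Q x)"
    and x: "x \<in> space N"
  shows "\<bar>p n x - (\<integral>y. p 0 y \<partial>\<pi>)\<bar> \<le> gap n x"
proof -
  note D = prob_algebraD[OF \<pi>]
  interpret \<pi>: prob_space \<pi> by (rule D(1))
  have abs: "\<bar>p m y\<bar> \<le> 1" if "y \<in> space N" for m y using p(2,3)[OF that, of m] by simp
  have int: "integrable \<pi> (p m)" for m by (rule integrable_bounded_prob[OF \<pi> p(1) abs])
  have inv: "(\<integral>y. p m y \<partial>\<pi>) = (\<integral>y. p 0 y \<partial>\<pi>)" for m
  proof (induction m)
    case (Suc m)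
    have "ennreal (\<integral>y. p (Suc m) y \<partial>\<pi>) = (\<integral>\<^sup>+y. ennreal (p (Suc m) y) \<partial>\<pi>)"
      by (rule nn_integral_eq_integral_prob[OF \<pi> p, symmetric])
    also have "\<dots> = (\<integral>\<^sup>+y. (\<integral>\<^sup>+w. ennreal (p m w) \<partial>Q y) \<partial>\<pi>)"
      using D(3) assms(4) nn_integral_eq_integral_prob[OF Q_in p]
      by (intro nn_integral_cong) simp
    also have "\<dots> = (\<integral>\<^sup>+y. ennreal (p m y) \<partial>\<pi>)" by (rule Q_invariant) (use p in simp)
    also have "\<dots> = ennreal (\<integral>y. p m y \<partial>\<pi>)" by (rule nn_integral_eq_integral_prob[OF \<pi> p])
    finally show ?case
      using Suc integral_prob_bounds(1)[OF \<pi> p(1) p(2) p(3)] by simp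
  qed simp
  have iu: "integrable \<pi> (\<lambda>y. C.uncoupled n (x, y))"
    by (rule integrable_bounded_prob[OF \<pi> section_measurable[OF C.uncoupled_measurable x], of _ 1])
       (use C.abs_uncoupled_le x in \<open>auto simp: space_pair_measure\<close>)
  have 01: "\<bar>p 0 u - p 0 v\<bar> \<le> 1" if "u \<in> space N" "v \<in> space N" for u v
    using p(2,3)[OF that(1), of 0] p(2,3)[OF that(2), of 0] by simp
  have "\<bar>p n x - (\<integral>y. p 0 y \<partial>\<pi>)\<bar> = \<bar>\<integral>y. p n x - p n y \<partial>\<pi>\<bar>"
    using int[of n] inv[of n] by (simp add: \<pi>.prob_space)
  also have "\<dots> \<le> (\<integral>y. \<bar>p n x - p n y\<bar> \<partial>\<pi>)" by (rule integral_abs_bound)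
  also have "\<dots> \<le> gap n x" unfolding gap_def
    by (rule integral_mono[OF _ iu])
       (use int[of n] D(3) x difference_le_uncoupled[OF p(1) abs 01 Suc] in auto)
  finally show ?thesis .
qed

lemma gap_tendsto:
  assumes x: "x \<in> space N"
  shows "(\<lambda>n. gap n x) \<longlonglongrightarrow> gap_limit x"
  unfolding gap_def gap_limit_def
proof (rule integral_dominated_convergence[where w="\<lambda>_. 1"])
  note D = prob_algebraD[OF \<pi>]
  show "(\<lambda>y. C.never_coupled (x, y)) \<in> borel_measurable \<pi>" "\<And>n. (\<lambda>y. C.uncoupled n (x, y)) \<in> borel_measurable \<pi>"
    using section_measurable[OF C.never_coupled_measurable x] section_measurable[OF C.uncoupled_measurable x] D(2)
    by (simp_all cong: measurable_cong_sets)
  show "integrable \<pi> (\<lambda>_. 1::real)" using integrable_bounded_prob[OF \<pi>, of "\<lambda>_. 1" 1] by simp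
  show "AE y in \<pi>. (\<lambda>n. C.uncoupled n (x, y)) \<longlonglongrightarrow> C.never_coupled (x, y)"
    by (rule AE_I2, rule C.uncoupled_tendsto) (use D(3) x in \<open>auto simp: space_pair_measure\<close>)
  show "AE y in \<pi>. norm (C.uncoupled n (x, y)) \<le> 1" for n
    using C.abs_uncoupled_le[of "(x, y)" n for y] D(3) x by (intro AE_I2) (auto simp: space_pair_measure)
qed

lemma gap_limit_measurable[measurable]: "gap_limit \<in> borel_measurable N"
proof -
  interpret \<pi>: prob_space \<pi> by (rule prob_algebraD(1)[OF \<pi>])
  note [measurable_cong] = prob_algebraD(2)[OF \<pi>]
  show ?thesis unfolding gap_limit_def by measurable
qed

lemma gap_limit_bounds:
  assumes x: "x \<in> space N"
  shows "0 \<le> gap_limit x" "gap_limit x \<le> 1"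
  unfolding gap_limit_def
  using integral_prob_bounds[OF \<pi> section_measurable[OF C.never_coupled_measurable x]]
    C.never_coupled_bounds x by (auto simp: space_pair_measure)

lemma nn_gap_limit:
  assumes x: "x \<in> space N"
  shows "ennreal (gap_limit x) = (\<integral>\<^sup>+y. ennreal (C.never_coupled (x, y)) \<partial>\<pi>)"
  unfolding gap_limit_def
  by (rule nn_integral_eq_integral_prob[OF \<pi> section_measurable[OF C.never_coupled_measurable x], of 1, symmetric])
     (use C.never_coupled_bounds x in \<open>auto simp: space_pair_measure\<close>)

lemma gap_limit_AE_zero: "AE x in \<pi>. gap_limit x = 0"
proof -
  interpret \<pi>: prob_space \<pi> by (rule prob_algebraD(1)[OF \<pi>])
  note sp = prob_algebraD(3)[OF \<pi>]
  note [measurable_cong] = prob_algebraD(2)[OF \<pi>]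
  have "(\<integral>\<^sup>+x. ennreal (gap_limit x) \<partial>\<pi>) = (\<integral>\<^sup>+x. (\<integral>\<^sup>+y. ennreal (C.never_coupled (x, y)) \<partial>\<pi>) \<partial>\<pi>)"
    using nn_gap_limit sp by (intro nn_integral_cong) simp
  also have "\<dots> = (\<integral>\<^sup>+z. ennreal (C.never_coupled z) \<partial>(\<pi> \<Otimes>\<^sub>M \<pi>))"
    by (rule nn_integral_pair_prob(1)[OF \<pi> \<pi>, symmetric]) measurable
  also have "\<dots> = 0"
    using C.never_coupled_AE_zero[OF product_pos] by (subst nn_integral_0_iff_AE) auto
  finally have "AE x in \<pi>. ennreal (gap_limit x) = 0"
    by (subst (asm) nn_integral_0_iff_AE) auto
  with AE_space show ?thesis
    by eventually_elim (use gap_limit_bounds sp in \<open>auto simp: ennreal_eq_0_iff order_antisym\<close>)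
qed

text \<open>In the identity for \<open>C.never_coupled\<close> under independent transitions of both
  variables, the integral over \<open>y\<close> absorbs the second transition by invariance of
  \<pi>; only the transition of \<open>x\<close> is left.\<close>

lemma gap_limit_harmonic:
  assumes x: "x \<in> space N"
  shows "(\<integral>y. gap_limit y \<partial>Q x) = gap_limit x"
proof -
  let ?g = "\<lambda>z. ennreal (C.never_coupled z)"
  note sp = prob_algebraD(3)[OF \<pi>]
  have g: "?g \<in> borel_measurable (N \<Otimes>\<^sub>M N)" by measurable
  have m: "(\<lambda>z. \<integral>\<^sup>+v. ?g (snd z, v) \<partial>Q (fst z)) \<in> borel_measurable (N \<Otimes>\<^sub>M N)"
    by (rule nn_integral_Q_measurable) measurable
  have gQ: "?g (x, y) = (\<integral>\<^sup>+w. ?g w \<partial>(Q x \<Otimes>\<^sub>M Q y))" if "y \<in> space N" for y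
  proof -
    have xy: "(x, y) \<in> space (N \<Otimes>\<^sub>M N)" using x that by (simp add: space_pair_measure)
    have "(\<integral>\<^sup>+w. ?g w \<partial>(Q x \<Otimes>\<^sub>M Q y)) = ennreal (\<integral>w. C.never_coupled w \<partial>(Q x \<Otimes>\<^sub>M Q y))"
      by (rule nn_integral_eq_integral_prob[where c=1 and N="N \<Otimes>\<^sub>M N"])
         (use C.never_coupled_bounds x that in \<open>auto intro!: pair_in Q_in\<close>)
    then show ?thesis using C.never_coupled_harmonic[OF product_pos xy] by simp
  qed
  have "ennreal (gap_limit x) = (\<integral>\<^sup>+y. (\<integral>\<^sup>+u. (\<integral>\<^sup>+v. ?g (u, v) \<partial>Q y) \<partial>Q x) \<partial>\<pi>)"
    unfolding nn_gap_limit[OF x]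
    by (rule nn_integral_cong)
       (use sp gQ nn_integral_pair_prob(1)[OF Q_in[OF x] Q_in g] in auto)
  also have "\<dots> = (\<integral>\<^sup>+u. (\<integral>\<^sup>+y. (\<integral>\<^sup>+v. ?g (u, v) \<partial>Q y) \<partial>\<pi>) \<partial>Q x)"
    using nn_integral_pair_prob[OF \<pi> Q_in[OF x] m] by simp
  also have "\<dots> = (\<integral>\<^sup>+u. (\<integral>\<^sup>+v. ?g (u, v) \<partial>\<pi>) \<partial>Q x)"
    using prob_algebraD(3)[OF Q_in[OF x]] g by (intro nn_integral_cong Q_invariant) simp
  also have "\<dots> = (\<integral>\<^sup>+u. ennreal (gap_limit u) \<partial>Q x)"
    using prob_algebraD(3)[OF Q_in[OF x]] nn_gap_limit by (intro nn_integral_cong) simp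
  also have "\<dots> = ennreal (\<integral>u. gap_limit u \<partial>Q x)"
    by (rule nn_integral_eq_integral_prob[OF Q_in[OF x]]) (use gap_limit_bounds in auto)
  finally show ?thesis
    using gap_limit_bounds[OF x] integral_prob_bounds(1)[OF Q_in[OF x] gap_limit_measurable gap_limit_bounds]
    by simp
qed

end

section \<open>Bounded harmonic functions on a half-line\<close>

lemma INF_Suc_decreasing:
  fixes f :: "nat \<Rightarrow> ennreal"
  assumes "\<And>n. f (Suc n) \<le> f n"
  shows "(INF n. f (Suc n)) = (INF n. f n)"
  by (rule INF_eq) (use assms in auto)

locale centred_step = prob_space \<mu> for \<mu> :: "real measure" +
  assumes sets_step[measurable_cong]: "sets \<mu> = sets borel"
    and integrable_step: "integrable \<mu> (\<lambda>y. y)"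
    and centred: "(\<integral>y. y \<partial>\<mu>) = 0"
    and nondegenerate: "0 < (\<integral>y. \<bar>y\<bar> \<partial>\<mu>)"
begin

lemma space_step[simp]: "space \<mu> = UNIV"
  using sets_eq_imp_space_eq[OF sets_step] by simp

definition step :: "(real \<Rightarrow> ennreal) \<Rightarrow> real \<Rightarrow> ennreal" where
  "step f x = (\<integral>\<^sup>+y. f (x + y) \<partial>\<mu>)"

lemma step_measurable[measurable]:
  assumes [measurable]: "f \<in> borel_measurable borel"
  shows "step f \<in> borel_measurable borel"
  unfolding step_def by measurable

lemma step_mono: "(\<And>x. f x \<le> g x) \<Longrightarrow> step f x \<le> step g x"
  unfolding step_def by (rule nn_integral_mono) simp

lemma step_const[simp]: "step (\<lambda>_. c) x = c"
  using emeasure_space_1 by (simp add: step_def)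

lemma reflected: "centred_step (distr \<mu> borel uminus)"
proof -
  have m: "uminus \<in> \<mu> \<rightarrow>\<^sub>M (borel :: real measure)" by measurable
  have "integrable (distr \<mu> borel uminus) (\<lambda>y. y)"
  proof (rule integrable_distr_eq[OF m, THEN iffD2])
    show "(\<lambda>y. y) \<in> borel_measurable (borel :: real measure)" by (rule measurable_ident_sets) (rule refl)
    show "integrable \<mu> (\<lambda>x. - x)" by (rule Bochner_Integration.integrable_minus[OF integrable_step])
  qed
  moreover have "(\<integral>y. y \<partial>distr \<mu> borel uminus) = - (\<integral>y. y \<partial>\<mu>)"
    by (subst integral_distr[OF m]) simp_all
  moreover have "(\<integral>y. \<bar>y\<bar> \<partial>distr \<mu> borel uminus) = (\<integral>y. \<bar>y\<bar> \<partial>\<mu>)"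
    by (subst integral_distr[OF m]) simp_all
  ultimately show ?thesis
    by (intro centred_step.intro prob_space_distr[OF m] centred_step_axioms.intro)
       (simp_all add: centred nondegenerate)
qed

lemma not_AE_nonpos: "\<not> (AE y in \<mu>. y \<le> 0)"
proof
  assume "AE y in \<mu>. y \<le> 0"
  then have "AE y in \<mu>. 0 \<le> - y" by simp
  then have "AE y in \<mu>. - y = 0"
    using integral_nonneg_eq_0_iff_AE[of \<mu> "\<lambda>y. - y"] integrable_step centred by simp
  then have "(\<integral>y. \<bar>y\<bar> \<partial>\<mu>) = 0" by (intro integral_eq_zero_AE) auto
  with nondegenerate show False by simp
qed

lemma not_AE_nonneg: "\<not> (AE y in \<mu>. 0 \<le> y)"
proof
  interpret R: centred_step "distr \<mu> borel uminus" by (rule reflected)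
  assume "AE y in \<mu>. 0 \<le> y"
  then have "AE y in distr \<mu> borel uminus. y \<le> 0" by (simp add: AE_distr_iff)
  then show False using R.not_AE_nonpos by simp
qed

lemma exists_large_down_step: "\<exists>\<delta>>0. \<not> (AE y in \<mu>. - \<delta> \<le> y)"
proof (rule ccontr)
  assume "\<not> ?thesis"
  then have "AE y in \<mu>. - inverse (Suc n) \<le> y" for n by simp
  then have "AE y in \<mu>. \<forall>n. - inverse (Suc n) \<le> y" by (simp add: AE_all_countable)
  then have "AE y in \<mu>. 0 \<le> y"
  proof eventually_elim
    case (elim y)
    have "(\<lambda>n. - inverse (real (Suc n))) \<longlonglongrightarrow> - 0"
      by (intro tendsto_minus LIMSEQ_inverse_real_of_nat)
    then show ?case using elim by (auto intro: LIMSEQ_le_const2)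
  qed
  then show False using not_AE_nonneg by simp
qed

text \<open>For the primitive \<open>U\<close> of \<open>v\<close> the drift \<open>E (U (c + X) - U c)\<close> does not depend on \<open>c \<ge> 0\<close>, tends
  to \<open>v(\<infinity>) E X = 0\<close> as \<open>c\<close> grows, and is at least \<open>v c * E X = 0\<close> by convexity of \<open>U\<close>; hence the
  convexity inequality is an equality almost surely.\<close>

lemma monotone_harmonic_zero:
  fixes v :: "real \<Rightarrow> real"
  assumes mono: "mono v" and bounds: "\<And>x. 0 \<le> v x" "\<And>x. v x \<le> 1"
    and neg: "\<And>x. x < 0 \<Longrightarrow> v x = 0"
    and harm: "\<And>x. 0 \<le> x \<Longrightarrow> ennreal (v x) = step (\<lambda>z. ennreal (v z)) x"
  shows "v x = 0"
proof -
  have m[measurable]: "v \<in> borel_measurable borel" by (rule borel_measurable_mono[OF mono])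
  define F where "F a b = (\<integral>z. indicator {a<..b} z * v z \<partial>lborel)" for a b
  have int: "integrable lborel (\<lambda>z. indicator {a<..b} z * v z)" for a b :: real
  proof (rule Bochner_Integration.integrable_bound)
    show "integrable lborel (indicator {a<..b} :: real \<Rightarrow> real)"
      by (cases "a \<le> b") (auto intro!: integrable_real_indicator)
  qed (use bounds in \<open>auto simp: indicator_def\<close>)
  have F_nn: "ennreal (F a b) = (\<integral>\<^sup>+z. indicator {a<..b} z * ennreal (v z) \<partial>lborel)" for a b
    unfolding F_def using bounds
    by (subst nn_integral_eq_integral[symmetric, OF int])
       (auto intro!: nn_integral_cong simp: indicator_def)
  have F_add: "F a c = F a b + F b c" if "a \<le> b" "b \<le> c" for a b c
  proof -
    have "F a c = (\<integral>z. indicator {a<..b} z * v z + indicator {b<..c} z * v z \<partial>lborel)"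
      unfolding F_def using that by (intro Bochner_Integration.integral_cong) (auto simp: indicator_def)
    then show ?thesis unfolding F_def using int by simp
  qed
  have F_ge: "v a * (b - a) \<le> F a b" and F_le: "F a b \<le> v b * (b - a)" if "a \<le> b" for a b
  proof -
    have c: "integrable lborel (\<lambda>z. indicator {a<..b} z * k)" "(\<integral>z. indicator {a<..b} z * k \<partial>lborel) = k * (b - a)" for k :: real
      using that by (auto intro: integrable_mult_left)
    show "v a * (b - a) \<le> F a b" unfolding F_def c(2)[symmetric]
      by (rule integral_mono[OF c(1) int]) (auto simp: indicator_def intro: monoD[OF mono])
    show "F a b \<le> v b * (b - a)" unfolding F_def c(2)[symmetric]
      by (rule integral_mono[OF int c(1)]) (auto simp: indicator_def intro: monoD[OF mono])
  qed
  define U where "U t = (if 0 \<le> t then F 0 t else 0)" for t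
  have U_diff: "U b - U a = F a b" if "a \<le> b" for a b
  proof -
    have z: "F a b = 0" if "b \<le> 0" for a b
    proof -
      have "AE z in lborel. indicator {a<..b} z * v z = 0"
        using AE_lborel_singleton[of 0] by eventually_elim (use neg that in \<open>auto simp: indicator_def\<close>)
      then show ?thesis unfolding F_def by (rule integral_eq_zero_AE)
    qed
    consider "0 \<le> a" | "a < 0" "0 \<le> b" | "b < 0" using that by linarith
    then show ?thesis
    proof cases
      case 1 then show ?thesis using F_add[of 0 a b] that by (simp add: U_def)
    next
      case 2 then show ?thesis using F_add[of a 0 b] z[of 0 a] by (simp add: U_def)
    next
      case 3 then show ?thesis using z[of b a] that by (simp add: U_def)
    qed
  qed
  have U_ge: "v c * y \<le> U (c + y) - U c" for c y
  proof (cases "0 \<le> y")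
    case True then show ?thesis using U_diff[of c "c + y"] F_ge[of c "c + y"] by simp
  next
    case False then show ?thesis using U_diff[of "c + y" c] F_le[of "c + y" c] by (simp add: algebra_simps)
  qed
  have U_le: "U (c + y) - U c \<le> v (c + y) * y" for c y
    using U_ge[of "c + y" "- y"] by simp
  have Ulip: "\<bar>U (c + y) - U c\<bar> \<le> \<bar>y\<bar>" for c y
  proof -
    have "\<bar>v c * y\<bar> \<le> \<bar>y\<bar>" "\<bar>v (c + y) * y\<bar> \<le> \<bar>y\<bar>"
      using bounds by (auto simp: abs_mult intro!: mult_left_le_one_le)
    then show ?thesis using U_ge[of c y] U_le[of c y] by linarith
  qed
  have Umono: "mono U"
  proof (rule monoI)
    fix s t :: real assume "s \<le> t"
    then show "U s \<le> U t" using U_diff[of s t] F_ge[of s t] bounds(1)[of s]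
      by (smt (verit) mult_nonneg_nonneg)
  qed
  have Um[measurable]: "U \<in> borel_measurable borel" by (rule borel_measurable_mono[OF Umono])
  have iU: "integrable \<mu> (\<lambda>y. U (c + y) - U c)" for c
    by (rule Bochner_Integration.integrable_bound[OF integrable_step]) (use Ulip in auto)
  define D where "D c = (\<integral>y. U (c + y) - U c \<partial>\<mu>)" for c
  \<comment> \<open>Integrating the harmonicity of \<open>v\<close> over \<open>{c<..L}\<close>,
    which lies in the nonnegative half-line, and exchanging integrals gives
    \<open>U L - U c = E (U (L + X) - U (c + X))\<close>. This is \<open>D L = D c\<close>.\<close>
  have D_const: "D L = D c" if cL: "0 \<le> c" "c \<le> L" for c L
  proof -
    interpret P: pair_sigma_finite lborel \<mu> ..
    have split: "(\<lambda>y. U (L + y) - U (c + y)) = (\<lambda>y. (U (L + y) - U L) - (U (c + y) - U c) + (U L - U c))"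
      by (rule ext) simp
    have "ennreal (F c L) = (\<integral>\<^sup>+z. (\<integral>\<^sup>+y. indicator {c<..L} z * ennreal (v (z + y)) \<partial>\<mu>) \<partial>lborel)"
      unfolding F_nn
    proof (rule nn_integral_cong)
      fix z :: real
      show "indicator {c<..L} z * ennreal (v z) = (\<integral>\<^sup>+y. indicator {c<..L} z * ennreal (v (z + y)) \<partial>\<mu>)"
        using harm[of z] cL by (subst nn_integral_cmult) (auto simp: indicator_def step_def)
    qed
    also have "\<dots> = (\<integral>\<^sup>+y. (\<integral>\<^sup>+z. indicator {c<..L} z * ennreal (v (z + y)) \<partial>lborel) \<partial>\<mu>)"
      by (rule P.Fubini'[symmetric]) measurable
    also have "\<dots> = (\<integral>\<^sup>+y. ennreal (U (L + y) - U (c + y)) \<partial>\<mu>)"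
    proof (rule nn_integral_cong)
      fix y :: real
      have "U (L + y) - U (c + y) = F (c + y) (L + y)" using U_diff[of "c + y" "L + y"] cL by simp
      also have "ennreal \<dots> = (\<integral>\<^sup>+z. indicator {c + y<..L + y} (y + 1 * z) * ennreal (v (y + 1 * z)) \<partial>lborel)"
        unfolding F_nn by (subst nn_integral_real_affine[where c=1 and t=y]) auto
      also have "\<dots> = (\<integral>\<^sup>+z. indicator {c<..L} z * ennreal (v (z + y)) \<partial>lborel)"
        by (intro nn_integral_cong) (auto simp: indicator_def add.commute)
      finally show "(\<integral>\<^sup>+z. indicator {c<..L} z * ennreal (v (z + y)) \<partial>lborel) = ennreal (U (L + y) - U (c + y))" ..
    qed
    also have "\<dots> = ennreal (\<integral>y. U (L + y) - U (c + y) \<partial>\<mu>)"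
    proof (rule nn_integral_eq_integral)
      show "integrable \<mu> (\<lambda>y. U (L + y) - U (c + y))"
        unfolding split by (intro Bochner_Integration.integrable_add Bochner_Integration.integrable_diff iU) simp_all
      show "AE y in \<mu>. 0 \<le> U (L + y) - U (c + y)" using cL by (auto intro!: monoD[OF Umono])
    qed
    finally have "F c L = (\<integral>y. U (L + y) - U (c + y) \<partial>\<mu>)"
      using F_ge[of c L] bounds(1)[of c] cL
      by (subst (asm) ennreal_inj) (auto intro!: integral_nonneg_AE AE_I2 monoD[OF Umono] intro: order_trans[rotated])
    also have "\<dots> = D L - D c + (U L - U c)"
      unfolding split D_def
      by (subst Bochner_Integration.integral_add) (simp_all only: Bochner_Integration.integrable_diff iU Bochner_Integration.integral_diff integrable_const lebesgue_integral_const prob_space, simp)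
    finally show ?thesis using U_diff[of c L] cL by simp
  qed
  have D0: "D c = 0" if c: "0 \<le> c" for c
  proof -
    obtain s where s: "(\<lambda>n. v (real n)) \<longlonglongrightarrow> s"
    proof (rule incseq_convergent[of "\<lambda>n. v (real n)" 1])
      show "incseq (\<lambda>n. v (real n))" by (auto intro!: incseq_SucI monoD[OF mono])
    qed (use bounds in auto)
    have s2: "(\<lambda>n. v (real n + y)) \<longlonglongrightarrow> s" for y
    proof -
      define k where "k = nat \<lceil>\<bar>y\<bar>\<rceil>"
      have k: "\<bar>y\<bar> \<le> real k" unfolding k_def by linarith
      have up: "(\<lambda>n. v (real (n + 2 * k))) \<longlonglongrightarrow> s"
        by (rule LIMSEQ_ignore_initial_segment[where f="\<lambda>n. v (real n)", OF s])
      have "v (real n) \<le> v (real (n + k) + y)" "v (real (n + k) + y) \<le> v (real (n + 2 * k))" for n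
        using k by (auto intro!: monoD[OF mono])
      then have "(\<lambda>n. v (real (n + k) + y)) \<longlonglongrightarrow> s"
        by (intro tendsto_sandwich[OF _ _ s up] always_eventually allI)
      then show ?thesis by (rule LIMSEQ_offset)
    qed
    have "(\<lambda>n. D (real n)) \<longlonglongrightarrow> (\<integral>y. s * y \<partial>\<mu>)"
      unfolding D_def
    proof (rule integral_dominated_convergence[where w="\<lambda>y. \<bar>y\<bar>"])
      show "AE y in \<mu>. (\<lambda>n. U (real n + y) - U (real n)) \<longlonglongrightarrow> s * y"
      proof (rule AE_I2, rule tendsto_sandwich)
        fix y :: real
        show "(\<lambda>n. v (real n) * y) \<longlonglongrightarrow> s * y" by (intro tendsto_intros s)
        show "(\<lambda>n. v (real n + y) * y) \<longlonglongrightarrow> s * y" by (intro tendsto_intros s2)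
      qed (simp_all add: U_ge U_le)
      show "integrable \<mu> (\<lambda>y. \<bar>y\<bar>)" using integrable_step by (rule integrable_abs)
      show "AE y in \<mu>. norm (U (real n + y) - U (real n)) \<le> \<bar>y\<bar>" for n
        by (rule AE_I2) (use Ulip in simp)
    qed measurable
    then have "(\<lambda>n. D (real n)) \<longlonglongrightarrow> 0" using centred by simp
    moreover have "(\<lambda>n. D (real n)) \<longlonglongrightarrow> D c"
    proof (rule tendsto_eventually)
      show "\<forall>\<^sub>F n in sequentially. D (real n) = D c"
        using eventually_ge_at_top[of "nat \<lceil>c\<rceil>"]
        by eventually_elim (rule D_const[OF c], linarith)
    qed
    ultimately show ?thesis by (metis LIMSEQ_unique)
  qed
  have affine: "AE y in \<mu>. U (c + y) - U c = v c * y" if c: "0 \<le> c" for c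
  proof -
    have i: "integrable \<mu> (\<lambda>y. U (c + y) - U c - v c * y)"
      by (intro Bochner_Integration.integrable_diff iU integrable_mult_right integrable_step)
    have "(\<integral>y. U (c + y) - U c - v c * y \<partial>\<mu>) = 0"
      using D0[OF c] iU[of c] integrable_step centred unfolding D_def by simp
    then have "AE y in \<mu>. U (c + y) - U c - v c * y = 0"
      using integral_nonneg_eq_0_iff_AE[OF i] U_ge by simp
    then show ?thesis by simp
  qed
  obtain \<delta> where \<delta>: "0 < \<delta>" "\<not> (AE y in \<mu>. - \<delta> \<le> y)" using exists_large_down_step by blast
  \<comment> \<open>Some jump below \<open>- \<delta>\<close> satisfies the equality, which makes
    \<open>U\<close> affine on \<open>[c + y, c]\<close>; its slope at \<open>c - \<delta>\<close>
    is then not below \<open>v c\<close>. Since \<delta> is the same for all \<open>c\<close>,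
    finitely many repetitions lead to negative points, where \<open>v\<close> is zero.\<close>
  have down: "v c \<le> v (c - \<delta>)" if c: "0 \<le> c" for c
  proof -
    have "\<exists>y. U (c + y) - U c = v c * y \<and> y < - \<delta>"
    proof (rule ccontr)
      assume *: "\<not> ?thesis"
      have "AE y in \<mu>. - \<delta> \<le> y"
        using affine[OF c] by eventually_elim (use * in \<open>auto simp: not_less\<close>)
      with \<delta>(2) show False by simp
    qed
    then obtain y where y: "U (c + y) - U c = v c * y" "y < - \<delta>" by auto
    have "F (c + y) c = F (c + y) (c - \<delta>) + F (c - \<delta>) c" using y(2) \<delta>(1) by (intro F_add) auto
    moreover have "F (c + y) (c - \<delta>) \<le> v (c - \<delta>) * (- \<delta> - y)" using F_le[of "c + y" "c - \<delta>"] y(2) by simp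
    moreover have "F (c - \<delta>) c \<le> v c * \<delta>" using F_le[of "c - \<delta>" c] \<delta>(1) by simp
    moreover have "F (c + y) c = v c * (- y)" using U_diff[of "c + y" c] y \<delta>(1) by simp
    ultimately have "v c * (- \<delta> - y) \<le> v (c - \<delta>) * (- \<delta> - y)" by (simp add: algebra_simps)
    then show ?thesis using y(2) by (simp add: mult_le_cancel_right)
  qed
  have "v x = 0" if "x < real n * \<delta>" for n x
    using that
  proof (induction n arbitrary: x)
    case (Suc n)
    show ?case
    proof (cases "x < 0")
      case False
      then have "v x \<le> v (x - \<delta>)" by (intro down) simp
      also have "\<dots> = 0" by (rule Suc.IH) (use Suc.prems in \<open>simp add: algebra_simps\<close>)
      finally show ?thesis using bounds(1)[of x] by simp
    qed (rule neg)
  qed (simp add: neg)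
  moreover obtain n :: nat where "x < real n * \<delta>" using reals_Archimedean3[OF \<delta>(1)] by auto
  ultimately show ?thesis by blast
qed

section \<open>One-step operators split by whether the step crosses zero upwards\<close>

definition cross :: "(real \<Rightarrow> ennreal) \<Rightarrow> real \<Rightarrow> ennreal" where
  "cross f x = (\<integral>\<^sup>+y. (if x < 0 \<and> 0 \<le> x + y then f (x + y) else 0) \<partial>\<mu>)"

definition stay :: "(real \<Rightarrow> ennreal) \<Rightarrow> real \<Rightarrow> ennreal" where
  "stay f x = (\<integral>\<^sup>+y. (if x < 0 \<and> 0 \<le> x + y then 0 else f (x + y)) \<partial>\<mu>)"

lemma cross_measurable[measurable]:
  assumes [measurable]: "f \<in> borel_measurable borel"
  shows "cross f \<in> borel_measurable borel"
  unfolding cross_def by measurable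

lemma stay_measurable[measurable]:
  assumes [measurable]: "f \<in> borel_measurable borel"
  shows "stay f \<in> borel_measurable borel"
  unfolding stay_def by measurable

lemma stay_iterate_measurable[measurable]:
  "f \<in> borel_measurable borel \<Longrightarrow> (stay ^^ n) f \<in> borel_measurable borel"
  by (induction n) auto

lemma step_iterate_measurable[measurable]:
  "f \<in> borel_measurable borel \<Longrightarrow> (step ^^ n) f \<in> borel_measurable borel"
  by (induction n) auto

lemma cross_plus_stay:
  assumes [measurable]: "f \<in> borel_measurable borel"
  shows "cross f x + stay f x = step f x"
proof -
  have "cross f x + stay f x =
    (\<integral>\<^sup>+y. (if x < 0 \<and> 0 \<le> x + y then f (x + y) else 0) + (if x < 0 \<and> 0 \<le> x + y then 0 else f (x + y)) \<partial>\<mu>)"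
    unfolding cross_def stay_def by (rule nn_integral_add[symmetric]) measurable
  also have "\<dots> = step f x" unfolding step_def by (intro nn_integral_cong) simp
  finally show ?thesis .
qed

lemma stay_add:
  assumes [measurable]: "f \<in> borel_measurable borel" "g \<in> borel_measurable borel"
  shows "stay (\<lambda>z. f z + g z) x = stay f x + stay g x"
proof -
  have "stay f x + stay g x =
    (\<integral>\<^sup>+y. (if x < 0 \<and> 0 \<le> x + y then 0 else f (x + y)) + (if x < 0 \<and> 0 \<le> x + y then 0 else g (x + y)) \<partial>\<mu>)"
    unfolding stay_def by (rule nn_integral_add[symmetric]) measurable
  also have "\<dots> = stay (\<lambda>z. f z + g z) x" unfolding stay_def by (intro nn_integral_cong) simp
  finally show ?thesis ..
qed

lemma stay_mono: "(\<And>x. f x \<le> g x) \<Longrightarrow> stay f x \<le> stay g x"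
  unfolding stay_def by (rule nn_integral_mono) simp

lemma stay_iterate_mono: "(\<And>x. f x \<le> g x) \<Longrightarrow> (stay ^^ n) f x \<le> (stay ^^ n) g x"
  by (induction n arbitrary: x) (auto intro: stay_mono)

lemma stay_le_step: "stay f x \<le> step f x"
  unfolding stay_def step_def by (rule nn_integral_mono) simp

lemma stay_nonneg: "0 \<le> x \<Longrightarrow> stay f x = step f x"
  unfolding stay_def step_def by (intro nn_integral_cong) simp

lemma cross_nonneg: "0 \<le> x \<Longrightarrow> cross f x = 0"
  unfolding cross_def by simp

text \<open>The iterates of the killed walk operator applied to \<open>1\<close> dominate \<open>f\<close>, and their limit is
  nondecreasing, so \<open>monotone_harmonic_zero\<close> applies to it.\<close>

lemma excessive_zero:
  assumes le1: "\<And>x. f x \<le> 1" and neg: "\<And>x. x < 0 \<Longrightarrow> f x = 0" and exc: "\<And>x. f x \<le> step f x"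
  shows "f x = 0"
proof -
  define kill where "kill f x = (if 0 \<le> x then step f x else 0)" for f x
  \<comment> \<open>For \<open>n \<ge> 1\<close>, \<open>u n x\<close> is the probability that the
    walk from \<open>x\<close> is nonnegative at the times \<open>0\<close> to \<open>n - 1\<close>;
    its limit \<open>w\<close> is the probability of staying nonnegative forever.\<close>
  define u where "u n = (kill ^^ n) (\<lambda>_. 1)" for n
  have u_Suc: "u (Suc n) = kill (u n)" and u_0: "u 0 = (\<lambda>_. 1)" for n by (auto simp: u_def)
  have kill_mono: "kill f x \<le> kill g x" if "\<And>x. f x \<le> g x" for f g x
    using step_mono[of f g x] that by (simp add: kill_def)
  have um[measurable]: "u n \<in> borel_measurable borel" for n
  proof (induction n)
    case (Suc n)
    note Suc[measurable]
    show ?case unfolding u_Suc kill_def by measurable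
  qed (simp add: u_0)
  have dec: "u (Suc n) x \<le> u n x" for n x
  proof (induction n arbitrary: x)
    case 0 show ?case by (simp add: u_Suc u_0 kill_def)
  next
    case (Suc n) then show ?case unfolding u_Suc[of "Suc n"] u_Suc[of n]
      by (intro kill_mono) (simp add: u_Suc)
  qed
  have decs: "decseq u" by (rule decseq_SucI) (auto simp: le_fun_def dec)
  have u_le1: "u n x \<le> 1" for n x
    using decseqD[OF decs, of 0 n] by (simp add: u_0 le_fun_def)
  have u_mono: "mono (u n)" for n
  proof (induction n)
    case (Suc n)
    show ?case
    proof (rule monoI)
      fix x y :: real assume "x \<le> y"
      then have "step (u n) x \<le> step (u n) y"
        unfolding step_def using Suc by (intro nn_integral_mono) (simp add: mono_def)
      with \<open>x \<le> y\<close> show "u (Suc n) x \<le> u (Suc n) y" by (simp add: u_Suc kill_def)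
    qed
  qed (simp add: u_0 mono_def)
  define w where "w x = (INF n. u n x)" for x
  have w_le1: "w x \<le> 1" for x unfolding w_def by (rule INF_lower2[of 0]) (auto simp: u_0)
  have w_mono: "mono w" unfolding w_def mono_def
    by (auto intro!: INF_mono' simp: monoD[OF u_mono])
  have w_neg: "w x = 0" if "x < 0" for x
  proof -
    have "w x \<le> u 1 x" unfolding w_def by (rule INF_lower) simp
    then show ?thesis using that u_Suc[of 0] by (simp add: kill_def)
  qed
  have w_step: "w x = step w x" if x: "0 \<le> x" for x
  proof -
    have "decseq (\<lambda>n y. u n (x + y))" by (rule decseq_SucI) (auto simp: le_fun_def dec)
    moreover have "(\<integral>\<^sup>+y. u 0 (x + y) \<partial>\<mu>) < \<infinity>" using emeasure_space_1 by (simp add: u_0)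
    ultimately have "step w x = (INF n. step (u n) x)"
      unfolding step_def w_def
      by (intro nn_integral_monotone_convergence_INF_decseq[of _ _ 0])
         (auto simp: order.strict_trans1[OF nn_integral_mono[of \<mu> _ "\<lambda>_. 1"]] u_le1 emeasure_space_1[simplified])
    also have "\<dots> = (INF n. u (Suc n) x)" using x by (simp add: u_Suc kill_def)
    also have "\<dots> = w x" unfolding w_def by (rule INF_Suc_decreasing) (rule dec)
    finally show ?thesis ..
  qed
  have fin: "w x < top" for x using w_le1[of x] by (rule le_less_trans) simp
  have "enn2real (w x) = 0"
  proof (rule monotone_harmonic_zero[where v="\<lambda>x. enn2real (w x)"])
    show "mono (\<lambda>x. enn2real (w x))"
      using w_mono fin by (auto simp: mono_def intro!: enn2real_mono)
    show "ennreal (enn2real (w x)) = step (\<lambda>z. ennreal (enn2real (w z))) x" if "0 \<le> x" for x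
      using w_step[OF that, symmetric] fin by simp
    show "enn2real (w x) \<le> 1" for x using enn2real_mono[OF w_le1[of x]] by simp
  qed (use w_neg in auto)
  then have "w x = 0" using fin[of x] by (auto simp add: enn2real_eq_0_iff)
  moreover have "f x \<le> u n x" for n x
  proof (induction n arbitrary: x)
    case (Suc n)
    have "f x \<le> kill f x" using neg[of x] exc[of x] by (simp add: kill_def)
    also have "\<dots> \<le> kill (u n) x" by (rule kill_mono) (rule Suc)
    finally show ?case by (simp add: u_Suc)
  qed (simp add: u_0 le1)
  then have "f x \<le> w x" unfolding w_def by (intro INF_greatest) simp
  ultimately show ?thesis by simp
qed

lemma excessive_zero_neg:
  assumes m[measurable]: "f \<in> borel_measurable borel"
    and le1: "\<And>x. f x \<le> 1" and pos: "\<And>x. 0 \<le> x \<Longrightarrow> f x = 0" and exc: "\<And>x. f x \<le> step f x"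
  shows "f x = 0"
proof -
  interpret R: centred_step "distr \<mu> borel uminus" by (rule reflected)
  have "f (- (- x)) = 0"
  proof (rule R.excessive_zero[where f="\<lambda>x. f (- x)"])
    show "f (- x) \<le> R.step (\<lambda>x. f (- x)) x" for x
    proof -
      have "R.step (\<lambda>x. f (- x)) x = step f (- x)"
        unfolding R.step_def step_def by (subst nn_integral_distr) auto
      then show ?thesis using exc[of "- x"] by simp
    qed
  qed (use le1 pos in auto)
  then show ?thesis by simp
qed

lemma stay_iterate_Suc_le: "(stay ^^ Suc n) (\<lambda>_. 1) x \<le> (stay ^^ n) (\<lambda>_. 1) x"
proof (induction n arbitrary: x)
  case 0
  show ?case using stay_le_step[of "\<lambda>_. 1" x] by simp
next
  case (Suc n)
  show ?case using stay_mono[of "(stay ^^ Suc n) (\<lambda>_. 1)" "(stay ^^ n) (\<lambda>_. 1)" x] Suc by simp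
qed

text \<open>The iterates are the probabilities of no up-crossing within \<open>n\<close> steps, and
  their limit satisfies \<open>w = stay w\<close>. From a negative point a move into the nonnegative
  half-line contributes nothing, so \<open>w\<close> cut off to negative points solves the problem
  of \<open>excessive_zero_neg\<close>. Once it vanishes there, \<open>excessive_zero\<close>
  applies to \<open>w\<close> itself.\<close>

lemma stay_iterate_tendsto_0: "(\<lambda>n. (stay ^^ n) (\<lambda>_. 1) x) \<longlonglongrightarrow> 0"
proof -
  define u where "u n = (stay ^^ n) (\<lambda>_. 1)" for n
  have dec: "u (Suc n) x \<le> u n x" for n x unfolding u_def by (rule stay_iterate_Suc_le)
  have decs: "decseq u" by (rule decseq_SucI) (auto simp: le_fun_def dec)
  have um[measurable]: "u n \<in> borel_measurable borel" for n unfolding u_def by measurable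
  have u_le1: "u n x \<le> 1" for n x
    using decseqD[OF decs, of 0 n] by (simp add: u_def le_fun_def)
  define w where "w x = (INF n. u n x)" for x
  have wm[measurable]: "w \<in> borel_measurable borel" unfolding w_def by measurable
  have w_le1: "w x \<le> 1" for x unfolding w_def by (rule INF_lower2[of 0]) (auto simp: u_def)
  have w_stay: "w x = stay w x" for x
  proof -
    have "stay w x = (\<integral>\<^sup>+y. (INF n. if x < 0 \<and> 0 \<le> x + y then 0 else u n (x + y)) \<partial>\<mu>)"
      unfolding stay_def w_def by (intro nn_integral_cong) simp
    also have "\<dots> = (INF n. stay (u n) x)"
      unfolding stay_def
    proof (intro nn_integral_monotone_convergence_INF_decseq[of _ _ 0])
      show "decseq (\<lambda>n y. if x < 0 \<and> 0 \<le> x + y then 0 else u n (x + y))"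
        by (rule decseq_SucI) (auto simp: le_fun_def dec)
      have "(\<integral>\<^sup>+y. (if x < 0 \<and> 0 \<le> x + y then 0 else u 0 (x + y)) \<partial>\<mu>) \<le> (\<integral>\<^sup>+y. 1 \<partial>\<mu>)"
        by (rule nn_integral_mono) (simp add: u_le1)
      also have "\<dots> < \<infinity>" using emeasure_space_1 by simp
      finally show "(\<integral>\<^sup>+y. (if x < 0 \<and> 0 \<le> x + y then 0 else u 0 (x + y)) \<partial>\<mu>) < \<infinity>" .
    qed measurable
    also have "\<dots> = (INF n. u (Suc n) x)" by (simp add: u_def)
    also have "\<dots> = w x" unfolding w_def by (rule INF_Suc_decreasing) (rule dec)
    finally show ?thesis ..
  qed
  have neg: "w x = 0" if "x < 0" for x
  proof -
    have "(if x < 0 then w x else 0) = 0"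
    proof (rule excessive_zero_neg[where f="\<lambda>x. if x < 0 then w x else 0"])
      fix x :: real
      show "(if x < 0 then w x else 0) \<le> step (\<lambda>x. if x < 0 then w x else 0) x"
      proof (cases "x < 0")
        case True
        have "w x = stay w x" by (rule w_stay)
        also have "\<dots> = step (\<lambda>x. if x < 0 then w x else 0) x"
          unfolding stay_def step_def using True by (intro nn_integral_cong) auto
        finally show ?thesis using True by simp
      qed simp
    qed (auto simp: w_le1)
    then show ?thesis using that by simp
  qed
  have "w x = 0"
  proof (rule excessive_zero[OF w_le1 neg])
    show "w x \<le> step w x" for x using w_stay[of x] stay_le_step[of w x] by simp
  qed
  moreover have "(\<lambda>n. u n x) \<longlonglongrightarrow> w x" unfolding w_def
    by (rule LIMSEQ_INF) (rule decseq_SucI, rule dec)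
  ultimately show ?thesis by (simp add: u_def)
qed

text \<open>Iterating the equation leaves the remainder \<open>(stay ^^ n) D\<close>, which is at
  most the probability of no crossing in \<open>n\<close> steps. A solution bounded by 1 is thus
  determined by \<open>h\<close>; this identifies quantities that are defined through paths.\<close>

lemma crossing_series:
  assumes D[measurable]: "D \<in> borel_measurable borel" and h[measurable]: "h \<in> borel_measurable borel"
    and le1: "\<And>x. D x \<le> 1" and eq: "\<And>x. D x = cross h x + stay D x"
  shows "D x = (\<Sum>n. (stay ^^ n) (cross h) x)"
proof -
  have part: "D x = (\<Sum>k<n. (stay ^^ k) (cross h) x) + (stay ^^ n) D x" for n x
  proof (induction n arbitrary: x)
    case (Suc n)
    have add: "(stay ^^ n) (\<lambda>z. f z + g z) x = (stay ^^ n) f x + (stay ^^ n) g x"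
      if [measurable]: "f \<in> borel_measurable borel" "g \<in> borel_measurable borel" for f g n x
    proof (induction n arbitrary: x)
      case (Suc n)
      have "(stay ^^ n) (\<lambda>z. f z + g z) = (\<lambda>z. (stay ^^ n) f z + (stay ^^ n) g z)" using Suc by auto
      then show ?case by (simp add: stay_add)
    qed simp
    have "D = (\<lambda>z. cross h z + stay D z)" using eq by auto
    then have "(stay ^^ n) D x = (stay ^^ n) (\<lambda>z. cross h z + stay D z) x" by simp
    also have "\<dots> = (stay ^^ n) (cross h) x + (stay ^^ Suc n) D x"
      by (subst add) (auto simp: funpow_swap1)
    finally show ?case using Suc[of x] by (simp add: add.assoc)
  qed simp
  have "(\<lambda>n. (stay ^^ n) D x) \<longlonglongrightarrow> 0"
    by (rule tendsto_sandwich[OF _ _ tendsto_const stay_iterate_tendsto_0[of x]])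
       (auto intro!: always_eventually stay_iterate_mono le1)
  moreover have "(\<lambda>n. \<Sum>k<n. (stay ^^ k) (cross h) x) \<longlonglongrightarrow> (\<Sum>n. (stay ^^ n) (cross h) x)"
    by (rule summable_LIMSEQ) simp
  ultimately have "(\<lambda>n. (\<Sum>k<n. (stay ^^ k) (cross h) x) + (stay ^^ n) D x) \<longlonglongrightarrow> (\<Sum>n. (stay ^^ n) (cross h) x) + 0"
    by (intro tendsto_add)
  then have "(\<lambda>n. D x) \<longlonglongrightarrow> (\<Sum>n. (stay ^^ n) (cross h) x)" by (simp flip: part)
  then show ?thesis by (rule LIMSEQ_const_iff[THEN iffD1])
qed

end

section \<open>Crossing times under a shift of the path\<close>

text \<open>Crossing times are handled through their strict comparisons with finite times: the
  infimum becomes a bounded existential, and infinite times need no separate treatment.\<close>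

lemma upcrossing_time_Suc_less:
  "upcrossing_time s (Suc n) < enat k \<longleftrightarrow>
    (\<exists>j<k. upcrossing_time s n < enat j \<and> s (j - 1) < 0 \<and> 0 \<le> s j)"
  by (auto simp: Inf_less_iff)

declare upcrossing_time.simps(2)[simp del]

lemma enat_eqI_less:
  assumes "\<And>k. a < enat k \<longleftrightarrow> b < enat k"
  shows "a = b"
proof (rule ccontr)
  have *: "\<not> a < b" if "\<And>k. a < enat k \<longleftrightarrow> b < enat k" for a b
  proof
    assume "a < b"
    then obtain m where m: "a = enat m" by (cases a) auto
    then have "b < enat (Suc m)" using that[of "Suc m"] by simp
    with \<open>a < b\<close> m show False by (cases b) auto
  qed
  assume "a \<noteq> b"
  then show False using *[of a b] *[of b a] assms by (auto simp: neq_iff)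
qed

lemma eSuc_less_enat: "eSuc a < enat k \<longleftrightarrow> (\<exists>k'. k = Suc k' \<and> a < enat k')"
  by (cases k; cases a) (auto simp: eSuc_enat zero_enat_def[symmetric])

lemma upcrossing_time_shift_Suc:
  assumes "upcrossing_time s m = eSuc (upcrossing_time (\<lambda>k. s (Suc k)) n)"
  shows "upcrossing_time s (Suc m) = eSuc (upcrossing_time (\<lambda>k. s (Suc k)) (Suc n))"
proof (rule enat_eqI_less)
  fix k
  \<comment> \<open>An index above a crossing time is positive, so the truncated
    \<open>i - 1\<close> commutes with the shift by one.\<close>
  have "upcrossing_time (\<lambda>k. s (Suc k)) n < enat i \<Longrightarrow> Suc (i - 1) = i" for i
    by (cases i) (auto simp: zero_enat_def[symmetric])
  then have "(\<exists>j<k. eSuc (upcrossing_time (\<lambda>k. s (Suc k)) n) < enat j \<and> s (j - 1) < 0 \<and> 0 \<le> s j) \<longleftrightarrow>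
    (\<exists>i. Suc i < k \<and> upcrossing_time (\<lambda>k. s (Suc k)) n < enat i \<and> s (Suc (i - 1)) < 0 \<and> 0 \<le> s (Suc i))"
    by (fastforce simp: eSuc_less_enat)
  then show "(upcrossing_time s (Suc m) < enat k) =
      (eSuc (upcrossing_time (\<lambda>k. s (Suc k)) (Suc n)) < enat k)"
    by (simp add: upcrossing_time_Suc_less[of s m] assms eSuc_less_enat)
       (auto simp: upcrossing_time_Suc_less[of _ n] gr0_conv_Suc less_Suc_eq_0_disj Suc_less_eq2)
qed

lemma upcrossing_time_shift_cross:
  assumes "s 0 < 0" "0 \<le> s 1"
  shows "upcrossing_time s (Suc n) = eSuc (upcrossing_time (\<lambda>k. s (Suc k)) n)"
proof (induction n)
  case 0
  show ?case
  proof (rule enat_eqI_less)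
    fix k
    have "(\<exists>j<k. 0 < enat j \<and> s (j - 1) < 0 \<and> 0 \<le> s j) \<longleftrightarrow> 1 < k"
      using assms by (auto simp: zero_enat_def intro!: exI[of _ "1::nat"])
    moreover have "eSuc 0 < enat k \<longleftrightarrow> 1 < k"
      by (auto simp: eSuc_less_enat zero_enat_def gr0_conv_Suc less_Suc_eq_0_disj Suc_less_eq2)
    ultimately show "(upcrossing_time s (Suc 0) < enat k) = (eSuc (upcrossing_time (\<lambda>k. s (Suc k)) 0) < enat k)"
      by (simp add: upcrossing_time_Suc_less)
  qed
next
  case (Suc n)
  then show ?case by (rule upcrossing_time_shift_Suc)
qed

lemma upcrossing_time_shift_stay:
  assumes "\<not> (s 0 < 0 \<and> 0 \<le> s 1)"
  shows "upcrossing_time s (Suc n) = eSuc (upcrossing_time (\<lambda>k. s (Suc k)) (Suc n))"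
proof (induction n)
  case 0
  show ?case
  proof (rule enat_eqI_less)
    fix k
    have "(\<exists>j<k. 0 < enat j \<and> s (j - 1) < 0 \<and> 0 \<le> s j) \<longleftrightarrow>
      (\<exists>i. Suc i < k \<and> 0 < enat i \<and> s (Suc (i - 1)) < 0 \<and> 0 \<le> s (Suc i))" (is "?l \<longleftrightarrow> ?r")
    proof
      assume ?l
      then obtain j where j: "j < k" "0 < j" "s (j - 1) < 0" "0 \<le> s j" by (auto simp: zero_enat_def)
      then have "j \<noteq> 1" using assms by auto
      then obtain i where "j = Suc i" "0 < i" using j(2) by (cases j) auto
      then show ?r using j by (intro exI[of _ i]) (auto simp: zero_enat_def)
    next
      assume ?r
      then obtain i where i: "Suc i < k" "0 < i" "s (Suc (i - 1)) < 0" "0 \<le> s (Suc i)"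
        by (auto simp: zero_enat_def)
      then show ?l by (intro exI[of _ "Suc i"]) (auto simp: zero_enat_def)
    qed
    then show "(upcrossing_time s (Suc 0) < enat k) =
        (eSuc (upcrossing_time (\<lambda>k. s (Suc k)) (Suc 0)) < enat k)"
      by (simp add: upcrossing_time_Suc_less[of s 0] eSuc_less_enat)
         (auto simp: upcrossing_time_Suc_less gr0_conv_Suc less_Suc_eq_0_disj Suc_less_eq2)
  qed
next
  case (Suc n)
  then show ?case by (rule upcrossing_time_shift_Suc)
qed

text \<open>The Markov property for single paths: dropping the first position uses up a crossing
  exactly when the first step crosses. An infinite time remains infinite, so the dummy value is the
  same on both sides.\<close>

lemma overshoot_shift:
  "overshoot s (Suc n) =
    (if s 0 < 0 \<and> 0 \<le> s 1 then overshoot (\<lambda>k. s (Suc k)) n else overshoot (\<lambda>k. s (Suc k)) (Suc n))"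
  using upcrossing_time_shift_cross[of s n] upcrossing_time_shift_stay[of s n]
  by (auto simp: overshoot_def eSuc_enat split: enat.split)

lemma measurable_overshoot:
  fixes s :: "'a \<Rightarrow> nat \<Rightarrow> real"
  assumes [measurable]: "\<And>k. (\<lambda>w. s w k) \<in> borel_measurable N"
  shows "(\<lambda>w. overshoot (s w) n) \<in> borel_measurable N"
proof -
  have less[measurable]: "Measurable.pred N (\<lambda>w. upcrossing_time (s w) n < enat k)" for n k
  proof (induction n arbitrary: k)
    case (Suc n)
    note Suc[measurable]
    show ?case unfolding upcrossing_time_Suc_less by measurable
  qed simp
  have enat: "upcrossing_time (s w) n = enat k \<longleftrightarrow>
      upcrossing_time (s w) n < enat (Suc k) \<and> \<not> upcrossing_time (s w) n < enat k" for w k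
    by (cases "upcrossing_time (s w) n") auto
  have infinity: "upcrossing_time (s w) n = \<infinity> \<longleftrightarrow> (\<forall>k. \<not> upcrossing_time (s w) n < enat k)" for w
    by (cases "upcrossing_time (s w) n") auto
  show ?thesis
  proof (rule measurableI)
    fix B :: "real set" assume [measurable]: "B \<in> sets borel"
    have "(\<lambda>w. overshoot (s w) n) -` B \<inter> space N = {w \<in> space N.
        (\<exists>k. upcrossing_time (s w) n = enat k \<and> s w k \<in> B) \<or> (upcrossing_time (s w) n = \<infinity> \<and> 0 \<in> B)}"
      by (auto simp: overshoot_def split: enat.splits)
    also have "\<dots> \<in> sets N" unfolding enat infinity by measurable
    finally show "(\<lambda>w. overshoot (s w) n) -` B \<inter> space N \<in> sets N" .
  qed simp
qed

section \<open>The walk on the space of streams and the laws of its overshoots\<close>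

definition stream_walk :: "real \<Rightarrow> real stream \<Rightarrow> nat \<Rightarrow> real" where
  "stream_walk x \<omega> k = x + (\<Sum>i<k. \<omega> !! i)"

lemma stream_walk_0[simp]: "stream_walk x \<omega> 0 = x"
  by (simp add: stream_walk_def)

lemma stream_walk_Stream[simp]: "stream_walk x (y ## \<omega>) (Suc k) = stream_walk (x + y) \<omega> k"
  by (simp add: stream_walk_def sum.lessThan_Suc_shift del: sum.lessThan_Suc)

lemma overshoot_stream_walk_Stream:
  "overshoot (stream_walk x (y ## \<omega>)) (Suc n) =
    (if x < 0 \<and> 0 \<le> x + y then overshoot (stream_walk (x + y) \<omega>) n
     else overshoot (stream_walk (x + y) \<omega>) (Suc n))"
  by (subst overshoot_shift) simp

context centred_step
begin

lemma stream_walk_measurable[measurable (raw)]: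
  assumes [measurable]: "g \<in> borel_measurable N" "h \<in> N \<rightarrow>\<^sub>M stream_space \<mu>"
  shows "(\<lambda>w. stream_walk (g w) (h w) k) \<in> borel_measurable N"
proof -
  have [measurable]: "(\<lambda>w. h w !! i) \<in> borel_measurable N" for i
    using measurable_compose[OF assms(2) measurable_snth[of i \<mu>]] by (simp cong: measurable_cong_sets add: sets_step)
  show ?thesis unfolding stream_walk_def by measurable
qed

lemma overshoot_walk_measurable[measurable (raw)]:
  assumes [measurable]: "g \<in> borel_measurable N" "h \<in> N \<rightarrow>\<^sub>M stream_space \<mu>"
  shows "(\<lambda>w. overshoot (stream_walk (g w) (h w)) n) \<in> borel_measurable N"
  by (rule measurable_overshoot) measurable

definition overshoot_law :: "nat \<Rightarrow> real \<Rightarrow> real measure" where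
  "overshoot_law n x = distr (stream_space \<mu>) borel (\<lambda>\<omega>. overshoot (stream_walk x \<omega>) n)"

lemma overshoot_law_kernel[measurable]: "overshoot_law n \<in> borel \<rightarrow>\<^sub>M prob_algebra borel"
proof -
  have "stream_space \<mu> \<in> space (prob_algebra (stream_space \<mu>))"
    using prob_space_stream_space by (simp add: space_prob_algebra)
  then show ?thesis unfolding overshoot_law_def by measurable
qed

lemma nn_integral_overshoot_law:
  assumes [measurable]: "f \<in> borel_measurable borel"
  shows "(\<integral>\<^sup>+z. f z \<partial>overshoot_law n x) = (\<integral>\<^sup>+\<omega>. f (overshoot (stream_walk x \<omega>) n) \<partial>stream_space \<mu>)"
  unfolding overshoot_law_def by (rule nn_integral_distr) measurable

lemma nn_integral_overshoot_law_measurable[measurable]: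
  assumes [measurable]: "f \<in> borel_measurable borel"
  shows "(\<lambda>x. \<integral>\<^sup>+z. f z \<partial>overshoot_law n x) \<in> borel_measurable borel"
  by (rule nn_integral_measurable_subprob_algebra2[where N=borel])
     (auto intro!: measurable_prob_algebraD)

lemma overshoot_law_0: "overshoot_law 0 x = return borel x"
proof -
  have "overshoot (stream_walk x \<omega>) 0 = x" for \<omega>
    by (simp add: overshoot_def zero_enat_def)
  then have "overshoot_law 0 x = distr (stream_space \<mu>) borel (\<lambda>_. x)"
    by (simp add: overshoot_law_def)
  also have "\<dots> = return borel x"
    by (rule prob_space.distr_const[OF prob_space_stream_space]) simp
  finally show ?thesis .
qed

text \<open>The stream is split into head and tail. After a crossing step \<open>n\<close> crossings
  remain, after any other step still \<open>Suc n\<close>.\<close>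

lemma overshoot_law_first_step:
  assumes [measurable]: "f \<in> borel_measurable borel"
  shows "(\<integral>\<^sup>+z. f z \<partial>overshoot_law (Suc n) x) =
    cross (\<lambda>x. \<integral>\<^sup>+z. f z \<partial>overshoot_law n x) x + stay (\<lambda>x. \<integral>\<^sup>+z. f z \<partial>overshoot_law (Suc n) x) x"
proof -
  have "(\<integral>\<^sup>+z. f z \<partial>overshoot_law (Suc n) x) =
      (\<integral>\<^sup>+y. (\<integral>\<^sup>+\<omega>. f (overshoot (stream_walk x (y ## \<omega>)) (Suc n)) \<partial>stream_space \<mu>) \<partial>\<mu>)"
    by (subst nn_integral_overshoot_law, measurable, rule nn_integral_stream_space) measurable
  also have "\<dots> = (\<integral>\<^sup>+y. (if x < 0 \<and> 0 \<le> x + y then (\<integral>\<^sup>+z. f z \<partial>overshoot_law n (x + y)) else 0) +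
      (if x < 0 \<and> 0 \<le> x + y then 0 else (\<integral>\<^sup>+z. f z \<partial>overshoot_law (Suc n) (x + y))) \<partial>\<mu>)"
    by (rule nn_integral_cong) (auto simp: nn_integral_overshoot_law overshoot_stream_walk_Stream)
  also have "\<dots> = cross (\<lambda>x. \<integral>\<^sup>+z. f z \<partial>overshoot_law n x) x + stay (\<lambda>x. \<integral>\<^sup>+z. f z \<partial>overshoot_law (Suc n) x) x"
    unfolding cross_def stay_def by (rule nn_integral_add) measurable
  finally show ?thesis .
qed

lemma nn_integral_overshoot_law_le:
  assumes "\<And>z. f z \<le> c" shows "(\<integral>\<^sup>+z. f z \<partial>overshoot_law n x) \<le> c"
proof -
  have "prob_space (overshoot_law n x)"
    using measurable_space[OF overshoot_law_kernel, of x] by (simp add: space_prob_algebra)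
  then interpret L: prob_space "overshoot_law n x" .
  have "(\<integral>\<^sup>+z. f z \<partial>overshoot_law n x) \<le> (\<integral>\<^sup>+z. c \<partial>overshoot_law n x)"
    by (rule nn_integral_mono) (rule assms)
  also have "\<dots> = c" by (simp add: L.emeasure_space_1)
  finally show ?thesis .
qed

lemma overshoot_law_Suc_series:
  assumes [measurable]: "f \<in> borel_measurable borel" and "\<And>z. f z \<le> 1"
  shows "(\<integral>\<^sup>+z. f z \<partial>overshoot_law (Suc n) x) =
    (\<Sum>k. (stay ^^ k) (cross (\<lambda>x. \<integral>\<^sup>+z. f z \<partial>overshoot_law n x)) x)"
  by (rule crossing_series) (measurable, rule nn_integral_overshoot_law_le, rule assms, rule overshoot_law_first_step, measurable)

text \<open>The strong Markov property at the first crossing, obtained without stopping times: both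
  sides satisfy a first-step equation with the same crossing reward \<open>g\<close>, hence are the
  same series.\<close>

lemma overshoot_law_Suc:
  assumes [measurable]: "f \<in> borel_measurable borel" and f: "\<And>z. f z \<le> 1"
  shows "(\<integral>\<^sup>+z. f z \<partial>overshoot_law (Suc n) x) = (\<integral>\<^sup>+y. (\<integral>\<^sup>+z. f z \<partial>overshoot_law n y) \<partial>overshoot_law 1 x)"
proof -
  define g where "g y = (\<integral>\<^sup>+z. f z \<partial>overshoot_law n y)" for y
  have g[measurable]: "g \<in> borel_measurable borel" unfolding g_def by measurable
  have "(\<integral>\<^sup>+z. g z \<partial>overshoot_law (Suc 0) x) = (\<Sum>k. (stay ^^ k) (cross (\<lambda>x. \<integral>\<^sup>+z. g z \<partial>overshoot_law 0 x)) x)"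
    by (rule overshoot_law_Suc_series[OF g]) (simp add: g_def nn_integral_overshoot_law_le f)
  also have "(\<lambda>x. \<integral>\<^sup>+z. g z \<partial>overshoot_law 0 x) = g"
    by (rule ext) (simp add: overshoot_law_0 nn_integral_return)
  finally show ?thesis using overshoot_law_Suc_series[OF assms] by (simp add: g_def)
qed

text \<open>Transfers the increments from an arbitrary probability space, where they are indexed
  from 1, to streams indexed from 0. There the decomposition into head and tail plays the role of
  the time shift.\<close>

lemma distr_increment_stream:
  fixes X :: "nat \<Rightarrow> 'a \<Rightarrow> real"
  assumes "prob_space M" and indep: "prob_space.indep_vars M (\<lambda>_. borel) X {1..}"
    and ident: "\<And>n. n \<ge> 1 \<Longrightarrow> distr M borel (X n) = \<mu>"
  shows "(\<lambda>\<omega>. to_stream (\<lambda>i. X (Suc i) \<omega>)) \<in> M \<rightarrow>\<^sub>M stream_space \<mu>"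
    and "distr M (stream_space \<mu>) (\<lambda>\<omega>. to_stream (\<lambda>i. X (Suc i) \<omega>)) = stream_space \<mu>"
proof -
  interpret M: prob_space M by fact
  have X: "X i \<in> borel_measurable M" if "1 \<le> i" for i
    using indep that by (auto simp: M.indep_vars_def)
  then have XS: "X (Suc i) \<in> M \<rightarrow>\<^sub>M \<mu>" for i by (simp cong: measurable_cong_sets add: sets_step)
  show meas: "(\<lambda>\<omega>. to_stream (\<lambda>i. X (Suc i) \<omega>)) \<in> M \<rightarrow>\<^sub>M stream_space \<mu>"
    by (rule measurable_stream_space2) (use XS in \<open>simp add: to_stream_def\<close>)
  let ?P1 = "\<Pi>\<^sub>M i\<in>{1::nat..}. \<mu>" and ?P = "\<Pi>\<^sub>M i\<in>(UNIV::nat set). \<mu>"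
  have X': "X i \<in> M \<rightarrow>\<^sub>M \<mu>" if "1 \<le> i" for i using X[OF that] by (simp cong: measurable_cong_sets add: sets_step)
  have sets1: "sets (\<Pi>\<^sub>M i\<in>{1::nat..}. borel) = sets ?P1"
    by (rule sets_PiM_cong) (auto simp: sets_step)
  have "distr M ?P1 (\<lambda>\<omega>. \<lambda>i\<in>{1..}. X i \<omega>) = distr M (\<Pi>\<^sub>M i\<in>{1..}. borel) (\<lambda>\<omega>. \<lambda>i\<in>{1..}. X i \<omega>)"
    by (rule distr_cong[OF refl sets1[symmetric]]) simp
  also have "\<dots> = (\<Pi>\<^sub>M i\<in>{1..}. distr M borel (X i))"
    using indep by (subst (asm) M.indep_vars_iff_distr_eq_PiM') (use X in auto)
  also have "\<dots> = ?P1" by (rule PiM_cong) (auto simp: ident)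
  finally have P1: "distr M ?P1 (\<lambda>\<omega>. \<lambda>i\<in>{1..}. X i \<omega>) = ?P1" .
  have m1: "(\<lambda>\<omega>. \<lambda>i\<in>{1..}. X i \<omega>) \<in> M \<rightarrow>\<^sub>M ?P1"
    by (rule measurable_restrict) (use X' in auto)
  have m2: "(\<lambda>\<omega>. \<lambda>n\<in>UNIV. \<omega> (Suc n)) \<in> ?P1 \<rightarrow>\<^sub>M ?P"
    by (rule measurable_restrict) (auto intro!: measurable_component_singleton)
  have "?P = distr ?P1 ?P (\<lambda>\<omega>. \<lambda>n\<in>UNIV. \<omega> (Suc n))"
    using distr_PiM_reindex[of "{1::nat..}" "\<lambda>_. \<mu>" Suc "UNIV :: nat set"] prob_space_axioms by auto
  also have "\<dots> = distr M ?P (\<lambda>\<omega> i. X (Suc i) \<omega>)"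
    by (subst P1[symmetric], subst distr_distr[OF m2 m1]) (simp add: comp_def restrict_UNIV)
  finally have P: "distr M ?P (\<lambda>\<omega> i. X (Suc i) \<omega>) = ?P" ..
  have m3: "(\<lambda>\<omega> i. X (Suc i) \<omega>) \<in> M \<rightarrow>\<^sub>M ?P"
    using measurable_restrict[of "UNIV :: nat set" "\<lambda>i. X (Suc i)" M "\<lambda>_. \<mu>"] XS by (simp add: restrict_UNIV)
  have st: "stream_space \<mu> = distr ?P (stream_space \<mu>) to_stream"
    unfolding stream_space_def by (rule distr_cong) auto
  have "distr M (stream_space \<mu>) (\<lambda>\<omega>. to_stream (\<lambda>i. X (Suc i) \<omega>)) =
      distr (distr M ?P (\<lambda>\<omega> i. X (Suc i) \<omega>)) (stream_space \<mu>) to_stream"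
    by (subst distr_distr[OF measurable_to_stream m3]) (simp add: comp_def)
  then show "distr M (stream_space \<mu>) (\<lambda>\<omega>. to_stream (\<lambda>i. X (Suc i) \<omega>)) = stream_space \<mu>"
    unfolding P st[symmetric] .
qed

lemma stream_walk_to_stream: "stream_walk x (to_stream (\<lambda>i. X (Suc i) \<omega>)) k = walk x X k \<omega>"
  by (simp add: stream_walk_def walk_def to_stream_def sum.atLeast1_atMost_eq)

definition walk_law :: "nat \<Rightarrow> real measure" where
  "walk_law n = distr (stream_space \<mu>) borel (\<lambda>\<omega>. stream_walk 0 \<omega> n)"

lemma distr_walk:
  fixes X :: "nat \<Rightarrow> 'a \<Rightarrow> real"
  assumes "prob_space M" "prob_space.indep_vars M (\<lambda>_. borel) X {1..}"
    "\<And>n. n \<ge> 1 \<Longrightarrow> distr M borel (X n) = \<mu>"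
  shows "distr M borel (\<lambda>\<omega>. overshoot (\<lambda>k. walk x X k \<omega>) n) = overshoot_law n x"
    and "distr M borel (walk 0 X n) = walk_law n"
proof -
  have S: "(\<lambda>\<omega>. to_stream (\<lambda>i. X (Suc i) \<omega>)) \<in> M \<rightarrow>\<^sub>M stream_space \<mu>"
    "distr M (stream_space \<mu>) (\<lambda>\<omega>. to_stream (\<lambda>i. X (Suc i) \<omega>)) = stream_space \<mu>"
    using distr_increment_stream[OF assms(1,2)] assms(3) by blast+
  have o: "(\<lambda>\<omega>. overshoot (stream_walk x \<omega>) n) \<in> borel_measurable (stream_space \<mu>)"
    and w: "(\<lambda>\<omega>. stream_walk 0 \<omega> n) \<in> borel_measurable (stream_space \<mu>)" by measurable
  have "overshoot_law n x = distr M borel ((\<lambda>\<omega>. overshoot (stream_walk x \<omega>) n) \<circ> (\<lambda>\<omega>. to_stream (\<lambda>i. X (Suc i) \<omega>)))"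
    using distr_distr[OF o S(1)] unfolding S(2) overshoot_law_def .
  moreover have "stream_walk x (to_stream (\<lambda>i. X (Suc i) \<omega>)) = (\<lambda>k. walk x X k \<omega>)" for \<omega>
    by (rule ext) (rule stream_walk_to_stream)
  ultimately show "distr M borel (\<lambda>\<omega>. overshoot (\<lambda>k. walk x X k \<omega>) n) = overshoot_law n x"
    by (simp add: comp_def)
  have "walk_law n = distr M borel ((\<lambda>\<omega>. stream_walk 0 \<omega> n) \<circ> (\<lambda>\<omega>. to_stream (\<lambda>i. X (Suc i) \<omega>)))"
    using distr_distr[OF w S(1)] unfolding S(2) walk_law_def .
  then show "distr M borel (walk 0 X n) = walk_law n"
    by (simp add: comp_def stream_walk_to_stream)
qed

lemma sets_walk_law[simp, measurable_cong]: "sets (walk_law n) = sets borel"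
  by (simp add: walk_law_def)

lemma prob_space_walk_law: "prob_space (walk_law n)"
  unfolding walk_law_def by (rule prob_space.prob_space_distr[OF prob_space_stream_space]) measurable

lemma step_iterate_eq:
  assumes [measurable]: "f \<in> borel_measurable borel"
  shows "(step ^^ n) f x = (\<integral>\<^sup>+y. f (x + y) \<partial>walk_law n)"
proof -
  have shift: "x + stream_walk 0 \<omega> n = stream_walk x \<omega> n" for x \<omega> n
    by (simp add: stream_walk_def)
  have "(step ^^ n) f x = (\<integral>\<^sup>+\<omega>. f (stream_walk x \<omega> n) \<partial>stream_space \<mu>)"
  proof (induction n arbitrary: x)
    case 0
    show ?case using prob_space.emeasure_space_1[OF prob_space_stream_space] by simp
  next
    case (Suc n)
    have "(step ^^ Suc n) f x = (\<integral>\<^sup>+y. (\<integral>\<^sup>+\<omega>. f (stream_walk (x + y) \<omega> n) \<partial>stream_space \<mu>) \<partial>\<mu>)"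
      by (simp add: step_def Suc)
    also have "\<dots> = (\<integral>\<^sup>+y. (\<integral>\<^sup>+\<omega>. f (stream_walk x (y ## \<omega>) (Suc n)) \<partial>stream_space \<mu>) \<partial>\<mu>)" by simp
    also have "\<dots> = (\<integral>\<^sup>+\<omega>. f (stream_walk x \<omega> (Suc n)) \<partial>stream_space \<mu>)"
      by (rule nn_integral_stream_space[symmetric]) measurable
    finally show ?case .
  qed
  also have "\<dots> = (\<integral>\<^sup>+y. f (x + y) \<partial>walk_law n)"
    unfolding walk_law_def by (subst nn_integral_distr) (auto simp: shift)
  finally show ?thesis .
qed

end

section \<open>The stationary law of the overshoots\<close>

text \<open>Treats \<open>lborel\<close> and the lattice measure together. The conditions are
  imposed for almost every step \<open>y\<close> because the lattice measure is invariant only under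
  lattice translations and gives \<open>{0..<y}\<close> the mass \<open>y\<close> only for lattice
  points \<open>y \<ge> 0\<close>. For negative \<open>y\<close>, \<open>ennreal y\<close> is
  zero.\<close>

locale reference_measure = centred_step \<mu> for \<mu> :: "real measure" +
  fixes \<Lambda> :: "real measure"
  assumes sets_ref[measurable_cong]: "sets \<Lambda> = sets borel"
    and sigma_finite_ref: "sigma_finite_measure \<Lambda>"
    and translation: "AE y in \<mu>. \<forall>f\<in>borel_measurable borel. (\<integral>\<^sup>+x. f (x + y) \<partial>\<Lambda>) = (\<integral>\<^sup>+x. f x \<partial>\<Lambda> :: ennreal)"
    and interval: "AE y in \<mu>. emeasure \<Lambda> {0..<y} = ennreal y"
begin

sublocale R: sigma_finite_measure \<Lambda> by (rule sigma_finite_ref)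

sublocale RS: pair_sigma_finite \<Lambda> \<mu> ..

lemma nn_integral_step_ref:
  assumes f[measurable]: "f \<in> borel_measurable borel"
  shows "(\<integral>\<^sup>+x. step f x \<partial>\<Lambda>) = (\<integral>\<^sup>+x. f x \<partial>\<Lambda>)"
proof -
  have "(\<integral>\<^sup>+x. step f x \<partial>\<Lambda>) = (\<integral>\<^sup>+y. (\<integral>\<^sup>+x. f (x + y) \<partial>\<Lambda>) \<partial>\<mu>)"
    unfolding step_def by (rule RS.Fubini'[symmetric]) measurable
  also have "\<dots> = (\<integral>\<^sup>+y. (\<integral>\<^sup>+x. f x \<partial>\<Lambda>) \<partial>\<mu>)"
    by (rule nn_integral_cong_AE) (use translation f in \<open>auto elim!: eventually_mono\<close>)
  also have "\<dots> = (\<integral>\<^sup>+x. f x \<partial>\<Lambda>)" using emeasure_space_1 by simp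
  finally show ?thesis .
qed

definition weight :: "real \<Rightarrow> ennreal" where
  "weight b = indicator {0..} b * emeasure \<mu> {b<..}"

lemma weight_measurable[measurable]: "weight \<in> borel_measurable borel"
proof -
  have "mono (\<lambda>b. - measure \<mu> {b<..})"
    by (auto simp: mono_def sets_step intro!: finite_measure_mono)
  then have "(\<lambda>b. - measure \<mu> {b<..}) \<in> borel_measurable borel" by (rule borel_measurable_mono)
  then have "(\<lambda>b. - (- measure \<mu> {b<..})) \<in> borel_measurable borel" by (rule borel_measurable_uminus)
  then have [measurable]: "(\<lambda>b. measure \<mu> {b<..}) \<in> borel_measurable borel" by simp
  show ?thesis unfolding weight_def emeasure_eq_measure by measurable
qed

text \<open>With the landing point \<open>b = x + y\<close> as variable, which translation
  invariance permits for almost each \<open>y\<close>, the condition \<open>x < 0\<close> becomes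
  \<open>y > b\<close> and integrates to \<open>weight b\<close>. This is the origin of the density
  of \<open>\<pi>\<^sub>+\<close>.\<close>

lemma nn_integral_cross_ref:
  assumes f[measurable]: "f \<in> borel_measurable borel"
  shows "(\<integral>\<^sup>+x. cross f x \<partial>\<Lambda>) = (\<integral>\<^sup>+b. weight b * f b \<partial>\<Lambda>)"
proof -
  have "(\<integral>\<^sup>+x. cross f x \<partial>\<Lambda>) =
      (\<integral>\<^sup>+y. (\<integral>\<^sup>+x. (if (x + y) - y < 0 \<and> 0 \<le> x + y then f (x + y) else 0) \<partial>\<Lambda>) \<partial>\<mu>)"
    unfolding cross_def by (subst RS.Fubini'[symmetric]) auto
  also have "\<dots> = (\<integral>\<^sup>+y. (\<integral>\<^sup>+b. (if b - y < 0 \<and> 0 \<le> b then f b else 0) \<partial>\<Lambda>) \<partial>\<mu>)"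
    using translation
  proof (intro nn_integral_cong_AE, eventually_elim)
    case (elim y)
    have "(\<lambda>b. if b - y < 0 \<and> 0 \<le> b then f b else 0) \<in> borel_measurable borel" by measurable
    from bspec[OF elim(2) this] show ?case .
  qed
  also have "\<dots> = (\<integral>\<^sup>+b. (\<integral>\<^sup>+y. (if b - y < 0 \<and> 0 \<le> b then f b else 0) \<partial>\<mu>) \<partial>\<Lambda>)"
    by (rule RS.Fubini') measurable
  also have "\<dots> = (\<integral>\<^sup>+b. weight b * f b \<partial>\<Lambda>)"
  proof (rule nn_integral_cong)
    fix b
    have "(\<integral>\<^sup>+y. (if b - y < 0 \<and> 0 \<le> b then f b else 0) \<partial>\<mu>) = (\<integral>\<^sup>+y. (indicator {0..} b * f b) * indicator {b<..} y \<partial>\<mu>)"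
      by (intro nn_integral_cong) (auto simp: indicator_def)
    also have "\<dots> = (indicator {0..} b * f b) * emeasure \<mu> {b<..}"
      by (rule nn_integral_cmult_indicator) (simp add: sets_step)
    finally show "(\<integral>\<^sup>+y. (if b - y < 0 \<and> 0 \<le> b then f b else 0) \<partial>\<mu>) = weight b * f b"
      by (simp add: weight_def mult_ac)
  qed
  finally show ?thesis .
qed

text \<open>Peeling off the first step, the claim for \<open>f\<close> follows from the claim for \<open>stay f\<close>, because
  \<open>cross f + stay f = step f\<close> has the same integral as \<open>f\<close>.\<close>

lemma sum_crossings_le:
  assumes "f \<in> borel_measurable borel"
  shows "(\<Sum>k<n. \<integral>\<^sup>+b. weight b * (stay ^^ k) f b \<partial>\<Lambda>) \<le> (\<integral>\<^sup>+x. f x \<partial>\<Lambda>)"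
  using assms
proof (induction n arbitrary: f)
  case (Suc n)
  note [measurable] = Suc.prems
  have "(\<Sum>k<Suc n. \<integral>\<^sup>+b. weight b * (stay ^^ k) f b \<partial>\<Lambda>) =
      (\<integral>\<^sup>+b. weight b * f b \<partial>\<Lambda>) + (\<Sum>k<n. \<integral>\<^sup>+b. weight b * (stay ^^ k) (stay f) b \<partial>\<Lambda>)"
    by (simp add: sum.lessThan_Suc_shift funpow_swap1 del: sum.lessThan_Suc)
  also have "\<dots> \<le> (\<integral>\<^sup>+x. cross f x \<partial>\<Lambda>) + (\<integral>\<^sup>+x. stay f x \<partial>\<Lambda>)"
    unfolding nn_integral_cross_ref[OF Suc.prems] by (intro add_left_mono Suc.IH) measurable
  also have "\<dots> = (\<integral>\<^sup>+x. step f x \<partial>\<Lambda>)"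
    by (subst nn_integral_add[symmetric]) (auto simp: cross_plus_stay)
  also have "\<dots> = (\<integral>\<^sup>+x. f x \<partial>\<Lambda>)" by (rule nn_integral_step_ref) measurable
  finally show ?case .
qed simp

text \<open>This is \<open>sum_crossings_le\<close> for \<open>cross f\<close>: the expectation of
  \<open>f\<close> at the next overshoot is the series of \<open>(stay ^^ k) (cross f)\<close>, and
  the reference integral of \<open>cross f\<close> is the weighted integral of
  \<open>f\<close>.\<close>

lemma overshoot_excessive:
  assumes f[measurable]: "f \<in> borel_measurable borel" and f1: "\<And>x. f x \<le> 1"
  shows "(\<integral>\<^sup>+b. weight b * (\<integral>\<^sup>+z. f z \<partial>overshoot_law 1 b) \<partial>\<Lambda>) \<le> (\<integral>\<^sup>+b. weight b * f b \<partial>\<Lambda>)"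
proof -
  have "(\<integral>\<^sup>+z. f z \<partial>overshoot_law 1 b) = (\<Sum>k. (stay ^^ k) (cross f) b)" for b
    using overshoot_law_Suc_series[OF f f1, of 0 b]
    by (simp add: overshoot_law_0 nn_integral_return)
  then have "(\<integral>\<^sup>+b. weight b * (\<integral>\<^sup>+z. f z \<partial>overshoot_law 1 b) \<partial>\<Lambda>) =
      (\<integral>\<^sup>+b. (\<Sum>k. weight b * (stay ^^ k) (cross f) b) \<partial>\<Lambda>)"
    by simp
  also have "\<dots> = (\<Sum>k. \<integral>\<^sup>+b. weight b * (stay ^^ k) (cross f) b \<partial>\<Lambda>)"
    by (rule nn_integral_suminf) measurable
  also have "\<dots> \<le> (\<integral>\<^sup>+x. cross f x \<partial>\<Lambda>)"
    by (rule suminf_le_const) (auto intro!: sum_crossings_le)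
  finally show ?thesis by (simp add: nn_integral_cross_ref)
qed

definition stationary :: "real measure" where
  "stationary = density \<Lambda> (\<lambda>b. ennreal (2 / (\<integral>y. \<bar>y\<bar> \<partial>\<mu>) * indicator {0..} b * measure \<mu> {b<..}))"

lemma stationary_eq: "stationary = density \<Lambda> (\<lambda>b. ennreal (2 / (\<integral>y. \<bar>y\<bar> \<partial>\<mu>)) * weight b)"
  unfolding stationary_def weight_def emeasure_eq_measure
  by (intro arg_cong[where f="density \<Lambda>"] ext)
     (use nondegenerate in \<open>auto simp: indicator_def simp flip: ennreal_mult'\<close>)

lemma sets_stationary[simp, measurable_cong]: "sets stationary = sets borel"
  by (simp add: stationary_def sets_ref)

lemma nn_integral_stationary:
  assumes [measurable]: "f \<in> borel_measurable borel"
  shows "(\<integral>\<^sup>+b. f b \<partial>stationary) = ennreal (2 / (\<integral>y. \<bar>y\<bar> \<partial>\<mu>)) * (\<integral>\<^sup>+b. weight b * f b \<partial>\<Lambda>)"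
  unfolding stationary_eq
  by (subst nn_integral_density) (auto simp: mult.assoc nn_integral_cmult)

text \<open>The tail integral is the mean of the positive part
  \<open>(y + \<bar>y\<bar>) / 2\<close>; since the step is centred, it equals half of
  \<open>E |X|\<close>. Hence the factor 2 in the density.\<close>

lemma total_weight: "(\<integral>\<^sup>+b. weight b \<partial>\<Lambda>) = ennreal ((\<integral>y. \<bar>y\<bar> \<partial>\<mu>) / 2)"
proof -
  have "(\<integral>\<^sup>+b. weight b \<partial>\<Lambda>) = (\<integral>\<^sup>+b. (\<integral>\<^sup>+y. indicator {0..} b * indicator {b<..} y \<partial>\<mu>) \<partial>\<Lambda>)"
    unfolding weight_def by (intro nn_integral_cong) (simp add: nn_integral_cmult_indicator sets_step)
  also have "\<dots> = (\<integral>\<^sup>+b. (\<integral>\<^sup>+y. (if 0 \<le> b \<and> b < y then 1 else 0) \<partial>\<mu>) \<partial>\<Lambda>)"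
    by (intro nn_integral_cong) (auto simp: indicator_def)
  also have "\<dots> = (\<integral>\<^sup>+y. (\<integral>\<^sup>+b. (if 0 \<le> b \<and> b < y then 1 else 0) \<partial>\<Lambda>) \<partial>\<mu>)"
    by (rule RS.Fubini'[symmetric]) measurable
  also have "\<dots> = (\<integral>\<^sup>+y. emeasure \<Lambda> {0..<y} \<partial>\<mu>)"
  proof (rule nn_integral_cong)
    fix y :: real
    have "(\<integral>\<^sup>+b. (if 0 \<le> b \<and> b < y then 1 else 0) \<partial>\<Lambda>) = (\<integral>\<^sup>+b. indicator {0..<y} b \<partial>\<Lambda>)"
      by (intro nn_integral_cong) (auto simp: indicator_def)
    then show "(\<integral>\<^sup>+b. (if 0 \<le> b \<and> b < y then 1 else 0) \<partial>\<Lambda>) = emeasure \<Lambda> {0..<y}"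
      by (simp add: sets_ref)
  qed
  also have "\<dots> = (\<integral>\<^sup>+y. ennreal ((y + \<bar>y\<bar>) / 2) \<partial>\<mu>)"
    by (rule nn_integral_cong_AE) (use interval in \<open>auto elim!: eventually_mono simp: abs_if ennreal_neg\<close>)
  also have "\<dots> = ennreal (\<integral>y. (y + \<bar>y\<bar>) / 2 \<partial>\<mu>)"
    by (rule nn_integral_eq_integral) (use integrable_step integrable_abs[OF integrable_step] in auto)
  also have "(\<integral>y. (y + \<bar>y\<bar>) / 2 \<partial>\<mu>) = (\<integral>y. \<bar>y\<bar> \<partial>\<mu>) / 2"
    using centred integrable_step integrable_abs[OF integrable_step] by simp
  finally show ?thesis .
qed

lemma prob_space_stationary: "prob_space stationary"
proof
  have "emeasure stationary (space stationary) = (\<integral>\<^sup>+b. 1 \<partial>stationary)" by simp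
  also have "\<dots> = ennreal (2 / (\<integral>y. \<bar>y\<bar> \<partial>\<mu>)) * ennreal ((\<integral>y. \<bar>y\<bar> \<partial>\<mu>) / 2)"
    by (subst nn_integral_stationary) (simp_all add: total_weight)
  also have "\<dots> = 1" using nondegenerate by (simp flip: ennreal_mult')
  finally show "emeasure stationary (space stationary) = 1" .
qed

lemma stationary_in: "stationary \<in> space (prob_algebra borel)"
  by (simp add: space_prob_algebra prob_space_stationary)

lemma stationary_invariant:
  assumes f: "f \<in> borel_measurable borel"
  shows "(\<integral>\<^sup>+x. (\<integral>\<^sup>+z. f z \<partial>overshoot_law 1 x) \<partial>stationary) = (\<integral>\<^sup>+x. f x \<partial>stationary)"
proof -
  define b where "b = stationary \<bind> overshoot_law 1"
  have k: "overshoot_law 1 \<in> stationary \<rightarrow>\<^sub>M subprob_algebra borel"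
    using measurable_prob_algebraD[OF overshoot_law_kernel[of 1]] by (simp cong: measurable_cong_sets)
  interpret S: prob_space stationary by (rule prob_space_stationary)
  interpret B: prob_space b unfolding b_def by (rule prob_space_bind'[OF stationary_in overshoot_law_kernel])
  have sb[simp]: "sets b = sets borel" unfolding b_def by (rule sets_bind'[OF stationary_in overshoot_law_kernel])
  have sp: "space b = UNIV" "space stationary = UNIV"
    using sets_eq_imp_space_eq[OF sb] sets_eq_imp_space_eq[OF sets_stationary] by auto
  have le: "emeasure b A \<le> emeasure stationary A" if A[measurable]: "A \<in> sets borel" for A
  proof -
    have A': "A \<in> sets b" unfolding sb by (rule A)
    have "emeasure b A = (\<integral>\<^sup>+x. (\<integral>\<^sup>+z. indicator A z \<partial>overshoot_law 1 x) \<partial>stationary)"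
      using nn_integral_bind[OF _ k, of "indicator A"] nn_integral_indicator[OF A']
      by (simp add: b_def del: nn_integral_indicator nn_integral_indicator')
    also have "\<dots> = ennreal (2 / (\<integral>y. \<bar>y\<bar> \<partial>\<mu>)) *
        (\<integral>\<^sup>+b. weight b * (\<integral>\<^sup>+z. indicator A z \<partial>overshoot_law 1 b) \<partial>\<Lambda>)"
      by (rule nn_integral_stationary) measurable
    also have "\<dots> \<le> ennreal (2 / (\<integral>y. \<bar>y\<bar> \<partial>\<mu>)) * (\<integral>\<^sup>+b. weight b * indicator A b \<partial>\<Lambda>)"
      by (intro mult_left_mono overshoot_excessive) (auto simp: indicator_def[abs_def])
    also have "\<dots> = (\<integral>\<^sup>+x. indicator A x \<partial>stationary)"
      by (rule nn_integral_stationary[symmetric]) measurable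
    finally show ?thesis by simp
  qed
  \<comment> \<open>The inequality holds for a set and for its complement, and both measures have
    mass one, so neither inequality can be strict.\<close>
  have "b = stationary"
  proof (rule measure_eqI)
    fix A assume "A \<in> sets b"
    then have A: "A \<in> sets borel" unfolding sb .
    then have "measure b A \<le> measure stationary A" "measure b (UNIV - A) \<le> measure stationary (UNIV - A)"
      using le[of A] le[of "UNIV - A"] by (auto simp: B.emeasure_eq_measure S.emeasure_eq_measure)
    moreover have "measure b (UNIV - A) = 1 - measure b A" "measure stationary (UNIV - A) = 1 - measure stationary A"
      using B.prob_compl[of A] S.prob_compl[of A] A sp by auto
    ultimately show "emeasure b A = emeasure stationary A"
      by (simp add: B.emeasure_eq_measure S.emeasure_eq_measure)
  qed (simp only: sb sets_stationary)
  then show ?thesis using nn_integral_bind[OF f k] by (simp add: b_def)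
qed

end

section \<open>Minorization of the overshoot kernel\<close>

context centred_step
begin

text \<open>Reordering the increments of a path so that the nonnegative ones come first removes all
  upcrossings. On the level of operators this is the decomposition \<open>step = up + down\<close> into commuting
  parts: a function that is not increased by \<open>down\<close>, nor by \<open>up\<close> on \<open>[0,\<infinity>)\<close>, is increased by
  \<open>step ^^ n\<close> on \<open>[0,\<infinity>)\<close> at most by the number \<open>2 ^ n\<close> of sign patterns.\<close>

lemma step_iterate_le:
  assumes q[measurable]: "q \<in> borel_measurable borel"
    and down: "\<And>x. (\<integral>\<^sup>+y. indicator {..<0} y * q (x + y) \<partial>\<mu>) \<le> q x"
    and up: "\<And>x. 0 \<le> x \<Longrightarrow> (\<integral>\<^sup>+y. indicator {0..} y * q (x + y) \<partial>\<mu>) \<le> q x"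
    and x: "0 \<le> x"
  shows "(step ^^ n) q x \<le> 2 ^ n * q x"
  using x
proof (induction n arbitrary: x)
  case (Suc n)
  interpret W: prob_space "walk_law n" by (rule prob_space_walk_law)
  interpret P: pair_sigma_finite \<mu> "walk_law n" ..
  have "(step ^^ Suc n) q x = (\<integral>\<^sup>+w. step q (x + w) \<partial>walk_law n)"
    by (simp add: funpow_swap1 step_iterate_eq)
  also have "\<dots> = (\<integral>\<^sup>+w. (\<integral>\<^sup>+y. indicator {0..} y * q (x + w + y) \<partial>\<mu>) +
      (\<integral>\<^sup>+y. indicator {..<0} y * q (x + w + y) \<partial>\<mu>) \<partial>walk_law n)"
    unfolding step_def
    by (intro nn_integral_cong, subst nn_integral_add[symmetric])
       (auto intro!: nn_integral_cong simp: indicator_def)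
  also have "\<dots> \<le> (\<integral>\<^sup>+w. (\<integral>\<^sup>+y. indicator {0..} y * q (x + w + y) \<partial>\<mu>) + q (x + w) \<partial>walk_law n)"
    by (intro nn_integral_mono add_left_mono down)
  also have "\<dots> = (\<integral>\<^sup>+w. (\<integral>\<^sup>+y. indicator {0..} y * q (x + w + y) \<partial>\<mu>) \<partial>walk_law n) + (step ^^ n) q x"
    unfolding step_iterate_eq[OF q] by (rule nn_integral_add) measurable
  \<comment> \<open>The last step, if nonnegative, is moved to the front. It leads from
    \<open>x\<close> to the nonnegative point \<open>x + y\<close>, where the induction hypothesis
    applies before \<open>up\<close> is used.\<close>
  also have "(\<integral>\<^sup>+w. (\<integral>\<^sup>+y. indicator {0..} y * q (x + w + y) \<partial>\<mu>) \<partial>walk_law n) =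
      (\<integral>\<^sup>+y. (\<integral>\<^sup>+w. indicator {0..} y * q (x + w + y) \<partial>walk_law n) \<partial>\<mu>)"
    by (rule P.Fubini') measurable
  also have "\<dots> = (\<integral>\<^sup>+y. indicator {0..} y * (step ^^ n) q (x + y) \<partial>\<mu>)"
    unfolding step_iterate_eq[OF q]
    by (intro nn_integral_cong, subst nn_integral_cmult[symmetric]) (auto simp: add_ac)
  also have "\<dots> \<le> (\<integral>\<^sup>+y. 2 ^ n * (indicator {0..} y * q (x + y)) \<partial>\<mu>)"
    using Suc by (intro nn_integral_mono) (auto simp: indicator_def)
  also have "\<dots> = 2 ^ n * (\<integral>\<^sup>+y. indicator {0..} y * q (x + y) \<partial>\<mu>)"
    by (rule nn_integral_cmult) measurable
  also have "\<dots> \<le> 2 ^ n * q x" by (intro mult_left_mono up Suc.prems) simp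
  finally have "(step ^^ Suc n) q x \<le> 2 ^ n * q x + 2 ^ n * q x"
    using Suc.IH[OF Suc.prems] by (meson add_mono order_refl order_trans)
  then show ?case by (simp add: mult_2 distrib_right)
qed simp

text \<open>The function \<open>q\<close> meets both conditions of \<open>step_iterate_le\<close>:
  from a nonnegative point no step is an up-crossing, so \<open>q = step q\<close> there; and a
  negative step is never an up-crossing, so it is counted in \<open>stay q\<close>, which is at most
  \<open>q\<close>.\<close>

lemma step_iterate_overshoot_le:
  assumes f[measurable]: "f \<in> borel_measurable borel" and x: "0 \<le> x"
  shows "(step ^^ n) (\<lambda>x. \<integral>\<^sup>+z. f z \<partial>overshoot_law 1 x) x \<le> 2 ^ n * (\<integral>\<^sup>+z. f z \<partial>overshoot_law 1 x)"
proof -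
  define q where "q x = (\<integral>\<^sup>+z. f z \<partial>overshoot_law 1 x)" for x
  have q[measurable]: "q \<in> borel_measurable borel" unfolding q_def by measurable
  have fs: "q x = cross f x + stay q x" for x
    using overshoot_law_first_step[OF f, of 0 x]
    by (simp add: q_def[abs_def] overshoot_law_0 nn_integral_return)
  have pos: "q x = step q x" if "0 \<le> x" for x
    using fs[of x] that by (simp add: cross_nonneg stay_nonneg)
  have "(step ^^ n) q x \<le> 2 ^ n * q x"
  proof (rule step_iterate_le[OF q _ _ x])
    show "(\<integral>\<^sup>+y. indicator {0..} y * q (x + y) \<partial>\<mu>) \<le> q x" if "0 \<le> x" for x
      unfolding pos[OF that] step_def by (rule nn_integral_mono) (simp add: indicator_def)
    show "(\<integral>\<^sup>+y. indicator {..<0} y * q (x + y) \<partial>\<mu>) \<le> q x" for x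
    proof -
      have "(\<integral>\<^sup>+y. indicator {..<0} y * q (x + y) \<partial>\<mu>) \<le> stay q x"
        unfolding stay_def by (rule nn_integral_mono) (simp add: indicator_def)
      also have "\<dots> \<le> q x" using fs[of x] by (simp add: le_iff_add)
      finally show ?thesis .
    qed
  qed
  then show ?thesis by (simp add: q_def[abs_def])
qed

text \<open>The walk enters \<open>W\<close> after \<open>n\<close> steps, \<open>m\<close> further
  steps spread the mass over \<rho>, and one transition of the overshoot chain follows;
  \<open>(1/2) ^ (n + m)\<close> is the price of the reordering.\<close>

lemma overshoot_minorized:
  assumes f[measurable]: "f \<in> borel_measurable borel" and W[measurable]: "W \<in> sets borel" and x: "0 \<le> x"
    and smooth: "\<And>f y. f \<in> borel_measurable borel \<Longrightarrow> y \<in> W \<Longrightarrow> c * (\<integral>\<^sup>+z. f z \<partial>\<rho>) \<le> (step ^^ m) f y"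
  shows "ennreal ((1/2) ^ (n + m)) * (emeasure (walk_law n) {y. x + y \<in> W} * c) *
      (\<integral>\<^sup>+w. (\<integral>\<^sup>+z. f z \<partial>overshoot_law 1 w) \<partial>\<rho>) \<le> (\<integral>\<^sup>+z. f z \<partial>overshoot_law 1 x)"
proof -
  define q where "q x = (\<integral>\<^sup>+z. f z \<partial>overshoot_law 1 x)" for x
  have q[measurable]: "q \<in> borel_measurable borel" unfolding q_def by measurable
  have "emeasure (walk_law n) {y. x + y \<in> W} * (c * (\<integral>\<^sup>+w. q w \<partial>\<rho>)) =
      (\<integral>\<^sup>+y. (c * (\<integral>\<^sup>+w. q w \<partial>\<rho>)) * indicator {y. x + y \<in> W} y \<partial>walk_law n)"
    by (subst nn_integral_cmult_indicator) (auto simp: mult_ac)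
  also have "\<dots> \<le> (\<integral>\<^sup>+y. (step ^^ m) q (x + y) \<partial>walk_law n)"
    by (rule nn_integral_mono) (use smooth[OF q] in \<open>auto simp: indicator_def\<close>)
  also have "\<dots> = (step ^^ (n + m)) q x"
    by (simp add: funpow_add step_iterate_eq)
  also have "\<dots> \<le> 2 ^ (n + m) * q x"
    unfolding q_def by (rule step_iterate_overshoot_le[OF f x])
  finally have "ennreal ((1/2) ^ (n + m)) * (emeasure (walk_law n) {y. x + y \<in> W} * (c * (\<integral>\<^sup>+w. q w \<partial>\<rho>))) \<le>
      ennreal ((1/2) ^ (n + m)) * (2 ^ (n + m) * q x)"
    by (rule mult_left_mono) simp
  also have "ennreal ((1/2) ^ (n + m)) * (2 ^ (n + m) * q x) = q x"
  proof -
    have "ennreal ((1/2) ^ (n + m)) * 2 ^ (n + m) = ennreal ((1/2) ^ (n + m)) * ennreal (2 ^ (n + m))"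
      by (simp flip: ennreal_power)
    also have "\<dots> = 1" by (simp flip: ennreal_mult' power_mult_distrib)
    finally show ?thesis by (simp flip: mult.assoc)
  qed
  finally show ?thesis by (simp add: q_def mult_ac)
qed

end

context reference_measure
begin

text \<open>The common frame of both cases: \<open>smooth\<close> and \<open>reach\<close> yield the
  minorization, while \<open>unique\<close> carries the vanishing of the limiting gap from almost
  every point to the given \<open>x0\<close>.\<close>

lemma overshoot_convergence:
  assumes \<rho>: "\<rho> \<in> space (prob_algebra borel)" and W[measurable]: "W \<in> sets borel" and c: "c \<noteq> 0"
    and smooth: "\<And>f y. f \<in> borel_measurable borel \<Longrightarrow> y \<in> W \<Longrightarrow> c * (\<integral>\<^sup>+z. f z \<partial>\<rho>) \<le> (step ^^ m) f y"
    and reach: "AE x in stationary. \<exists>n. emeasure (walk_law n) {y. x + y \<in> W} \<noteq> 0"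
    and unique: "\<And>G. G \<in> borel_measurable borel \<Longrightarrow> (\<And>x. G x \<le> 1) \<Longrightarrow> (\<And>x. step G x = G x) \<Longrightarrow>
      (AE x in stationary. G x = 0) \<Longrightarrow> G x0 = 0"
  shows "(\<lambda>n. tv_dist (overshoot_law n x0) stationary) \<longlonglongrightarrow> 0"
proof -
  define \<nu> where "\<nu> = \<rho> \<bind> overshoot_law 1"
  note \<rho>D = prob_algebraD[OF \<rho>]
  have kernel\<rho>: "overshoot_law 1 \<in> \<rho> \<rightarrow>\<^sub>M subprob_algebra borel"
    using measurable_prob_algebraD[OF overshoot_law_kernel[of 1]] \<rho>D(2) by (simp cong: measurable_cong_sets)
  have \<nu>: "\<nu> \<in> space (prob_algebra borel)"
    unfolding \<nu>_def space_prob_algebra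
    using prob_space_bind'[OF \<rho> overshoot_law_kernel] sets_bind'[OF \<rho> overshoot_law_kernel] by blast
  have nn\<nu>: "(\<integral>\<^sup>+z. f z \<partial>\<nu>) = (\<integral>\<^sup>+w. (\<integral>\<^sup>+z. f z \<partial>overshoot_law 1 w) \<partial>\<rho>)" if "f \<in> borel_measurable borel" for f
    unfolding \<nu>_def by (rule nn_integral_bind[OF that kernel\<rho>])
  have law_in: "overshoot_law n x \<in> space (prob_algebra borel)" for n x
    using measurable_space[OF overshoot_law_kernel, of x n] by simp
  define t where "t n x = ennreal ((1/2) ^ (n + m)) * (emeasure (walk_law n) {y. x + y \<in> W} * c)" for n x
  \<comment> \<open>No single \<open>n\<close> serves all starting points, so the bounds for all
    \<open>n\<close> are mixed with weights of total mass 1; one nonzero term makes \<beta>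
    positive. The indicator reflects that the reordering starts from a nonnegative point.\<close>
  define \<beta> where "\<beta> x = indicator {0..} x * (\<Sum>n. ennreal ((1/2) ^ Suc n) * t n x)" for x :: real
  have [measurable]: "t n \<in> borel_measurable borel" for n
  proof -
    interpret Wn: prob_space "walk_law n" by (rule prob_space_walk_law)
    have "(\<lambda>x. \<integral>\<^sup>+y. indicator W (x + y) \<partial>walk_law n) \<in> borel_measurable borel" by measurable
    also have "(\<lambda>x. \<integral>\<^sup>+y. indicator W (x + y) \<partial>walk_law n) = (\<lambda>x. emeasure (walk_law n) {y. x + y \<in> W})"
    proof (rule ext)
      fix x
      have "(\<integral>\<^sup>+y. indicator W (x + y) \<partial>walk_law n) = (\<integral>\<^sup>+y. indicator {y. x + y \<in> W} y \<partial>walk_law n)"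
        by (rule nn_integral_cong) (simp add: indicator_def)
      then show "(\<integral>\<^sup>+y. indicator W (x + y) \<partial>walk_law n) = emeasure (walk_law n) {y. x + y \<in> W}"
        by simp
    qed
    finally show ?thesis unfolding t_def[abs_def] by measurable
  qed
  have \<beta>m[measurable]: "\<beta> \<in> borel_measurable borel" unfolding \<beta>_def by measurable
  have half: "(\<Sum>n. ennreal ((1/2) ^ Suc n)) = 1"
    by (subst suminf_ennreal_eq[OF _ power_half_series]) simp_all
  have minor: "\<beta> x * (\<integral>\<^sup>+z. f z \<partial>\<nu>) \<le> (\<integral>\<^sup>+z. f z \<partial>overshoot_law 1 x)"
    if f: "f \<in> borel_measurable borel" for f x
  proof (cases "0 \<le> x")
    case True
    have "\<beta> x * (\<integral>\<^sup>+z. f z \<partial>\<nu>) = (\<Sum>n. ennreal ((1/2) ^ Suc n) * (t n x * (\<integral>\<^sup>+z. f z \<partial>\<nu>)))"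
      using True
      by (simp add: \<beta>_def mult.assoc ennreal_suminf_multc[symmetric] del: power_Suc ennreal_suminf_multc)
    also have "\<dots> \<le> (\<Sum>n. ennreal ((1/2) ^ Suc n) * (\<integral>\<^sup>+z. f z \<partial>overshoot_law 1 x))"
      unfolding t_def nn\<nu>[OF f]
      by (intro suminf_le mult_left_mono overshoot_minorized[OF f W True smooth]) auto
    also have "\<dots> = (\<integral>\<^sup>+z. f z \<partial>overshoot_law 1 x)"
      by (simp only: ennreal_suminf_multc half mult_1_left)
    finally show ?thesis .
  qed (simp add: \<beta>_def)
  have \<beta>1: "\<beta> x \<le> 1" for x
    using minor[of "\<lambda>_. 1" x] prob_algebraD(3)[OF \<nu>] prob_algebraD(3)[OF law_in[of 1 x]]
      prob_space.emeasure_space_1[OF prob_algebraD(1)[OF \<nu>]]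
      prob_space.emeasure_space_1[OF prob_algebraD(1)[OF law_in[of 1 x]]]
    by simp
  define \<alpha> where "\<alpha> x = enn2real (\<beta> x)" for x
  have \<alpha>\<beta>: "ennreal (\<alpha> x) = \<beta> x" for x
    unfolding \<alpha>_def by (rule ennreal_enn2real) (rule le_less_trans[OF \<beta>1 ennreal_one_less_top])
  have pos: "AE x in stationary. 0 < \<alpha> x"
  proof -
    have "AE x in stationary. 0 \<le> x"
      unfolding stationary_eq
      by (subst AE_density, measurable, rule AE_I2) (auto simp: weight_def indicator_def split: if_splits)
    with reach show ?thesis
    proof eventually_elim
      case (elim x)
      then obtain n where "emeasure (walk_law n) {y. x + y \<in> W} \<noteq> 0" by auto
      then have n: "ennreal ((1/2) ^ Suc n) * t n x \<noteq> 0" using c by (simp add: t_def)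
      have "\<beta> x \<noteq> 0"
      proof
        assume "\<beta> x = 0"
        then have "(\<Sum>n. ennreal ((1/2) ^ Suc n) * t n x) = 0" using elim by (simp add: \<beta>_def)
        then show False using n by (simp add: suminf_eq_zero_iff)
      qed
      then show ?case using \<alpha>\<beta>[of x] by (metis enn2real_nonneg \<alpha>_def ennreal_0 less_eq_real_def)
    qed
  qed
  interpret MC: minorized_chain borel "overshoot_law 1" stationary \<nu> \<alpha>
  proof
    show "overshoot_law 1 \<in> borel \<rightarrow>\<^sub>M prob_algebra borel" by (rule overshoot_law_kernel)
    show "stationary \<in> space (prob_algebra borel)" by (rule stationary_in)
    show "\<nu> \<in> space (prob_algebra borel)" by (rule \<nu>)
    show "\<alpha> \<in> borel_measurable borel" unfolding \<alpha>_def by measurable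
    show "AE x in stationary. 0 < \<alpha> x" by (rule pos)
    show "0 \<le> \<alpha> x" for x by (simp add: \<alpha>_def)
    show "(\<integral>\<^sup>+x. (\<integral>\<^sup>+y. f y \<partial>overshoot_law 1 x) \<partial>stationary) = (\<integral>\<^sup>+x. f x \<partial>stationary)"
      if "f \<in> borel_measurable borel" for f using that by (rule stationary_invariant)
    show "ennreal (\<alpha> x) * (\<integral>\<^sup>+y. f y \<partial>\<nu>) \<le> (\<integral>\<^sup>+y. f y \<partial>overshoot_law 1 x)"
      if "f \<in> borel_measurable borel" for f x unfolding \<alpha>\<beta> using that by (rule minor)
  qed
  have gap_zero: "MC.gap_limit x0 = 0"
  proof -
    let ?G = "\<lambda>x. ennreal (MC.gap_limit x)"
    have G[measurable]: "?G \<in> borel_measurable borel" by measurable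
    have "?G x0 = 0"
    proof (rule unique[OF G])
      show "?G x \<le> 1" for x using MC.gap_limit_bounds[of x] by simp
      show "AE x in stationary. ?G x = 0" using MC.gap_limit_AE_zero by eventually_elim simp
      have "(\<integral>\<^sup>+z. ?G z \<partial>overshoot_law 1 x) = ?G x" for x
        using nn_integral_eq_integral_prob[OF law_in MC.gap_limit_measurable MC.gap_limit_bounds, of 1 x]
          MC.gap_limit_harmonic[of x] by simp
      \<comment> \<open>As \<open>?G\<close> is invariant under the overshoot kernel, it may be put
        on both sides of the first-step equation, and \<open>cross\<close> and \<open>stay\<close>
        add up to \<open>step\<close>.\<close>
      then show "step ?G x = ?G x" for x
        using overshoot_law_first_step[OF G, of 0 x] cross_plus_stay[OF G, of x]
        by (simp add: overshoot_law_0 nn_integral_return One_nat_def[symmetric] del: One_nat_def)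
    qed
    then show ?thesis using MC.gap_limit_bounds(1)[of x0] by simp
  qed
  have bound: "\<bar>measure (overshoot_law n x0) B - measure stationary B\<bar> \<le> MC.gap n x0"
    if B[measurable]: "B \<in> sets borel" for n B
  proof -
    define p where "p n x = measure (overshoot_law n x) B" for n x
    have em: "ennreal (p n x) = (\<integral>\<^sup>+z. indicator B z \<partial>overshoot_law n x)" for n x
    proof -
      interpret L: prob_space "overshoot_law n x" by (rule prob_algebraD(1)[OF law_in])
      show ?thesis using prob_algebraD(2)[OF law_in, of n x] by (simp add: p_def L.emeasure_eq_measure)
    qed
    have pm: "p n \<in> borel_measurable borel" for n
      unfolding p_def[abs_def]
      by (rule measurable_compose[OF overshoot_law_kernel measurable_measure_prob_algebra]) simp
    have p01: "0 \<le> p n x" "p n x \<le> 1" for n x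
      using prob_space.prob_le_1[OF prob_algebraD(1)[OF law_in]] by (auto simp: p_def)
    have pS: "p (Suc n) x = (\<integral>y. p n y \<partial>overshoot_law 1 x)" for n x
    proof -
      have "ennreal (p (Suc n) x) = (\<integral>\<^sup>+y. ennreal (p n y) \<partial>overshoot_law 1 x)"
        unfolding em by (rule overshoot_law_Suc) (auto simp: indicator_def)
      also have "\<dots> = ennreal (\<integral>y. p n y \<partial>overshoot_law 1 x)"
        by (rule nn_integral_eq_integral_prob[OF law_in pm p01])
      finally show ?thesis using p01 by (subst (asm) ennreal_inj) (auto intro!: integral_nonneg_AE)
    qed
    have "(\<integral>y. p 0 y \<partial>stationary) = (\<integral>y. indicator B y \<partial>stationary)"
      by (rule Bochner_Integration.integral_cong)
         (auto simp: p_def overshoot_law_0 measure_return)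
    also have "\<dots> = measure stationary B"
      using sets_eq_imp_space_eq[OF sets_stationary] by simp
    finally show ?thesis
      using MC.difference_le_gap[of p x0 n, OF pm p01 pS] by (simp add: p_def)
  qed
  show ?thesis
  proof (rule tendsto_sandwich)
    show "\<forall>\<^sub>F n in sequentially. tv_dist (overshoot_law n x0) stationary \<le> MC.gap n x0"
      unfolding tv_dist_def by (intro always_eventually allI cSUP_least bound) auto
    show "\<forall>\<^sub>F n in sequentially. 0 \<le> tv_dist (overshoot_law n x0) stationary"
    proof (intro always_eventually allI)
      fix n
      have "0 \<le> \<bar>measure (overshoot_law n x0) {} - measure stationary {}\<bar>" by simp
      also have "\<dots> \<le> tv_dist (overshoot_law n x0) stationary"
        unfolding tv_dist_def by (rule cSUP_upper) (auto intro!: bdd_aboveI2[of _ _ "MC.gap n x0"] bound)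
      finally show "0 \<le> tv_dist (overshoot_law n x0) stationary" .
    qed
    show "(\<lambda>n. MC.gap n x0) \<longlonglongrightarrow> 0" using MC.gap_tendsto[of x0] gap_zero by simp
  qed simp
qed

end

section \<open>Reachable points and the span\<close>

lemma lattice_set_pos: "d \<noteq> 0 \<Longrightarrow> lattice_set d = range (\<lambda>k::int. d * of_int k)"
  by (simp add: lattice_set_def)

lemma lattice_set_borel[measurable, simp]: "lattice_set d \<in> sets borel"
proof (cases "d = 0")
  case False
  show ?thesis
    unfolding lattice_set_pos[OF False] by (rule sets.countable) simp_all
qed (simp add: lattice_set_def)

lemma lattice_set_add: "x \<in> lattice_set d \<Longrightarrow> y \<in> lattice_set d \<Longrightarrow> x + y \<in> lattice_set d"
  by (cases "d = 0") (auto simp: lattice_set_def simp flip: distrib_left of_int_add)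

lemma lattice_set_minus: "x \<in> lattice_set d \<Longrightarrow> - x \<in> lattice_set d"
  by (cases "d = 0") (auto simp: lattice_set_def intro!: image_eqI[of _ _ "- _"])

context centred_step
begin

lemma walk_law_add:
  assumes [measurable]: "A \<in> sets borel" "B \<in> sets borel" "C \<in> sets borel"
    and sub: "\<And>a b. a \<in> A \<Longrightarrow> b \<in> B \<Longrightarrow> a + b \<in> C"
  shows "emeasure (walk_law m) A * emeasure (walk_law n) B \<le> emeasure (walk_law (m + n)) C"
proof -
  interpret Wn: prob_space "walk_law n" by (rule prob_space_walk_law)
  have C: "emeasure (walk_law k) C = (step ^^ k) (indicator C) 0" for k
    by (simp add: step_iterate_eq)
  have "emeasure (walk_law m) A * emeasure (walk_law n) B =
      (\<integral>\<^sup>+a. (\<integral>\<^sup>+b. indicator A a * indicator B b \<partial>walk_law n) \<partial>walk_law m)"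
    by (simp add: nn_integral_cmult nn_integral_multc)
  also have "\<dots> \<le> (\<integral>\<^sup>+a. (\<integral>\<^sup>+b. indicator C (a + b) \<partial>walk_law n) \<partial>walk_law m)"
    by (intro nn_integral_mono) (auto simp: indicator_def sub)
  also have "\<dots> = emeasure (walk_law (m + n)) C"
    unfolding C by (simp add: funpow_add step_iterate_eq)
  finally show ?thesis .
qed

lemma step_iterate_fixed: "(\<And>x. step G x = G x) \<Longrightarrow> (step ^^ n) G = G"
  by (induction n) auto

lemma walk_law_0:
  assumes [measurable]: "A \<in> sets borel"
  shows "emeasure (walk_law 0) A = indicator A 0"
  using step_iterate_eq[of "indicator A" 0 0] by simp

lemma walk_law_1:
  assumes [measurable]: "A \<in> sets borel"
  shows "emeasure (walk_law 1) A = emeasure \<mu> A"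
  using step_iterate_eq[of "indicator A" 1 0] by (simp add: step_def sets_step)

text \<open>The topological support of the sum of all \<open>walk_law n\<close>. Neighbourhoods
  instead of atoms let one set serve the lattice and the spread-out case.\<close>

definition reach :: "real set" where
  "reach = {t. \<forall>e>0. \<exists>n. emeasure (walk_law n) {t - e<..<t + e} \<noteq> 0}"

lemma reach_0: "0 \<in> reach"
proof -
  have "emeasure (walk_law 0) {0 - e<..<0 + e} \<noteq> 0" if "e > 0" for e :: real
    using that by (subst walk_law_0) auto
  then show ?thesis unfolding reach_def by blast
qed

lemma reach_add:
  assumes "s \<in> reach" "t \<in> reach" shows "s + t \<in> reach"
  unfolding reach_def
proof (intro CollectI allI impI)
  fix e :: real assume "e > 0"
  then have "0 < e / 2" by simp
  with assms obtain m n where mn: "emeasure (walk_law m) {s - e/2<..<s + e/2} \<noteq> 0"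
      "emeasure (walk_law n) {t - e/2<..<t + e/2} \<noteq> 0"
    unfolding reach_def by blast
  have "emeasure (walk_law m) {s - e/2<..<s + e/2} * emeasure (walk_law n) {t - e/2<..<t + e/2} \<le>
      emeasure (walk_law (m + n)) {s + t - e<..<s + t + e}"
    by (rule walk_law_add) auto
  then show "\<exists>n. emeasure (walk_law n) {s + t - e<..<s + t + e} \<noteq> 0"
    using mn by (intro exI[of _ "m + n"]) auto
qed

lemma reach_mult: "t \<in> reach \<Longrightarrow> real n * t \<in> reach"
  by (induction n) (auto simp: reach_0 distrib_right intro: reach_add)

text \<open>A law is carried by its support: only countably many intervals with rational endpoints
  can be null, and their union is discarded.\<close>

lemma AE_in_reach: "AE y in \<mu>. y \<in> reach"
proof -
  have "AE y in \<mu>. \<forall>a\<in>\<rat>. \<forall>b\<in>\<rat>. y \<in> {a<..<b} \<longrightarrow> emeasure \<mu> {a<..<b} \<noteq> 0"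
  proof -
    have "AE y in \<mu>. y \<in> {a<..<b} \<longrightarrow> emeasure \<mu> {a<..<b} \<noteq> 0" for a b :: real
    proof (cases "emeasure \<mu> {a<..<b} = 0")
      case True
      then show ?thesis
        by (intro AE_I'[of "{a<..<b}"]) (auto simp: null_sets_def sets_step)
    qed simp
    then show ?thesis by (simp add: AE_ball_countable countable_rat)
  qed
  then show ?thesis
  proof eventually_elim
    case (elim y)
    show ?case unfolding reach_def
    proof (intro CollectI allI impI)
      fix e :: real assume "e > 0"
      obtain a b where ab: "a \<in> \<rat>" "y - e < a" "a < y" "b \<in> \<rat>" "y < b" "b < y + e"
        using Rats_dense_in_real[of "y - e" y] Rats_dense_in_real[of y "y + e"] \<open>e > 0\<close> by auto
      then have "emeasure \<mu> {a<..<b} \<noteq> 0" using elim by auto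
      moreover have "emeasure \<mu> {a<..<b} \<le> emeasure \<mu> {y - e<..<y + e}"
        by (rule emeasure_mono) (use ab in \<open>auto simp: sets_step\<close>)
      ultimately have "emeasure (walk_law 1) {y - e<..<y + e} \<noteq> 0" by (subst walk_law_1) auto
      then show "\<exists>n. emeasure (walk_law n) {y - e<..<y + e} \<noteq> 0" by blast
    qed
  qed
qed

lemma exists_reach_pos:
  assumes "AE y in \<mu>. P y" shows "\<exists>y>0. P y \<and> y \<in> reach"
proof (rule ccontr)
  assume *: "\<not> ?thesis"
  have "AE y in \<mu>. y \<le> 0" using AE_in_reach assms
    by eventually_elim (use * in \<open>auto simp: not_less[symmetric]\<close>)
  then show False using not_AE_nonpos by simp
qed

lemma exists_reach_neg:
  assumes "AE y in \<mu>. P y" shows "\<exists>y<0. P y \<and> y \<in> reach"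
proof (rule ccontr)
  assume *: "\<not> ?thesis"
  have "AE y in \<mu>. 0 \<le> y" using AE_in_reach assms
    by eventually_elim (use * in \<open>auto simp: not_less[symmetric]\<close>)
  then show False using not_AE_nonneg by simp
qed

section \<open>Attainment of the span and reachability of the whole lattice\<close>

lemma measure_lattice_set: "measure \<mu> (lattice_set h) = 1 \<longleftrightarrow> (AE y in \<mu>. y \<in> lattice_set h)"
  using prob_eq_1[of "lattice_set h"] by (simp add: sets_step)

text \<open>A positive candidate \<open>h0\<close> forces an atom \<open>y \<noteq> 0\<close>. Every
  positive candidate divides \<open>y\<close>, hence has the form \<open>|y| / j\<close>, and only
  finitely many of these are at least \<open>h0\<close>. So the supremum is a maximum, and the law
  really lives on the lattice of its span.\<close>

lemma span_candidates:
  defines "S \<equiv> {h. 0 \<le> h \<and> measure \<mu> (lattice_set h) = 1}"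
  shows "bdd_above S" "span_of \<mu> \<in> S"
proof -
  have S0: "0 \<in> S" using prob_space by (simp add: S_def lattice_set_def)
  have "bdd_above S \<and> Sup S \<in> S"
  proof (cases "\<exists>h\<in>S. 0 < h")
    case False
    then have "S = {0}" using S0 by (force simp: S_def)
    then show ?thesis by simp
  next
    case True
    then obtain h0 where h0: "h0 \<in> S" "0 < h0" by auto
    have "\<exists>k::int. k \<noteq> 0 \<and> emeasure \<mu> {h0 * of_int k} \<noteq> 0"
    proof (rule ccontr)
      assume "\<not> ?thesis"
      then have "AE y in \<mu>. k \<noteq> 0 \<longrightarrow> y \<noteq> h0 * of_int k" for k :: int
        by (cases "k = 0") (auto intro!: AE_I'[of "{h0 * of_int k}"] simp: null_sets_def sets_step)
      then have "AE y in \<mu>. \<forall>k::int. k \<noteq> 0 \<longrightarrow> y \<noteq> h0 * of_int k" by (simp add: AE_all_countable)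
      moreover have "AE y in \<mu>. y \<in> lattice_set h0" using h0 by (simp add: S_def measure_lattice_set)
      ultimately have "AE y in \<mu>. y \<le> 0"
      proof eventually_elim
        case (elim y)
        then obtain k :: int where "y = h0 * of_int k" using h0 by (auto simp: lattice_set_pos)
        with elim show ?case by (cases "k = 0") auto
      qed
      then show False using not_AE_nonpos by simp
    qed
    then obtain k where k: "k \<noteq> 0" "emeasure \<mu> {h0 * of_int k} \<noteq> 0" by auto
    define y where "y = h0 * of_int k"
    have y: "y \<noteq> 0" using k h0 by (simp add: y_def)
    have div: "\<exists>j::nat. 0 < j \<and> \<bar>y\<bar> = h * real j" if h: "h \<in> S" "0 < h" for h
    proof -
      have "y \<in> lattice_set h"
      proof (rule ccontr)
        assume "y \<notin> lattice_set h"
        moreover have "AE z in \<mu>. z \<in> lattice_set h" using h by (simp add: S_def measure_lattice_set)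
        ultimately have "AE z in \<mu>. z \<notin> {y}" by (auto elim!: eventually_mono)
        then have "emeasure \<mu> {y} = 0" by (subst (asm) AE_iff_measurable[OF _ refl]) (auto simp: sets_step)
        then show False using k by (simp add: y_def)
      qed
      then obtain j :: int where j: "y = h * of_int j" using h by (auto simp: lattice_set_pos)
      then show ?thesis using h y by (intro exI[of _ "nat \<bar>j\<bar>"]) (auto simp: abs_mult)
    qed
    have bdd: "bdd_above S"
    proof (rule bdd_aboveI)
      fix h assume h: "h \<in> S"
      show "h \<le> \<bar>y\<bar>"
      proof (cases "0 < h")
        case True
        then obtain j :: nat where "0 < j" "\<bar>y\<bar> = h * real j" using div h by blast
        then show ?thesis using True by simp
      qed simp
    qed
    have Sup: "h0 \<le> Sup S" by (rule cSup_upper[OF h0(1) bdd])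
    define T where "T = {h \<in> S. h0 \<le> h}"
    have "T \<subseteq> (\<lambda>j. \<bar>y\<bar> / real j) ` {1..nat \<lceil>\<bar>y\<bar> / h0\<rceil>}"
    proof
      fix h assume h: "h \<in> T"
      then obtain j :: nat where j: "0 < j" "\<bar>y\<bar> = h * real j" using div[of h] h0 by (auto simp: T_def)
      have "h0 * real j \<le> \<bar>y\<bar>" using h j by (simp add: T_def mult_right_mono)
      then have "real j \<le> \<bar>y\<bar> / h0" using h0 by (simp add: field_simps)
      then have "j \<le> nat \<lceil>\<bar>y\<bar> / h0\<rceil>" by linarith
      then show "h \<in> (\<lambda>j. \<bar>y\<bar> / real j) ` {1..nat \<lceil>\<bar>y\<bar> / h0\<rceil>}"
        using j by (intro image_eqI[of _ _ j]) auto
    qed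
    then have fin: "finite T" by (rule finite_subset) simp
    have T: "Max T \<in> T" by (rule Max_in[OF fin]) (use h0 in \<open>auto simp: T_def\<close>)
    have "Sup S = Max T"
    proof (rule cSup_eq_maximum)
      show "Max T \<in> S" using T by (simp add: T_def)
      fix h assume h: "h \<in> S"
      show "h \<le> Max T"
      proof (cases "h0 \<le> h")
        case True
        then show ?thesis using h fin by (intro Max_ge) (auto simp: T_def)
      next
        case False
        then show ?thesis using T by (simp add: T_def)
      qed
    qed
    then show ?thesis using bdd T by (simp add: T_def)
  qed
  then show "bdd_above S" "span_of \<mu> \<in> S" by (auto simp: span_of_def S_def)
qed

lemma span_nonneg: "0 \<le> span_of \<mu>"
  and AE_lattice_span: "AE y in \<mu>. y \<in> lattice_set (span_of \<mu>)"
  using span_candidates(2) by (auto simp: measure_lattice_set)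

lemma span_maximal: "0 \<le> h \<Longrightarrow> AE y in \<mu>. y \<in> lattice_set h \<Longrightarrow> h \<le> span_of \<mu>"
  unfolding span_of_def using span_candidates(1) by (intro cSup_upper) (auto simp: measure_lattice_set)

text \<open>The integers \<open>k\<close> with \<open>d * k\<close> in \<open>reach\<close> form a
  semigroup with elements of both signs, hence a group. If \<open>e\<close> is its positive
  generator, the steps lie almost surely in the lattice of span \<open>d * e\<close>, and maximality
  of the span gives \<open>e = 1\<close>.\<close>

lemma lattice_subset_reach:
  assumes d: "0 < span_of \<mu>"
  shows "lattice_set (span_of \<mu>) \<subseteq> reach"
proof -
  define d where "d = span_of \<mu>"
  have d0: "0 < d" using assms by (simp add: d_def)
  have L: "lattice_set d = range (\<lambda>k::int. d * of_int k)" using d0 by (simp add: lattice_set_pos)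
  have AEL: "AE y in \<mu>. y \<in> lattice_set d" unfolding d_def by (rule AE_lattice_span)
  define I where "I = {k::int. d * of_int k \<in> reach}"
  have add: "j + k \<in> I" if "j \<in> I" "k \<in> I" for j k
    using reach_add[of "d * of_int j" "d * of_int k"] that by (simp add: I_def algebra_simps)
  have mult: "int n * k \<in> I" if "k \<in> I" for n k
    using reach_mult[of "d * of_int k" n] that by (simp add: I_def algebra_simps)
  obtain a where a: "0 < a" "a \<in> I"
    using exists_reach_pos[OF AEL] d0 by (auto simp: L I_def zero_less_mult_iff)
  obtain b where b: "0 < b" "- b \<in> I"
    using exists_reach_neg[OF AEL] d0 by (force simp: L I_def mult_less_0_iff intro: that[of "- _"])
  have minus: "- k \<in> I" if "k \<in> I" for k
  proof -
    consider "k > 0" | "k = 0" | "k < 0" by linarith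
    then show ?thesis
    proof cases
      case 1
      \<comment> \<open>The identity \<open>- k = (b - 1) * k + k * (- b)\<close> expresses the
        inverse with nonnegative coefficients.\<close>
      have "int (nat (b - 1)) * k + int (nat k) * (- b) \<in> I" by (intro add mult that b)
      then show ?thesis using 1 b by (simp add: algebra_simps)
    next
      case 3
      have "int (nat (a - 1)) * k + int (nat (- k)) * a \<in> I" by (intro add mult that a)
      then show ?thesis using 3 a by (simp add: algebra_simps)
    qed (use that in simp)
  qed
  have zmult: "j * k \<in> I" if "k \<in> I" for j k
    using mult[OF that, of "nat j"] minus[OF mult[OF that, of "nat (- j)"]] by (cases "0 \<le> j") auto
  define e where "e = (LEAST n::nat. 0 < n \<and> int n \<in> I)"
  have "0 < nat a \<and> int (nat a) \<in> I" using a by simp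
  then have e: "0 < e \<and> int e \<in> I" unfolding e_def by (rule LeastI)
  have e_min: "e \<le> n" if "0 < n" "int n \<in> I" for n unfolding e_def using that by (intro Least_le) simp
  have dvd: "int e dvd k" if k: "k \<in> I" for k
  proof -
    have "k mod int e = k + (- (k div int e)) * int e" by (simp add: minus_div_mult_eq_mod[symmetric])
    also have "\<dots> \<in> I" by (rule add[OF k zmult]) (use e in simp)
    finally have m: "k mod int e \<in> I" .
    have "0 \<le> k mod int e" "k mod int e < int e" using e by auto
    with m e_min[of "nat (k mod int e)"] have "k mod int e = 0" by (cases "k mod int e = 0") auto
    then show ?thesis by auto
  qed
  have "AE y in \<mu>. y \<in> lattice_set (d * real e)"
    using AEL AE_in_reach
  proof eventually_elim
    case (elim y)
    then obtain k where k: "y = d * of_int k" "k \<in> I" by (auto simp: L I_def)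
    then obtain j where "k = int e * j" using dvd by (auto elim: dvdE)
    then show ?case using k d0 e by (auto simp: lattice_set_pos)
  qed
  then have "d * real e \<le> d" using span_maximal[of "d * real e"] d0 by (simp add: d_def)
  then have "e = 1" using d0 e by (simp add: mult_le_cancel_left2)
  then have "1 \<in> I" using e by simp
  then have "k \<in> I" for k using zmult[of 1 k] by simp
  then show ?thesis by (auto simp: d_def[symmetric] L I_def)
qed

lemma AE_walk_law_lattice:
  assumes "AE y in \<mu>. y \<in> lattice_set d"
  shows "emeasure (walk_law n) (- lattice_set d) = 0"
proof -
  have "(step ^^ n) (indicator (- lattice_set d)) x = 0" if "x \<in> lattice_set d" for x
    using that
  proof (induction n arbitrary: x)
    case (Suc n)
    define g where "g = (step ^^ n) (indicator (- lattice_set d))"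
    have "step g x = (\<integral>\<^sup>+y. 0 \<partial>\<mu>)"
      unfolding step_def
    proof (rule nn_integral_cong_AE)
      show "AE y in \<mu>. g (x + y) = 0"
        using assms
        by eventually_elim (unfold g_def, intro Suc.IH lattice_set_add Suc.prems)
    qed
    then show ?case by (simp add: g_def)
  qed simp
  moreover have "0 \<in> lattice_set d" by (auto simp: lattice_set_def)
  moreover have "emeasure (walk_law n) (- lattice_set d) = (step ^^ n) (indicator (- lattice_set d)) 0"
    by (simp add: step_iterate_eq)
  ultimately show ?thesis by simp
qed

text \<open>The ball of radius \<open>d\<close> around \<open>x\<close> contains no other lattice
  point and the walk stays on the lattice, so positive mass near \<open>x\<close> is mass at
  \<open>x\<close>.\<close>

lemma walk_law_hits_lattice:
  assumes d: "0 < span_of \<mu>" and x: "x \<in> lattice_set (span_of \<mu>)"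
  shows "\<exists>n. emeasure (walk_law n) {x} \<noteq> 0"
proof -
  define d where "d = span_of \<mu>"
  have d0: "0 < d" using d by (simp add: d_def)
  obtain n where n: "emeasure (walk_law n) {x - d<..<x + d} \<noteq> 0"
    using lattice_subset_reach[OF d] x d0 unfolding reach_def by blast
  have "{x - d<..<x + d} \<subseteq> {x} \<union> (- lattice_set d)"
  proof
    fix z assume z: "z \<in> {x - d<..<x + d}"
    show "z \<in> {x} \<union> (- lattice_set d)"
    proof (cases "z \<in> lattice_set d")
      case True
      then obtain k j :: int where kj: "z = d * of_int k" "x = d * of_int j"
        using x d0 by (auto simp: lattice_set_pos d_def)
      then have "d * of_int (k - j) < d * 1" "d * (- 1) < d * of_int (k - j)"
        using z by (auto simp: algebra_simps)
      then have "of_int (k - j) < (1::real)" "- 1 < (of_int (k - j) :: real)"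
        using d0 by (simp_all only: mult_less_cancel_left_pos)
      then have "k = j" by linarith
      then show ?thesis using kj by simp
    qed simp
  qed
  then have "emeasure (walk_law n) {x - d<..<x + d} \<le> emeasure (walk_law n) ({x} \<union> (- lattice_set d))"
    by (rule emeasure_mono) auto
  also have "\<dots> \<le> emeasure (walk_law n) {x} + emeasure (walk_law n) (- lattice_set d)"
    by (rule emeasure_subadditive) auto
  also have "emeasure (walk_law n) (- lattice_set d) = 0"
    unfolding d_def by (rule AE_walk_law_lattice[OF AE_lattice_span])
  finally have "emeasure (walk_law n) {x} \<noteq> 0" using n by auto
  then show ?thesis by blast
qed

end

section \<open>Smoothing of spread-out laws\<close>

text \<open>Hahn decompositions of \<open>L\<close> against \<open>lborel\<close> scaled by
  \<open>1 / Suc n\<close> take the place of a Lebesgue decomposition, on bounded intervals to keep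
  the masses finite. If all sets \<open>Y j n\<close> were Lebesgue null, then off their union
  \<open>L\<close> would be at most \<open>1 / Suc n\<close> times Lebesgue measure for every
  \<open>n\<close>, hence zero, and \<open>L\<close> would be singular.\<close>

lemma nonsingular_component:
  fixes L :: "real measure"
  assumes L: "prob_space L" "sets L = sets borel" and ns: "\<not> mutually_singular L lborel"
  obtains E \<eta> where "E \<in> sets borel" "0 < emeasure lborel E" "emeasure lborel E < \<infinity>" "(0::real) < \<eta>"
    "\<And>X. X \<in> sets borel \<Longrightarrow> X \<subseteq> E \<Longrightarrow> ennreal \<eta> * emeasure lborel X \<le> emeasure L X"
proof -
  interpret L: prob_space L by fact
  have "\<exists>Y\<in>sets L. Y \<subseteq> {- real j..real j} \<and>
      (\<forall>X\<in>sets L. X \<subseteq> Y \<longrightarrow> emeasure (scale_measure (ennreal (1 / Suc n)) lborel) X \<le> emeasure L X) \<and>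
      (\<forall>X\<in>sets L. X \<subseteq> {- real j..real j} \<longrightarrow> X \<inter> Y = {} \<longrightarrow>
        emeasure L X \<le> emeasure (scale_measure (ennreal (1 / Suc n)) lborel) X)" for j n :: nat
    by (rule unsigned_Hahn_decomposition) (auto simp: L ennreal_mult_eq_top_iff)
  then obtain Y where Y: "\<And>j n. Y j n \<in> sets borel" "\<And>j n. Y j n \<subseteq> {- real j..real j}"
    and inside: "\<And>j n X. X \<in> sets borel \<Longrightarrow> X \<subseteq> Y j n \<Longrightarrow> ennreal (1 / Suc n) * emeasure lborel X \<le> emeasure L X"
    and outside: "\<And>j n X. X \<in> sets borel \<Longrightarrow> X \<subseteq> {- real j..real j} \<Longrightarrow> X \<inter> Y j n = {} \<Longrightarrow>
        emeasure L X \<le> ennreal (1 / Suc n) * emeasure lborel X"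
    unfolding L(2) emeasure_scale_measure by metis
  show ?thesis
  proof (cases "\<exists>j n. emeasure lborel (Y j n) \<noteq> 0")
    case True
    then obtain j n where jn: "emeasure lborel (Y j n) \<noteq> 0" by auto
    have "emeasure lborel (Y j n) \<le> emeasure lborel {- real j..real j}"
      by (rule emeasure_mono[OF Y(2)]) simp
    also have "\<dots> < \<infinity>" by simp
    finally show ?thesis
      using jn by (intro that[of "Y j n" "1 / Suc n"] Y inside) (auto simp: zero_less_iff_neq_zero)
  next
    case False
    define Z where "Z = (\<Union>j n. Y j n)"
    have Zb[measurable]: "Z \<in> sets borel" unfolding Z_def using Y(1) by auto
    have "Z \<in> null_sets lborel"
      unfolding Z_def using False Y(1) by (intro null_sets_UN') (auto simp: null_sets_def)
    have zero: "emeasure L ({- real j..real j} - Z) = 0" for j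
    proof -
      have "emeasure L ({- real j..real j} - Z) \<le> 0"
      proof (rule LIMSEQ_le_const)
        show "(\<lambda>n. ennreal (1 / Suc n * (2 * real j))) \<longlonglongrightarrow> 0"
          using tendsto_ennrealI[OF tendsto_mult_left_zero[OF LIMSEQ_inverse_real_of_nat, of "2 * real j"]]
          by (simp add: inverse_eq_divide)
        have "emeasure L ({- real j..real j} - Z) \<le> ennreal (1 / Suc n * (2 * real j))" for n
        proof -
          have "emeasure L ({- real j..real j} - Z) \<le> ennreal (1 / Suc n) * emeasure lborel ({- real j..real j} - Z)"
          proof (rule outside[of _ j])
            show "{- real j..real j} - Z \<in> sets borel" by measurable
          qed (auto simp: Z_def)
          also have "\<dots> \<le> ennreal (1 / Suc n) * emeasure lborel {- real j..real j}"
            by (intro mult_left_mono emeasure_mono) auto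
          also have "\<dots> = ennreal (1 / Suc n * (2 * real j))"
            by (simp flip: ennreal_mult')
          finally show ?thesis .
        qed
        then show "\<exists>N. \<forall>n\<ge>N. emeasure L ({- real j..real j} - Z) \<le> ennreal (1 / Suc n * (2 * real j))" by blast
      qed
      then show ?thesis by simp
    qed
    have cover: "UNIV - Z = (\<Union>j::nat. {- real j..real j} - Z)"
    proof -
      have "\<exists>j::nat. x \<in> {- real j..real j}" for x :: real
      proof -
        obtain n :: nat where "\<bar>x\<bar> \<le> real n" using real_arch_simple by blast
        then show ?thesis by (intro exI[of _ n]) (simp add: abs_le_iff)
      qed
      then show ?thesis by blast
    qed
    have "UNIV - Z \<in> null_sets L"
      unfolding cover using zero L(2) by (intro null_sets_UN) (auto simp: null_sets_def)
    then have "mutually_singular L lborel"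
      unfolding mutually_singular_def using \<open>Z \<in> null_sets lborel\<close> L(2)
      by (intro bexI[of _ "UNIV - Z"]) (auto simp: null_sets_def Diff_Diff_Int)
    with ns show ?thesis by simp
  qed
qed

text \<open>A form of Steinhaus' theorem. For \<open>\<bar>t\<bar> < \<delta>\<close> the translate by \<open>t\<close> of the part of \<open>H\<close> that has
  distance at least \<open>\<delta>\<close> from the complement of \<open>U\<close> stays inside \<open>U\<close>, which is only slightly larger
  than \<open>H\<close>, so the two must overlap.\<close>

lemma translate_overlap:
  fixes H :: "real set"
  assumes H[measurable]: "H \<in> sets borel" and pos: "0 < emeasure lborel H" and fin: "emeasure lborel H < \<infinity>"
  obtains \<delta> \<epsilon> :: real where "0 < \<delta>" "0 < \<epsilon>"
    "\<And>t. \<bar>t\<bar> < \<delta> \<Longrightarrow> ennreal \<epsilon> \<le> emeasure lborel (H \<inter> {z. z - t \<in> H})"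
proof -
  define h where "h = measure lborel H"
  have h1: "emeasure lborel H = ennreal h"
    unfolding h_def by (rule emeasure_eq_ennreal_measure) (use fin in simp)
  moreover have "0 < h" using pos unfolding h1 by simp
  ultimately have h: "emeasure lborel H = ennreal h" "0 < h" by auto
  obtain U where U: "open U" "H \<subseteq> U" "emeasure lborel (U - H) < ennreal (h / 4)"
    using outer_regular_lborel[OF H, of "h / 4"] h by auto
  have Ub[measurable]: "U \<in> sets borel" using U(1) by simp
  have Ule: "emeasure lborel U \<le> ennreal (5 / 4 * h)"
  proof -
    have "emeasure lborel U = emeasure lborel H + emeasure lborel (U - H)"
      using U(2) by (subst plus_emeasure) (auto intro!: arg_cong[where f="emeasure lborel"])
    also have "\<dots> \<le> ennreal h + ennreal (h / 4)" using U(3) h by (intro add_mono) auto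
    also have "\<dots> = ennreal (5 / 4 * h)" using h by (simp flip: ennreal_plus)
    finally show ?thesis .
  qed
  define V where "V n = {x. \<forall>y. \<bar>y - x\<bar> < 1 / Suc n \<longrightarrow> y \<in> U}" for n :: nat
  have Vb[measurable]: "V n \<in> sets borel" for n
  proof -
    have "- V n = (\<Union>y\<in>-U. ball y (1 / Suc n))" by (auto simp: V_def dist_real_def)
    then have "open (- V n)" by auto
    then show ?thesis by (auto simp: closed_def intro: borel_closed)
  qed
  have inc: "incseq (\<lambda>n. H \<inter> V n)"
  proof (rule incseq_SucI)
    fix n
    have "1 / real (Suc (Suc n)) \<le> 1 / real (Suc n)" by (simp add: field_simps)
    then show "H \<inter> V n \<subseteq> H \<inter> V (Suc n)" unfolding V_def by (auto dest: less_le_trans)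
  qed
  have "(\<Union>n. H \<inter> V n) = H"
  proof -
    have "\<exists>n. x \<in> V n" if "x \<in> H" for x
    proof -
      obtain e where e: "e > 0" "ball x e \<subseteq> U" using openE[OF U(1), of x] U(2) \<open>x \<in> H\<close> by blast
      obtain n where "inverse (real (Suc n)) < e" using reals_Archimedean[OF e(1)] by auto
      then have "ball x (1 / real (Suc n)) \<subseteq> U"
        using e(2) subset_ball[of "1 / real (Suc n)" e x] by (auto simp: inverse_eq_divide)
      then have "x \<in> V n" unfolding V_def
        by (auto simp: subset_iff dist_real_def abs_minus_commute)
      then show ?thesis ..
    qed
    then show ?thesis by auto
  qed
  then have "(\<lambda>n. emeasure lborel (H \<inter> V n)) \<longlonglongrightarrow> ennreal h"
    using Lim_emeasure_incseq[OF _ inc, of lborel] h sets.Int[OF H Vb] by (simp add: image_subset_iff)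
  moreover have "ennreal (3 / 4 * h) < ennreal h" using h by (intro ennreal_lessI) auto
  ultimately have "eventually (\<lambda>n. ennreal (3 / 4 * h) < emeasure lborel (H \<inter> V n)) sequentially"
    by (rule order_tendstoD(1))
  then obtain n where n: "ennreal (3 / 4 * h) < emeasure lborel (H \<inter> V n)"
    by (auto simp: eventually_sequentially)
  define F where "F = H \<inter> V n"
  have Fb[measurable]: "F \<in> sets borel" by (simp add: F_def)
  show ?thesis
  proof (rule that[of "1 / Suc n" "h / 4"])
    fix t :: real assume t: "\<bar>t\<bar> < 1 / Suc n"
    define F' where "F' = {z. z - t \<in> F}"
    have F'b[measurable]: "F' \<in> sets borel" unfolding F'_def by measurable
    have "emeasure lborel F' = (\<integral>\<^sup>+z. indicator F' z \<partial>lborel)" by simp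
    also have "\<dots> = (\<integral>\<^sup>+z. indicator F (z - t) \<partial>lborel)"
      by (rule nn_integral_cong) (simp add: F'_def indicator_def)
    also have "\<dots> = emeasure lborel F"
      using nn_integral_real_affine[of "indicator F" 1 "- t"] by (simp add: add.commute)
    finally have F'e: "emeasure lborel F' = emeasure lborel F" .
    have sub: "F \<union> F' \<subseteq> U"
    proof -
      have "z \<in> U" if "z \<in> F'" for z
      proof -
        have "z - t \<in> V n" using that by (simp add: F'_def F_def)
        moreover have "\<bar>z - (z - t)\<bar> < 1 / Suc n" using t by simp
        ultimately show ?thesis unfolding V_def by blast
      qed
      then show ?thesis using U(2) by (auto simp: F_def)
    qed
    \<comment> \<open>Both copies of \<open>F\<close> have measure above \<open>3 / 4 * h\<close>
      and lie in \<open>U\<close>, of measure at most \<open>5 / 4 * h\<close>; this leaves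
      \<open>h / 4\<close> for the intersection.\<close>
    have "emeasure lborel F + emeasure lborel F' = emeasure lborel (F \<union> F') + emeasure lborel (F \<inter> F')"
      using emeasure_Un_Int[of F lborel F'] by simp
    also have "\<dots> \<le> ennreal (5 / 4 * h) + emeasure lborel (F \<inter> F')"
      using emeasure_mono[OF sub, of lborel] Ule by (intro add_right_mono) auto
    finally have "emeasure lborel F + emeasure lborel F \<le> ennreal (5 / 4 * h) + emeasure lborel (F \<inter> F')"
      unfolding F'e .
    moreover have "ennreal (3 / 4 * h) + ennreal (3 / 4 * h) \<le> emeasure lborel F + emeasure lborel F"
      using n unfolding F_def by (intro add_mono less_imp_le)
    ultimately have "ennreal (3 / 4 * h) + ennreal (3 / 4 * h) \<le> ennreal (5 / 4 * h) + emeasure lborel (F \<inter> F')"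
      by (rule order_trans[rotated])
    moreover have "ennreal (3 / 4 * h) + ennreal (3 / 4 * h) = ennreal (5 / 4 * h) + ennreal (h / 4)"
      using h by (simp flip: ennreal_plus)
    ultimately have "ennreal (h / 4) \<le> emeasure lborel (F \<inter> F')"
      by (simp add: ennreal_add_left_cancel_le)
    also have "\<dots> \<le> emeasure lborel (H \<inter> {z. z - t \<in> H})"
      by (rule emeasure_mono) (auto simp: F_def F'_def)
    finally show "ennreal (h / 4) \<le> emeasure lborel (H \<inter> {z. z - t \<in> H})" .
  qed (use h in auto)
qed

lemma emeasure_sum_overlap:
  fixes E :: "real set"
  assumes [measurable]: "E \<in> sets borel"
  shows "emeasure lborel (E \<inter> {z. w - z \<in> E}) = (\<integral>\<^sup>+z. indicator E z * indicator E (w - z) \<partial>lborel)"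
proof -
  have "(\<integral>\<^sup>+z. indicator E z * indicator E (w - z) \<partial>lborel) = (\<integral>\<^sup>+z. indicator (E \<inter> {z. w - z \<in> E}) z \<partial>lborel)"
    by (rule nn_integral_cong) (simp add: indicator_def)
  then show ?thesis by simp
qed

text \<open>The measure in question is the convolution of the indicator of \<open>E\<close> with
  itself at \<open>w\<close>. Its integral is the square of the measure of \<open>E\<close>, so it
  is positive at some \<open>u\<close>. For \<open>H = E \<inter> (u - E)\<close>, the overlap of
  \<open>H\<close> with its translate by \<open>w - u\<close> lies in
  \<open>E \<inter> (w - E)\<close>, and \<open>translate_overlap\<close> bounds it below for
  \<open>w\<close> near \<open>u\<close>.\<close>

lemma sumset_overlap:
  fixes E :: "real set"
  assumes E[measurable]: "E \<in> sets borel" and pos: "0 < emeasure lborel E" and fin: "emeasure lborel E < \<infinity>"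
  obtains u r \<epsilon> :: real where "0 < r" "0 < \<epsilon>"
    "\<And>w. \<bar>w - u\<bar> < r \<Longrightarrow> ennreal \<epsilon> \<le> emeasure lborel (E \<inter> {z. w - z \<in> E})"
proof -
  note em = emeasure_sum_overlap[OF E]
  have "\<exists>u. emeasure lborel (E \<inter> {z. u - z \<in> E}) \<noteq> 0"
  proof (rule ccontr)
    assume "\<not> ?thesis"
    then have "0 = (\<integral>\<^sup>+w. (\<integral>\<^sup>+z. indicator E z * indicator E (w - z) \<partial>lborel) \<partial>lborel)"
      by (simp flip: em)
    also have "\<dots> = (\<integral>\<^sup>+z. (\<integral>\<^sup>+w. indicator E z * indicator E (w - z) \<partial>lborel) \<partial>lborel)"
      by (rule lborel_pair.Fubini'[symmetric]) measurable
    also have "\<dots> = (\<integral>\<^sup>+z. indicator E z * emeasure lborel E \<partial>lborel)"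
    proof (rule nn_integral_cong)
      fix z :: real
      have "(\<integral>\<^sup>+w. indicator E (w - z) \<partial>lborel) = emeasure lborel E"
        using nn_integral_real_affine[of "indicator E" 1 "- z"] by (simp add: add.commute)
      then show "(\<integral>\<^sup>+w. indicator E z * indicator E (w - z) \<partial>lborel) = indicator E z * emeasure lborel E"
        by (subst nn_integral_cmult) auto
    qed
    also have "\<dots> = emeasure lborel E * emeasure lborel E" by (simp add: nn_integral_multc)
    finally show False using pos by simp
  qed
  then obtain u where u: "emeasure lborel (E \<inter> {z. u - z \<in> E}) \<noteq> 0" by auto
  define H where "H = E \<inter> {z. u - z \<in> E}"
  have Hb: "H \<in> sets borel" unfolding H_def by measurable
  have "emeasure lborel H \<le> emeasure lborel E" unfolding H_def by (rule emeasure_mono) auto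
  then have "emeasure lborel H < \<infinity>" using fin by (rule le_less_trans)
  moreover have "0 < emeasure lborel H" using u by (simp add: H_def zero_less_iff_neq_zero)
  ultimately obtain \<delta> \<epsilon> :: real where \<delta>: "0 < \<delta>" "0 < \<epsilon>"
    "\<And>t. \<bar>t\<bar> < \<delta> \<Longrightarrow> ennreal \<epsilon> \<le> emeasure lborel (H \<inter> {z. z - t \<in> H})"
    using translate_overlap[OF Hb] by metis
  show ?thesis
  proof (rule that[OF \<delta>(1,2)])
    fix w assume w: "\<bar>w - u\<bar> < \<delta>"
    have "ennreal \<epsilon> \<le> emeasure lborel (H \<inter> {z. z - (w - u) \<in> H})" by (rule \<delta>(3)[OF w])
    also have "\<dots> \<le> emeasure lborel (E \<inter> {z. w - z \<in> E})"
      by (rule emeasure_mono) (auto simp: H_def algebra_simps)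
    finally show "ennreal \<epsilon> \<le> emeasure lborel (E \<inter> {z. w - z \<in> E})" .
  qed
qed

context centred_step
begin

text \<open>Since \<open>walk_law k\<close> dominates \<eta> times Lebesgue measure on
  \<open>E\<close>, the law after \<open>k + k\<close> steps dominates
  \<open>\<eta> * \<eta>\<close> times the self-convolution of the indicator of \<open>E\<close>.
  Doubling the time replaces a mere measurable set by an interval.\<close>

lemma spread_out_smoothing:
  assumes ns: "\<not> mutually_singular (walk_law k) lborel"
  obtains u r \<epsilon> :: real where "0 < r" "0 < \<epsilon>"
    "\<And>f y. f \<in> borel_measurable borel \<Longrightarrow>
      ennreal \<epsilon> * (\<integral>\<^sup>+w. indicator {u - r<..<u + r} w * f (y + w) \<partial>lborel) \<le> (step ^^ (k + k)) f y"
proof -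
  interpret W: prob_space "walk_law k" by (rule prob_space_walk_law)
  obtain E \<eta> where E[measurable]: "E \<in> sets borel" and Epos: "0 < emeasure lborel E" "emeasure lborel E < \<infinity>"
    and \<eta>: "(0::real) < \<eta>"
    and dom: "\<And>X. X \<in> sets borel \<Longrightarrow> X \<subseteq> E \<Longrightarrow> ennreal \<eta> * emeasure lborel X \<le> emeasure (walk_law k) X"
    using nonsingular_component[OF W.prob_space_axioms sets_walk_law ns] by metis
  obtain u r \<epsilon> :: real where r: "0 < r" and \<epsilon>: "0 < \<epsilon>"
    and overlap: "\<And>w. \<bar>w - u\<bar> < r \<Longrightarrow> ennreal \<epsilon> \<le> emeasure lborel (E \<inter> {z. w - z \<in> E})"
    using sumset_overlap[OF E Epos] by metis
  have nn: "ennreal \<eta> * (\<integral>\<^sup>+y. indicator E y * f y \<partial>lborel) \<le> (\<integral>\<^sup>+y. f y \<partial>walk_law k)"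
    if [measurable]: "f \<in> borel_measurable borel" for f
  proof -
    define D where "D = density lborel (\<lambda>y. ennreal \<eta> * indicator E y)"
    have sD: "sets D = sets (walk_law k)" by (simp add: D_def)
    have "D \<le> walk_law k"
      unfolding le_measure[OF sD]
    proof
      show "emeasure D X \<le> emeasure (walk_law k) X" if "X \<in> sets D" for X
      proof -
        have X[measurable]: "X \<in> sets borel" using that by (simp add: D_def)
        have "emeasure D X = ennreal \<eta> * emeasure lborel (E \<inter> X)"
          unfolding D_def by (subst emeasure_density) (auto simp: mult.assoc nn_integral_cmult indicator_inter_arith[symmetric])
        also have "\<dots> \<le> emeasure (walk_law k) (E \<inter> X)" by (rule dom) auto
        also have "\<dots> \<le> emeasure (walk_law k) X" by (rule emeasure_mono) auto
        finally show ?thesis .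
      qed
    qed
    then have "(\<integral>\<^sup>+y. f y \<partial>D) \<le> (\<integral>\<^sup>+y. f y \<partial>walk_law k)"
      by (intro nn_integral_mono_measure) (simp add: D_def)
    also have "(\<integral>\<^sup>+y. f y \<partial>D) = ennreal \<eta> * (\<integral>\<^sup>+y. indicator E y * f y \<partial>lborel)"
      unfolding D_def by (subst nn_integral_density) (auto simp: mult.assoc nn_integral_cmult)
    finally show ?thesis .
  qed
  show ?thesis
  proof (rule that[OF r, of "\<eta> * \<eta> * \<epsilon>"])
    show "0 < \<eta> * \<eta> * \<epsilon>" using \<eta> \<epsilon> by simp
    fix f :: "real \<Rightarrow> ennreal" and y :: real
    assume f[measurable]: "f \<in> borel_measurable borel"
    have "ennreal (\<eta> * \<eta> * \<epsilon>) * (\<integral>\<^sup>+w. indicator {u - r<..<u + r} w * f (y + w) \<partial>lborel) =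
        ennreal \<eta> * (ennreal \<eta> * (\<integral>\<^sup>+w. ennreal \<epsilon> * (indicator {u - r<..<u + r} w * f (y + w)) \<partial>lborel))"
      using \<eta> \<epsilon> by (simp add: nn_integral_cmult ennreal_mult mult.assoc)
    also have "\<dots> \<le> ennreal \<eta> * (ennreal \<eta> * (\<integral>\<^sup>+w. emeasure lborel (E \<inter> {z. w - z \<in> E}) * f (y + w) \<partial>lborel))"
      by (intro mult_left_mono nn_integral_mono)
         (auto simp: indicator_def abs_less_iff intro!: mult_right_mono overlap)
    also have "(\<integral>\<^sup>+w. emeasure lborel (E \<inter> {z. w - z \<in> E}) * f (y + w) \<partial>lborel) =
        (\<integral>\<^sup>+w. (\<integral>\<^sup>+z. indicator E z * (indicator E (w - z) * f (y + w)) \<partial>lborel) \<partial>lborel)"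
    proof (rule nn_integral_cong)
      fix w
      have "emeasure lborel (E \<inter> {z. w - z \<in> E}) = (\<integral>\<^sup>+z. indicator E z * indicator E (w - z) \<partial>lborel)"
        by (rule emeasure_sum_overlap) measurable
      then show "emeasure lborel (E \<inter> {z. w - z \<in> E}) * f (y + w) =
          (\<integral>\<^sup>+z. indicator E z * (indicator E (w - z) * f (y + w)) \<partial>lborel)"
        by (simp add: nn_integral_multc[symmetric] mult.assoc)
    qed
    also have "\<dots> = (\<integral>\<^sup>+z. (\<integral>\<^sup>+w. indicator E z * (indicator E (w - z) * f (y + w)) \<partial>lborel) \<partial>lborel)"
      by (rule lborel_pair.Fubini'[symmetric]) measurable
    also have "\<dots> = (\<integral>\<^sup>+z. indicator E z * (\<integral>\<^sup>+w. indicator E w * f (y + z + w) \<partial>lborel) \<partial>lborel)"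
    proof (rule nn_integral_cong)
      fix z :: real
      have "(\<integral>\<^sup>+w. indicator E (w - z) * f (y + w) \<partial>lborel) = (\<integral>\<^sup>+w. indicator E w * f (y + z + w) \<partial>lborel)"
        using nn_integral_real_affine[of "\<lambda>w. indicator E (w - z) * f (y + w)" 1 z] by (simp add: add.assoc)
      then show "(\<integral>\<^sup>+w. indicator E z * (indicator E (w - z) * f (y + w)) \<partial>lborel) =
          indicator E z * (\<integral>\<^sup>+w. indicator E w * f (y + z + w) \<partial>lborel)"
        by (subst nn_integral_cmult) auto
    qed
    also have "ennreal \<eta> * (ennreal \<eta> * \<dots>) =
        ennreal \<eta> * (\<integral>\<^sup>+z. indicator E z * (ennreal \<eta> * (\<integral>\<^sup>+w. indicator E w * f (y + z + w) \<partial>lborel)) \<partial>lborel)"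
      by (subst nn_integral_cmult[symmetric]) (auto simp: mult_ac)
    also have "\<dots> \<le> ennreal \<eta> * (\<integral>\<^sup>+z. indicator E z * (step ^^ k) f (y + z) \<partial>lborel)"
      unfolding step_iterate_eq[OF f]
      by (intro mult_left_mono nn_integral_mono nn) auto
    also have "\<dots> \<le> (\<integral>\<^sup>+z. (step ^^ k) f (y + z) \<partial>walk_law k)"
      by (rule nn) measurable
    also have "\<dots> = (step ^^ (k + k)) f y"
      by (simp add: funpow_add step_iterate_eq)
    finally show "ennreal (\<eta> * \<eta> * \<epsilon>) * (\<integral>\<^sup>+w. indicator {u - r<..<u + r} w * f (y + w) \<partial>lborel) \<le> (step ^^ (k + k)) f y" .
  qed
qed

text \<open>The set \<open>reach\<close> contains an interval, and its \<open>m\<close>-fold sums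
  fill one of length \<open>2 * m * r\<close>. Once this exceeds a positive element
  \<open>p\<close>, adding multiples of \<open>p\<close> and of a negative element \<open>q\<close>
  covers the line.\<close>

lemma reach_UNIV:
  assumes r: "0 < r" and \<epsilon>: "(0::real) < \<epsilon>"
    and smooth: "\<And>f y. f \<in> borel_measurable borel \<Longrightarrow>
      ennreal \<epsilon> * (\<integral>\<^sup>+w. indicator {u - r<..<u + r} w * f (y + w) \<partial>lborel) \<le> (step ^^ k) f y"
  shows "t \<in> reach"
proof -
  have interval: "s \<in> reach" if s: "u - r < s" "s < u + r" for s
    unfolding reach_def
  proof (intro CollectI allI impI exI[of _ k])
    fix e :: real assume e: "e > 0"
    let ?a = "max (u - r) (s - e)" and ?b = "min (u + r) (s + e)"
    have "0 < ennreal \<epsilon> * ennreal (?b - ?a)" using \<epsilon> s e by (simp add: ennreal_zero_less_mult_iff)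
    also have "ennreal (?b - ?a) = emeasure lborel {?a<..<?b}" using s e r by (subst emeasure_lborel_Ioo) auto
    also have "\<dots> = (\<integral>\<^sup>+w. indicator {?a<..<?b} w \<partial>lborel)" by simp
    also have "\<dots> = (\<integral>\<^sup>+w. indicator {u - r<..<u + r} w * indicator {s - e<..<s + e} (0 + w) \<partial>lborel)"
      by (rule nn_integral_cong) (auto simp: indicator_def)
    also have "ennreal \<epsilon> * \<dots> \<le> (step ^^ k) (indicator {s - e<..<s + e}) 0"
      by (rule smooth) simp
    also have "\<dots> = emeasure (walk_law k) {s - e<..<s + e}" by (simp add: step_iterate_eq)
    finally show "emeasure (walk_law k) {s - e<..<s + e} \<noteq> 0" by simp
  qed
  obtain p where p: "0 < p" "p \<in> reach" using exists_reach_pos[of "\<lambda>_. True"] by auto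
  obtain q where q: "q < 0" "q \<in> reach" using exists_reach_neg[of "\<lambda>_. True"] by auto
  obtain m :: nat where m: "p / (2 * r) < real m" using reals_Archimedean2 by blast
  have mr: "p < 2 * real m * r" using m r by (simp add: field_simps)
  have "0 < p / (2 * r)" using p r by simp
  then have m0: "0 < real m" using m by (rule less_trans)
  obtain j :: nat where j: "(real m * (u - r) - t) / (- q) < real j" using reals_Archimedean2 by blast
  \<comment> \<open>The choice of \<open>j\<close> makes \<open>x\<close> positive, and
    \<open>i\<close> is the largest integer with \<open>i * p < x\<close>. Then
    \<open>x - i * p\<close> is positive and at most \<open>p\<close>, which puts \<open>s\<close>
    strictly inside the \<open>m\<close>-fold window.\<close>
  define x where "x = t - real j * q - real m * (u - r)"
  have x: "0 < x" using j q by (simp add: x_def field_simps)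
  define i where "i = nat (\<lceil>x / p\<rceil> - 1)"
  have "0 < x / p" using x p by simp
  then have "real i = of_int \<lceil>x / p\<rceil> - 1" unfolding i_def by (simp add: of_nat_nat)
  then have "real i < x / p" "x / p \<le> real i + 1" by linarith+
  then have i: "real i * p < x" "x \<le> real i * p + p" using p by (simp_all add: field_simps)
  define s where "s = t - real j * q - real i * p"
  have "u - r < s / real m" "s / real m < u + r"
    using i mr m0 by (simp_all add: s_def x_def field_simps)
  then have "real m * (s / real m) \<in> reach" by (intro reach_mult interval)
  then have "s \<in> reach" using m0 by simp
  then have "s + real i * p + real j * q \<in> reach" by (intro reach_add reach_mult p q)
  then show ?thesis by (simp add: s_def)
qed

lemma lborel_reference: "reference_measure \<mu> lborel"
proof unfold_locales
  show "AE y in \<mu>. \<forall>f\<in>borel_measurable borel. (\<integral>\<^sup>+x. f (x + y) \<partial>lborel) = (\<integral>\<^sup>+x. f x \<partial>lborel :: ennreal)"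
  proof (rule AE_I2, rule ballI)
    fix y :: real and f :: "real \<Rightarrow> ennreal" assume "f \<in> borel_measurable borel"
    then show "(\<integral>\<^sup>+x. f (x + y) \<partial>lborel) = (\<integral>\<^sup>+x. f x \<partial>lborel)"
      using nn_integral_real_affine[of f 1 y] by (simp add: add.commute)
  qed
  show "AE y in \<mu>. emeasure lborel {0..<y} = ennreal y"
  proof (rule AE_I2)
    fix y :: real
    show "emeasure lborel {0..<y} = ennreal y" by (cases "0 \<le> y") (auto simp: ennreal_neg)
  qed
qed simp

lemma spread_out_convergence:
  assumes ns: "\<not> mutually_singular (walk_law k) lborel"
  shows "(\<lambda>n. tv_dist (overshoot_law n x0) (reference_measure.stationary \<mu> lborel)) \<longlonglongrightarrow> 0"
proof -
  interpret RM: reference_measure \<mu> lborel by (rule lborel_reference)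
  obtain u r \<epsilon> :: real where r: "0 < r" and \<epsilon>: "0 < \<epsilon>"
    and smooth: "\<And>f y. f \<in> borel_measurable borel \<Longrightarrow>
      ennreal \<epsilon> * (\<integral>\<^sup>+w. indicator {u - r<..<u + r} w * f (y + w) \<partial>lborel) \<le> (step ^^ (k + k)) f y"
    using spread_out_smoothing[OF ns] by metis
  have reach: "\<exists>n. emeasure (walk_law n) {t - r/2<..<t + r/2} \<noteq> 0" for t
    using reach_UNIV[OF r \<epsilon> smooth, of t] r unfolding reach_def by simp
  have smooth_near: "ennreal \<epsilon> * (\<integral>\<^sup>+z. indicator {c + u - r/2<..<c + u + r/2} z * f z \<partial>lborel) \<le> (step ^^ (k + k)) f y"
    if f[measurable]: "f \<in> borel_measurable borel" and y: "y \<in> {c - r/2<..<c + r/2}" for f y c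
  proof -
    have "(\<integral>\<^sup>+z. indicator {c + u - r/2<..<c + u + r/2} z * f z \<partial>lborel) =
        (\<integral>\<^sup>+w. indicator {c + u - r/2<..<c + u + r/2} (y + w) * f (y + w) \<partial>lborel)"
      using nn_integral_real_affine[of "\<lambda>z. indicator {c + u - r/2<..<c + u + r/2} z * f z" 1 y] by simp
    also have "\<dots> \<le> (\<integral>\<^sup>+w. indicator {u - r<..<u + r} w * f (y + w) \<partial>lborel)"
      by (rule nn_integral_mono) (use y in \<open>auto simp: indicator_def\<close>)
    finally show ?thesis using smooth[OF f, of y] by (meson mult_left_mono order_trans zero_le)
  qed
  \<comment> \<open>With half the radius for both the target set around 0 and \<open>J\<close>, the
    window \<open>y + {u - r<..<u + r}\<close> contains \<open>J\<close> for every \<open>y\<close>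
    in the target. The length \<open>r\<close> of \<open>J\<close> turns \<epsilon> into
    \<open>\<epsilon> * r\<close> for the uniform law.\<close>
  define J where "J = {u - r/2<..<u + r/2}"
  have J: "emeasure lborel J = ennreal r" using r by (simp add: J_def)
  show ?thesis
  proof (rule RM.overshoot_convergence[where W="{0 - r/2<..<0 + r/2}" and \<rho>="uniform_measure lborel J"
        and m="k + k" and c="ennreal \<epsilon> * ennreal r"])
    have "prob_space (uniform_measure lborel J)"
      by (rule prob_space_uniform_measure) (use J r in auto)
    then show "uniform_measure lborel J \<in> space (prob_algebra borel)" by (simp add: space_prob_algebra)
    show "ennreal \<epsilon> * ennreal r \<noteq> 0" using \<epsilon> r by simp
    show "AE x in RM.stationary. \<exists>n. emeasure (walk_law n) {y. x + y \<in> {0 - r/2<..<0 + r/2}} \<noteq> 0"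
    proof (rule AE_I2)
      fix x :: real
      have "{y. x + y \<in> {0 - r/2<..<0 + r/2}} = {- x - r/2<..<- x + r/2}" by auto
      then show "\<exists>n. emeasure (walk_law n) {y. x + y \<in> {0 - r/2<..<0 + r/2}} \<noteq> 0" using reach[of "- x"] by simp
    qed
    show "ennreal \<epsilon> * ennreal r * (\<integral>\<^sup>+z. f z \<partial>uniform_measure lborel J) \<le> (step ^^ (k + k)) f y"
      if f[measurable]: "f \<in> borel_measurable borel" and y: "y \<in> {0 - r/2<..<0 + r/2}" for f y
    proof -
      have Jb: "J \<in> sets lborel" by (simp add: J_def)
      have "(\<integral>\<^sup>+z. f z \<partial>uniform_measure lborel J) = (\<integral>\<^sup>+z. indicator J z * f z \<partial>lborel) / ennreal r"
        by (subst nn_integral_uniform_measure[OF _ Jb]) (simp_all add: J mult.commute)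
      then have "ennreal r * (\<integral>\<^sup>+z. f z \<partial>uniform_measure lborel J) =
          (\<integral>\<^sup>+z. indicator J z * f z \<partial>lborel) * ennreal r / ennreal r"
        by (simp add: ennreal_times_divide mult.commute)
      also have "\<dots> = (\<integral>\<^sup>+z. indicator J z * f z \<partial>lborel)"
        by (rule mult_divide_eq_ennreal) (use r in auto)
      finally have "ennreal r * (\<integral>\<^sup>+z. f z \<partial>uniform_measure lborel J) = (\<integral>\<^sup>+z. indicator J z * f z \<partial>lborel)" .
      then show ?thesis using smooth_near[OF f y] by (simp add: mult.assoc J_def)
    qed
    show "G x0 = 0" if G[measurable]: "G \<in> borel_measurable borel" and G1: "\<And>x. G x \<le> 1"
      and harm: "\<And>x. step G x = G x" and AE0: "AE x in RM.stationary. G x = 0" for G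
    proof -
      note iter = step_iterate_fixed[of G, OF harm]
      interpret S: prob_space RM.stationary by (rule RM.prob_space_stationary)
      obtain x1 where x1: "G x1 = 0"
        using eventually_happens'[OF S.ae_filter_bot AE0] by auto
      \<comment> \<open>A nonnegative harmonic \<open>G\<close> with \<open>G x1 = 0\<close> has no
        mass on an interval over which the walk from \<open>x1\<close> spreads: some number of steps
        brings it near \<open>s\<close>, after which the smoothing covers the interval around
        \<open>c\<close>.\<close>
      have zero: "(\<integral>\<^sup>+z. indicator {c - r/2<..<c + r/2} z * G z \<partial>lborel) = 0" for c
      proof -
        define s where "s = c - u - x1"
        obtain n where n: "emeasure (walk_law n) {s - r/2<..<s + r/2} \<noteq> 0" using reach by blast
        define I where "I = ennreal \<epsilon> * (\<integral>\<^sup>+z. indicator {c - r/2<..<c + r/2} z * G z \<partial>lborel)"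
        have "I * emeasure (walk_law n) {s - r/2<..<s + r/2} =
            (\<integral>\<^sup>+a. I * indicator {s - r/2<..<s + r/2} a \<partial>walk_law n)"
          by (subst nn_integral_cmult_indicator) auto
        also have "\<dots> \<le> (\<integral>\<^sup>+a. G (x1 + a) \<partial>walk_law n)"
        proof (rule nn_integral_mono)
          fix a
          have "I \<le> G (x1 + a)" if "a \<in> {s - r/2<..<s + r/2}"
            using smooth_near[OF G, of "x1 + a" "x1 + s"] that by (simp add: iter I_def s_def)
          then show "I * indicator {s - r/2<..<s + r/2} a \<le> G (x1 + a)" by (simp add: indicator_def)
        qed
        also have "\<dots> = 0" using step_iterate_eq[OF G, of n x1] by (simp add: iter x1)
        finally have "I = 0" using n by simp
        then show ?thesis using \<epsilon> by (simp add: I_def)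
      qed
      have "AE z in lborel. G z = 0"
      proof -
        have "AE z in lborel. z \<in> {c - r/2<..<c + r/2} \<longrightarrow> G z = 0" for c
          using zero[of c] by (subst (asm) nn_integral_0_iff_AE) (auto simp: indicator_def)
        then have "AE z in lborel. \<forall>i::int. z \<in> {of_int i * (r/4) - r/2<..<of_int i * (r/4) + r/2} \<longrightarrow> G z = 0"
          unfolding AE_all_countable by blast
        then show ?thesis
        proof eventually_elim
          case (elim z)
          define i where "i = \<lfloor>z / (r/4)\<rfloor>"
          have "of_int i \<le> z / (r/4)" "z / (r/4) < of_int i + 1" unfolding i_def by linarith+
          then have "of_int i * (r/4) \<le> z" "z < of_int i * (r/4) + r/4" using r by (simp_all add: field_simps)
          then have "z \<in> {of_int i * (r/4) - r/2<..<of_int i * (r/4) + r/2}" using r by simp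
          then show ?case using elim by blast
        qed
      qed
      \<comment> \<open>From almost everywhere to everywhere: \<open>\<sigma> - G\<close> equals
        \<sigma> almost everywhere, so smoothing gives its iterate at least the value \<kappa> at
        each point. Thus \<open>G + \<kappa> \<le> \<sigma>\<close> at every point, and taking the
        supremum forces \<open>\<kappa> = 0\<close>.\<close>
      define \<sigma> where "\<sigma> = (SUP x. G x)"
      have \<sigma>1: "\<sigma> \<le> 1" unfolding \<sigma>_def by (rule SUP_least) (rule G1)
      have G\<sigma>: "G x \<le> \<sigma>" for x unfolding \<sigma>_def by (rule SUP_upper) simp
      define \<kappa> where "\<kappa> = ennreal (\<epsilon> * (2 * r)) * \<sigma>"
      have "G y + \<kappa> \<le> \<sigma>" for y
      proof -
        interpret Wk: prob_space "walk_law (k + k)" by (rule prob_space_walk_law)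
        have "(step ^^ (k + k)) (\<lambda>z. \<sigma> - G z) y + G y = (step ^^ (k + k)) (\<lambda>z. \<sigma> - G z) y + (step ^^ (k + k)) G y"
          by (simp add: iter)
        also have "\<dots> = (\<integral>\<^sup>+a. (\<sigma> - G (y + a)) + G (y + a) \<partial>walk_law (k + k))"
          by (subst (1 2) step_iterate_eq, measurable, rule nn_integral_add[symmetric]) measurable
        also have "\<dots> = (\<integral>\<^sup>+a. \<sigma> \<partial>walk_law (k + k))"
          by (intro nn_integral_cong diff_add_cancel_ennreal G\<sigma>)
        also have "\<dots> = \<sigma>" using Wk.emeasure_space_1 by simp
        finally have 1: "(step ^^ (k + k)) (\<lambda>z. \<sigma> - G z) y + G y = \<sigma>" .
        have "AE w in lborel. G (y + w) = 0"
        proof -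
          have "(\<integral>\<^sup>+w. G (y + w) \<partial>lborel) = (\<integral>\<^sup>+z. G z \<partial>lborel)"
            using nn_integral_real_affine[of G 1 y] by simp
          also have "\<dots> = 0" using \<open>AE z in lborel. G z = 0\<close> by (subst nn_integral_0_iff_AE) auto
          finally show ?thesis by (subst (asm) nn_integral_0_iff_AE) auto
        qed
        then have "(\<integral>\<^sup>+w. indicator {u - r<..<u + r} w * (\<sigma> - G (y + w)) \<partial>lborel) =
            (\<integral>\<^sup>+w. \<sigma> * indicator {u - r<..<u + r} w \<partial>lborel)"
          by (intro nn_integral_cong_AE) (auto elim!: eventually_mono simp: mult.commute)
        also have "\<dots> = \<sigma> * ennreal (2 * r)"
          by (subst nn_integral_cmult_indicator) (use r in auto)
        finally have "\<kappa> \<le> (step ^^ (k + k)) (\<lambda>z. \<sigma> - G z) y"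
          using smooth[of "\<lambda>z. \<sigma> - G z" y] \<epsilon> r by (simp add: \<kappa>_def ennreal_mult mult_ac)
        then show ?thesis using 1 by (metis add.commute add_left_mono)
      qed
      then have "\<sigma> + \<kappa> \<le> \<sigma>"
        unfolding \<sigma>_def by (subst ennreal_SUP_add_left[symmetric]) (auto intro: SUP_least)
      moreover have "\<sigma> < top" using \<sigma>1 by (rule le_less_trans) simp
      ultimately have "\<kappa> = 0"
        by (metis add.right_neutral ennreal_add_left_cancel_le le_zero_eq less_irrefl infinity_ennreal_def)
      then have "\<sigma> = 0" using \<epsilon> r by (simp add: \<kappa>_def)
      then show ?thesis using G\<sigma>[of x0] by simp
    qed
  qed simp
qed

end

section \<open>Convergence in the two cases\<close>

lemma sets_lattice_measure[simp]: "sets (lattice_measure d) = sets borel"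
  by (simp add: lattice_measure_def)

lemma nn_integral_lattice_measure:
  assumes d: "0 < d" and f[measurable]: "f \<in> borel_measurable borel"
  shows "(\<integral>\<^sup>+x. f x \<partial>lattice_measure d) = ennreal d * (\<integral>\<^sup>+k. f (d * of_int k) \<partial>count_space (UNIV :: int set))"
proof -
  have L: "lattice_set d = range (\<lambda>k::int. d * of_int k)" using d by (simp add: lattice_set_def)
  have m: "(\<lambda>x. x) \<in> scale_measure (ennreal d) (count_space (lattice_set d)) \<rightarrow>\<^sub>M (borel :: real measure)"
    by (rule measurable_cong_sets[THEN equalityD1, THEN subsetD, of "count_space (lattice_set d)" _ borel borel]) auto
  have "(\<integral>\<^sup>+x. f x \<partial>lattice_measure d) = (\<integral>\<^sup>+x. f x \<partial>scale_measure (ennreal d) (count_space (lattice_set d)))"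
    using d by (simp add: lattice_measure_def nn_integral_distr[OF m])
  also have "\<dots> = ennreal d * (\<integral>\<^sup>+x. f x \<partial>count_space (lattice_set d))"
    by (rule nn_integral_scale_measure) simp
  also have "(\<integral>\<^sup>+x. f x \<partial>count_space (lattice_set d)) = (\<integral>\<^sup>+k. f (d * of_int k) \<partial>count_space (UNIV :: int set))"
    by (rule nn_integral_bij_count_space[symmetric]) (use d in \<open>auto simp: L bij_betw_def inj_on_def\<close>)
  finally show ?thesis .
qed

context centred_step
begin

lemma lattice_reference:
  assumes d: "0 < d" and AEL: "AE y in \<mu>. y \<in> lattice_set d"
  shows "reference_measure \<mu> (lattice_measure d)"
proof -
  have L: "lattice_set d = range (\<lambda>k::int. d * of_int k)" using d by (simp add: lattice_set_def)
  have Lb: "- lattice_set d \<in> sets borel" by simp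
  have sf: "sigma_finite_measure (lattice_measure d)"
  proof
    let ?A = "insert (- lattice_set d) (range (\<lambda>k::int. {d * of_int k}))"
    have "emeasure (lattice_measure d) (- lattice_set d) \<noteq> \<infinity>"
      using emeasure_lattice_measure[OF d Lb] by simp
    moreover have "emeasure (lattice_measure d) {d * of_int k} \<noteq> \<infinity>" for k :: int
      using emeasure_lattice_measure[OF d, of "{d * of_int k}"]
      by (simp add: L ennreal_mult_eq_top_iff)
    ultimately show "\<exists>A. countable A \<and> A \<subseteq> sets (lattice_measure d) \<and> \<Union> A = space (lattice_measure d) \<and>
        (\<forall>a\<in>A. emeasure (lattice_measure d) a \<noteq> \<infinity>)"
      using Lb sets_eq_imp_space_eq[OF sets_lattice_measure[of d]]
      by (intro exI[of _ ?A]) (auto simp: L)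
  qed
  have transl: "AE y in \<mu>. \<forall>f\<in>borel_measurable borel.
      (\<integral>\<^sup>+x. f (x + y) \<partial>lattice_measure d) = (\<integral>\<^sup>+x. f x \<partial>lattice_measure d :: ennreal)"
    using AEL
  proof eventually_elim
    case (elim y)
    then obtain j :: int where y: "y = d * of_int j" by (auto simp: L)
    show ?case
    proof
      fix f :: "real \<Rightarrow> ennreal" assume f[measurable]: "f \<in> borel_measurable borel"
      have "(\<integral>\<^sup>+x. f (x + y) \<partial>lattice_measure d) = ennreal d * (\<integral>\<^sup>+k. f (d * of_int (k + j)) \<partial>count_space (UNIV :: int set))"
        by (subst nn_integral_lattice_measure[OF d]) (auto simp: y distrib_left)
      also have "(\<integral>\<^sup>+k. f (d * of_int (k + j)) \<partial>count_space (UNIV :: int set)) =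
          (\<integral>\<^sup>+k. f (d * of_int k) \<partial>count_space (UNIV :: int set))"
        by (rule nn_integral_bij_count_space[of "\<lambda>k. k + j"]) (auto intro!: bij_betw_byWitness[of _ "\<lambda>k. k - j"])
      finally show "(\<integral>\<^sup>+x. f (x + y) \<partial>lattice_measure d) = (\<integral>\<^sup>+x. f x \<partial>lattice_measure d)"
        using nn_integral_lattice_measure[OF d f] by simp
    qed
  qed
  have interval: "AE y in \<mu>. emeasure (lattice_measure d) {0..<y} = ennreal y"
    using AEL
  proof eventually_elim
    case (elim y)
    then obtain j :: int where y: "y = d * of_int j" by (auto simp: L)
    have "{0..<y} \<inter> lattice_set d = (\<lambda>k::int. d * of_int k) ` {0..<j}"
      using d by (auto simp: L y zero_le_mult_iff)
    moreover have "inj_on (\<lambda>k::int. d * of_int k) {0..<j}" using d by (auto simp: inj_on_def)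
    ultimately have "emeasure (count_space UNIV) ({0..<y} \<inter> lattice_set d) = ennreal (real (nat j))"
      by (simp add: emeasure_count_space_finite card_image ennreal_of_nat_eq_real_of_nat)
    then have "emeasure (lattice_measure d) {0..<y} = ennreal (d * real (nat j))"
      using emeasure_lattice_measure[OF d, of "{0..<y}"] d by (simp add: ennreal_mult)
    also have "\<dots> = ennreal y"
      using d by (cases "0 \<le> j") (auto simp: y ennreal_neg mult_nonneg_nonpos)
    finally show ?case .
  qed
  show ?thesis
    by (intro reference_measure.intro centred_step_axioms reference_measure_axioms.intro sf transl interval) simp
qed

text \<open>Single lattice points are hit with positive probability, so the point mass at 0
  minorizes after \<open>m = 0\<close> steps from \<open>W = {0}\<close>. For uniqueness, the walk
  from a lattice zero \<open>x1\<close> of a harmonic \<open>G\<close> hits \<open>x0\<close> with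
  positive probability, so \<open>G x0\<close> must vanish too.\<close>

lemma arithmetic_convergence:
  assumes d: "0 < span_of \<mu>" and x0: "x0 \<in> lattice_set (span_of \<mu>)"
  shows "(\<lambda>n. tv_dist (overshoot_law n x0) (reference_measure.stationary \<mu> (lattice_measure (span_of \<mu>)))) \<longlonglongrightarrow> 0"
proof -
  let ?L = "lattice_set (span_of \<mu>)"
  interpret RM: reference_measure \<mu> "lattice_measure (span_of \<mu>)"
    by (rule lattice_reference[OF d AE_lattice_span])
  have "AE x in lattice_measure (span_of \<mu>). x \<in> ?L"
    using emeasure_lattice_measure[OF d, of "- ?L"]
    by (intro AE_I'[of "- ?L"]) (auto simp: null_sets_def)
  then have AEL: "AE x in RM.stationary. x \<in> ?L"
    unfolding RM.stationary_eq by (subst AE_density) (auto elim: eventually_mono)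
  show ?thesis
  proof (rule RM.overshoot_convergence[where W="{0}" and \<rho>="return borel 0" and m=0 and c=1])
    show "return borel (0::real) \<in> space (prob_algebra borel)"
      by (simp add: space_prob_algebra prob_space_return)
    show "1 * (\<integral>\<^sup>+z. f z \<partial>return borel 0) \<le> (step ^^ 0) f y"
      if "f \<in> borel_measurable borel" "y \<in> {0}" for f y
      using that by (simp add: nn_integral_return)
    show "AE x in RM.stationary. \<exists>n. emeasure (walk_law n) {y. x + y \<in> {0}} \<noteq> 0"
      using AEL
    proof eventually_elim
      case (elim x)
      have "{y. x + y \<in> {0}} = {- x}" by auto
      then show ?case using walk_law_hits_lattice[OF d lattice_set_minus[OF elim]] by simp
    qed
    show "G x0 = 0" if G[measurable]: "G \<in> borel_measurable borel" and G1: "\<And>x. G x \<le> 1"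
      and harm: "\<And>x. step G x = G x" and AE0: "AE x in RM.stationary. G x = 0" for G
    proof -
      note iter = step_iterate_fixed[of G, OF harm]
      interpret S: prob_space RM.stationary by (rule RM.prob_space_stationary)
      have "AE x in RM.stationary. x \<in> ?L \<and> G x = 0" using AEL AE0 by eventually_elim simp
      then obtain x1 where x1: "x1 \<in> ?L" "G x1 = 0"
        using eventually_happens'[OF S.ae_filter_bot] by blast
      have "x0 - x1 \<in> ?L" using lattice_set_add[OF x0 lattice_set_minus[OF x1(1)]] by simp
      then obtain n where n: "emeasure (walk_law n) {x0 - x1} \<noteq> 0"
        using walk_law_hits_lattice[OF d] by blast
      have "G x0 * emeasure (walk_law n) {x0 - x1} = (\<integral>\<^sup>+a. G x0 * indicator {x0 - x1} a \<partial>walk_law n)"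
        by (subst nn_integral_cmult_indicator) auto
      also have "\<dots> \<le> (\<integral>\<^sup>+a. G (x1 + a) \<partial>walk_law n)"
        by (rule nn_integral_mono) (auto simp: indicator_def)
      also have "\<dots> = 0" using step_iterate_eq[OF G, of n x1] by (simp add: iter x1)
      finally show ?thesis using n by simp
    qed
  qed simp_all
qed

end

theorem theorem2:
  fixes M :: "'a measure" and X :: "nat \<Rightarrow> 'a \<Rightarrow> real" and \<mu> :: "real measure"
  defines "\<mu> \<equiv> distr M borel (X 1)"
  assumes "prob_space M"
    and indep: "prob_space.indep_vars M (\<lambda>_. borel) X {1..}"
    and ident: "\<And>n. n \<ge> 1 \<Longrightarrow> distr M borel (X n) = \<mu>"
    and integ: "integrable M (X 1)"
    and pos: "0 < (\<integral>\<omega>. \<bar>X 1 \<omega>\<bar> \<partial>M)"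
    and mean: "(\<integral>\<omega>. X 1 \<omega> \<partial>M) = 0"
    and law: "arithmetic \<mu> \<or> spread_out M X"
  shows "\<forall>x \<in> lattice_set (span_of \<mu>).
    (\<lambda>n. tv_dist (distr M borel (\<lambda>\<omega>. overshoot (\<lambda>k. walk x X k \<omega>) n)) (pi_plus \<mu>))
      \<longlonglongrightarrow> 0"
proof
  fix x assume x: "x \<in> lattice_set (span_of \<mu>)"
  interpret M: prob_space M by fact
  have X1[measurable]: "X 1 \<in> borel_measurable M" using integ by (rule borel_measurable_integrable)
  interpret centred_step \<mu>
  proof (rule centred_step.intro)
    show "prob_space \<mu>" unfolding \<mu>_def by (rule M.prob_space_distr[OF X1])
    show "centred_step_axioms \<mu>"
    proof
      show "sets \<mu> = sets borel" by (simp add: \<mu>_def)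
      show "integrable \<mu> (\<lambda>y. y)" using integ unfolding \<mu>_def by (subst integrable_distr_eq[OF X1]) simp_all
      show "(\<integral>y. y \<partial>\<mu>) = 0" using mean unfolding \<mu>_def by (subst integral_distr[OF X1]) simp_all
      show "0 < (\<integral>y. \<bar>y\<bar> \<partial>\<mu>)" using pos unfolding \<mu>_def by (subst integral_distr[OF X1]) simp_all
    qed
  qed
  have laws: "distr M borel (\<lambda>\<omega>. overshoot (\<lambda>k. walk x X k \<omega>) n) = overshoot_law n x"
    "distr M borel (walk 0 X n) = walk_law n" for n
    using distr_walk[OF \<open>prob_space M\<close> indep ident] by blast+
  have pi: "pi_plus \<mu> = reference_measure.stationary \<mu> (lattice_measure (span_of \<mu>))"
    if "reference_measure \<mu> (lattice_measure (span_of \<mu>))"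
    by (simp add: pi_plus_def reference_measure.stationary_def[OF that])
  show "(\<lambda>n. tv_dist (distr M borel (\<lambda>\<omega>. overshoot (\<lambda>k. walk x X k \<omega>) n)) (pi_plus \<mu>)) \<longlonglongrightarrow> 0"
  \<comment> \<open>The split follows the span because the span selects the reference measure. At
    span 0 the law is not arithmetic, so \<open>law\<close> leaves the spread-out case, and the
    lattice is the whole line.\<close>
  proof (cases "0 < span_of \<mu>")
    case True
    show ?thesis
      unfolding laws(1) pi[OF lattice_reference[OF True AE_lattice_span]]
      by (rule arithmetic_convergence[OF True x])
  next
    case False
    then have d0: "span_of \<mu> = 0" using span_nonneg by simp
    then have Lb: "lattice_measure (span_of \<mu>) = lborel" by (simp add: lattice_measure_def)
    have "spread_out M X" using law d0 by (simp add: arithmetic_def)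
    then obtain k where "\<not> mutually_singular (walk_law k) lborel"
      unfolding spread_out_def laws(2) by blast
    then show ?thesis
      unfolding laws(1) pi[unfolded Lb, OF lborel_reference] by (rule spread_out_convergence)
  qed
qed

end
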